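(* Let $K_t(\xi,\eta,d\zeta)$ satisfy the usual conditions, i.e. for all $\eta,\xi\in\Gamma_0$ and $t\ge0$, $K_t(\xi,\eta,\cdot)\ge0$ is a finite, non-atomic Borel measure on $\Gamma_0$, and for all $A\in\mathcal{B}(\Gamma_0)$ the map $(t,\xi,\eta)\mapsto K_t(\xi,\eta,A)$ is measurable. Let $Q(t,\eta,A)=\sum_{\xi\subset\eta}\int_{\Gamma_0}\mathbf{1}_A(\eta\backslash\xi\cup\zeta)K_t(\xi,\eta,d\zeta)$ and $q(t,\eta)=Q(t,\eta,\Gamma_0)$. Assume that $K_t(\xi,\eta,d\zeta)$ is absolutely continuous with respect to the Lebesgue-Poisson measure $\lambda$, and that the following hold: (A) For any $\varepsilon>0$, $T>0$ and any compact $B\subset\Gamma_0$ there exists a compact $A\subset\Gamma_0$ such that $\int_0^T Q(r,\eta,A^c)\,dr<\varepsilon$ for all $\eta\in B$. (B) There exist continuous functions $V:\Gamma_0\to\mathbb{R}_+$ and $c:\mathbb{R}_+\to\mathbb{R}_+$ such that $\sum_{\xi\subset\eta}\int_{\Gamma_0}V(\eta\backslash\xi\cup\zeta)K_t(\xi,\eta,d\zeta)\le c(t)V(\eta)+q(t,\eta)V(\eta)$ for all $t\ge0$, $\eta\in\Gamma_0$. (C) For any continuous $F:\Gamma_0\to\mathbb{R}$ with $\sup_{\eta\in\Gamma_0}\frac{|F(\eta)|}{1+V(\eta)}<\infty$ the map $(t,\eta)\mapsto\sum_{\xi\subset\eta}\int_{\Gamma_0}F(\eta\backslash\xi\cup\zeta)K_t(\xi,\eta,d\zeta)$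 is continuous. (D) For any $T>0$ there exists $a(T)>0$ such that $q(t,\eta)\le a(T)V(\eta)$ for all $\eta\in\Gamma_0$ and $t\in[0,T]$. (E) For any $T>0$ there exists $b(T)>0$ such that $q(t,\eta)\ge b(T)q(T,\eta)$ for all $\eta\in\Gamma_0$ and $t\in[0,T]$. Then the adjoint evolution system $U^*(t,s)$, $0\le s\le t$, leaves $L^1(\Gamma_0,d\lambda)$ invariant and is strongly continuous on $L^1(\Gamma_0,d\lambda)$.
   Context: $\Gamma_0=\{\eta\subset\mathbb{R}^d : |\eta|<\infty\}=\bigsqcup_{n\ge0}\Gamma_0^{(n)}$ is the space of finite subsets of $\mathbb{R}^d$, where $|\eta|$ is the cardinality and $\Gamma_0^{(n)}=\{|\eta|=n\}$. $\Gamma_0^{(n)}$ carries the quotient topology under $(x_1,\dots,x_n)\mapsto\{x_1,\dots,x_n\}$ from the set of $n$-tuples of pairwise distinct points, and $\Gamma_0$ the disjoint union topology; it is a locally compact Polish space with Borel $\sigma$-algebra $\mathcal{B}(\Gamma_0)$. We write $\eta\backslash\xi\cup\zeta=(\eta\backslash\xi)\cup\zeta$. The Lebesgue-Poisson measure is $\lambda=\delta_\emptyset+\sum_{n\ge1}\frac1{n!}d^{(n)}x$, where $d^{(n)}x$ is the image on $\Gamma_0^{(n)}$ of Lebesgue measure on $(\mathbb{R}^d)^n$ under $(x_1,\dots,x_n)\mapsto\{x_1,\dots,x_n\}$. Let $P=\sum_{n\ge0}P^{(n)}$ with $P^{(0)}(s,\eta;t,A)=\mathbf{1}_A(\eta)e^{-\int_s^tq(r,\eta)dr}$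 and, for $n\ge0$, $P^{(n+1)}(s,\eta;t,A)=\int_s^te^{-\int_s^rq(\tau,\eta)d\tau}\int_{\Gamma_0}P^{(n)}(r,\omega;t,A)Q(r,\eta,d\omega)\,dr$. On the space $\mathcal{M}(\Gamma_0)$ of finite signed Borel measures with total variation norm, the adjoint evolution system is $U^*(t,s)\mu(A)=\int_{\Gamma_0}P(s,\eta;t,A)\,\mu(d\eta)$, $0\le s\le t$. The space $L^1(\Gamma_0,d\lambda)$ is identified with a subspace of $\mathcal{M}(\Gamma_0)$ via the isometric embedding $R\mapsto R\,d\lambda$. Strong continuity means that $(s,t)\mapsto U^*(t,s)R$ is continuous on $\{0\le s\le t\}$ in $L^1$-norm for each $R\in L^1(\Gamma_0,d\lambda)$. *)

theory Defs
  imports "HOL-Analysis.Analysis" "HOL-Library.FSet"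
begin

section \<open>The space of finite configurations\<close>

text \<open>The type \<open>'a fset\<close> with \<open>'a\<close> a Euclidean space is the space \<open>\<Gamma>\<^sub>0\<close>. An \<open>n\<close>-tuple is an extensional
  function on \<open>{..<n}\<close>.\<close>

definition distinct_tuples :: "nat \<Rightarrow> (nat \<Rightarrow> 'a :: topological_space) topology" where
  "distinct_tuples n = subtopology (product_topology (\<lambda>_. euclidean) {..<n}) {x. inj_on x {..<n}}"

definition config_of :: "nat \<Rightarrow> (nat \<Rightarrow> 'a) \<Rightarrow> 'a fset" where
  "config_of n x = Abs_fset (x ` {..<n})"

lemma fset_config_of [simp]: "fset (config_of n x) = x ` {..<n}"
  by (simp add: config_of_def Abs_fset_inverse)

lemma topspace_distinct_tuples:
  "topspace (distinct_tuples n) = {x \<in> PiE {..<n} (\<lambda>_. UNIV). inj_on x {..<n}}"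
  by (auto simp: distinct_tuples_def)

lemma fcard_config_of: "x \<in> topspace (distinct_tuples n) \<Longrightarrow> fcard (config_of n x) = n"
  by (simp add: topspace_distinct_tuples fcard.rep_eq card_image)

text \<open>The disjoint union of the quotient topologies; see \<open>open_fcard_eq\<close> and
  \<open>quotient_map_config_of\<close> below.\<close>

instantiation fset :: (topological_space) topological_space
begin

definition open_fset :: "'a fset set \<Rightarrow> bool" where
  "open_fset U \<longleftrightarrow> (\<forall>n. openin (distinct_tuples n) {x \<in> topspace (distinct_tuples n). config_of n x \<in> U})"

instance
proof
  show "open (UNIV :: 'a fset set)"
    by (simp add: open_fset_def)
next
  fix S T :: "'a fset set"
  assume "open S" "open T"
  then have "openin (distinct_tuples n) ({x \<in> topspace (distinct_tuples n). config_of n x \<in> S}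
      \<inter> {x \<in> topspace (distinct_tuples n). config_of n x \<in> T})" for n
    by (auto simp: open_fset_def)
  moreover have "{x \<in> topspace (distinct_tuples n). config_of n x \<in> S}
      \<inter> {x \<in> topspace (distinct_tuples n). config_of n x \<in> T}
      = {x \<in> topspace (distinct_tuples n). config_of n x \<in> S \<inter> T}" for n
    by auto
  ultimately show "open (S \<inter> T)"
    by (simp add: open_fset_def)
next
  fix K :: "'a fset set set"
  assume "\<forall>S\<in>K. open S"
  then have "openin (distinct_tuples n)
      (\<Union>S\<in>K. {x \<in> topspace (distinct_tuples n). config_of n x \<in> S})" for n
    by (intro openin_Union) (auto simp: open_fset_def)
  moreover have "(\<Union>S\<in>K. {x \<in> topspace (distinct_tuples n). config_of n x \<in> S})
      = {x \<in> topspace (distinct_tuples n). config_of n x \<in> \<Union>K}" for n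
    by auto
  ultimately show "open (\<Union>K)"
    by (simp add: open_fset_def)
qed

end

lemma open_fcard_eq: "open {\<eta> :: 'a :: topological_space fset. fcard \<eta> = n}"
proof -
  have "{x \<in> topspace (distinct_tuples m). config_of m x \<in> {\<eta> :: 'a fset. fcard \<eta> = n}} =
      (if m = n then topspace (distinct_tuples m) else {})" for m
    by (auto simp: fcard_config_of)
  then show ?thesis
    by (simp add: open_fset_def)
qed

lemma ex_config_of:
  fixes \<eta> :: "'a :: topological_space fset"
  assumes "fcard \<eta> = n"
  shows "\<exists>x \<in> topspace (distinct_tuples n). config_of n x = \<eta>"
proof -
  have "card {..<n} = card (fset \<eta>)"
    using assms by (simp add: fcard.rep_eq)
  then obtain f where f: "bij_betw f {..<n} (fset \<eta>)"
    by (metis finite_fset finite_lessThan finite_same_card_bij)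
  then have g: "restrict f {..<n} ` {..<n} = fset \<eta>" "inj_on (restrict f {..<n}) {..<n}"
    by (auto simp: bij_betw_def inj_on_def)
  then have "restrict f {..<n} \<in> topspace (distinct_tuples n)"
    by (auto simp: topspace_distinct_tuples)
  moreover have "config_of n (restrict f {..<n}) = \<eta>"
    using g(1) by (metis fset_config_of fset_inject)
  ultimately show ?thesis by blast
qed

lemma quotient_map_config_of:
  "quotient_map (distinct_tuples n)
     (top_of_set {\<eta> :: 'a :: topological_space fset. fcard \<eta> = n}) (config_of n)"
  unfolding quotient_map_def
proof (intro conjI allI impI)
  show "config_of n ` topspace (distinct_tuples n) =
      topspace (top_of_set {\<eta> :: 'a fset. fcard \<eta> = n})"
  proof (intro equalityI subsetI)
    fix \<eta> :: "'a fset"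
    assume "\<eta> \<in> topspace (top_of_set {\<eta>. fcard \<eta> = n})"
    then show "\<eta> \<in> config_of n ` topspace (distinct_tuples n)"
      using ex_config_of[of \<eta> n] by force
  qed (auto simp: fcard_config_of)
next
  fix U :: "'a fset set"
  assume "U \<subseteq> topspace (top_of_set {\<eta>. fcard \<eta> = n})"
  then have U: "U \<subseteq> {\<eta>. fcard \<eta> = n}" by simp
  have *: "{x \<in> topspace (distinct_tuples m). config_of m x \<in> U} = {}" if "m \<noteq> n" for m
    using U that by (auto simp: fcard_config_of)
  have "openin (top_of_set {\<eta>. fcard \<eta> = n}) U \<longleftrightarrow> open U"
    using U open_fcard_eq openin_open_eq by blast
  also have "\<dots> \<longleftrightarrow> openin (distinct_tuples n) {x \<in> topspace (distinct_tuples n). config_of n x \<in> U}"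
    unfolding open_fset_def using * by (metis openin_empty)
  finally show "openin (distinct_tuples n) {x \<in> topspace (distinct_tuples n). config_of n x \<in> U} =
      openin (top_of_set {\<eta>. fcard \<eta> = n}) U" by simp
qed

subsection \<open>The Lebesgue--Poisson measure\<close>

text \<open>The image of Lebesgue measure on pairwise distinct \<open>n\<close>-tuples.\<close>

definition lebesgue_config :: "nat \<Rightarrow> 'a :: euclidean_space fset measure" where
  "lebesgue_config n =
     distr (restrict_space (PiM {..<n} (\<lambda>_. lborel)) {x. inj_on x {..<n}}) borel (config_of n)"

definition lebesgue_poisson :: "'a :: euclidean_space fset measure" where
  "lebesgue_poisson = measure_of UNIV (sets borel)
     (\<lambda>A. indicator A {||} + (\<Sum>n. ennreal (1 / fact (Suc n)) * emeasure (lebesgue_config (Suc n)) A))"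

lemma sets_lebesgue_poisson [simp, measurable_cong]: "sets lebesgue_poisson = sets borel"
  using sets.sigma_sets_eq[of borel] by (simp add: lebesgue_poisson_def)

lemma space_lebesgue_poisson [simp]: "space lebesgue_poisson = UNIV"
  by (simp add: lebesgue_poisson_def)

lemma emeasure_lebesgue_poisson:
  assumes A: "A \<in> sets borel"
  shows "emeasure lebesgue_poisson A =
    indicator A {||} + (\<Sum>n. ennreal (1 / fact (Suc n)) * emeasure (lebesgue_config (Suc n)) A)"
proof (rule emeasure_measure_of[OF lebesgue_poisson_def])
  have swap: "(\<Sum>i n. f n i) = (\<Sum>n i. f n i)" for f :: "nat \<Rightarrow> nat \<Rightarrow> ennreal"
    using nn_integral_suminf[of f "count_space UNIV"] by (simp add: nn_integral_count_space_nat)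
  let ?\<mu> = "\<lambda>A. indicator A {||} +
      (\<Sum>n. ennreal (1 / fact (Suc n)) * emeasure (lebesgue_config (Suc n)) (A :: 'a fset set))"
  show "positive (sets lebesgue_poisson) ?\<mu>"
    by (simp add: positive_def)
  show "countably_additive (sets lebesgue_poisson) ?\<mu>"
  proof (rule countably_additiveI)
    fix B :: "nat \<Rightarrow> 'a fset set"
    assume B: "range B \<subseteq> sets lebesgue_poisson" "disjoint_family B"
    have 1: "(\<Sum>i. indicator (B i) {||}) = (indicator (\<Union>i. B i) {||} :: ennreal)"
      by (rule suminf_indicator[OF B(2)])
    have 2: "(\<Sum>i. emeasure (lebesgue_config n) (B i)) = emeasure (lebesgue_config n) (\<Union>i. B i)" for n
      using B by (intro suminf_emeasure) (auto simp: lebesgue_config_def)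
    have "(\<Sum>i. ?\<mu> (B i)) = (\<Sum>i. indicator (B i) {||}) +
        (\<Sum>i n. ennreal (1 / fact (Suc n)) * emeasure (lebesgue_config (Suc n)) (B i))"
      by (subst suminf_add) auto
    also have "(\<Sum>i n. ennreal (1 / fact (Suc n)) * emeasure (lebesgue_config (Suc n)) (B i)) =
        (\<Sum>n i. ennreal (1 / fact (Suc n)) * emeasure (lebesgue_config (Suc n)) (B i))"
      by (rule swap)
    also have "\<dots> = (\<Sum>n. ennreal (1 / fact (Suc n)) * emeasure (lebesgue_config (Suc n)) (\<Union>i. B i))"
      by (simp only: ennreal_suminf_cmult 2)
    finally show "(\<Sum>i. ?\<mu> (B i)) = ?\<mu> (\<Union>i. B i)"
      by (simp only: 1)
  qed
qed (use A in auto)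

lemma sets_PiM_openin:
  fixes T :: "(nat \<Rightarrow> 'a :: second_countable_topology) set"
  assumes T: "openin (product_topology (\<lambda>_. euclidean) {..<n}) T"
  shows "T \<in> sets (PiM {..<n} (\<lambda>_. borel))"
proof -
  obtain B :: "'a set set" where B: "countable B" "topological_basis B"
    using ex_countable_basis by blast
  define C where "C = {R \<in> PiE {..<n} ` PiE {..<n} (\<lambda>_. B). R \<subseteq> T}"
  have "countable C"
    unfolding C_def using B by (intro countable_Collect countable_image countable_PiE) auto
  moreover have "R \<in> sets (PiM {..<n} (\<lambda>_. borel))" if "R \<in> C" for R
    using that topological_basis_open[OF B(2)]
    by (auto simp: C_def PiE_iff intro!: sets_PiM_I_finite borel_open)
  moreover have "T = \<Union>C"
  proof (intro equalityI subsetI)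
    fix x assume "x \<in> T"
    then have "\<exists>U. (\<forall>i\<in>{..<n}. open (U i)) \<and> x \<in> PiE {..<n} U \<and> PiE {..<n} U \<subseteq> T"
      using T by (auto simp: openin_product_topology_alt)
    then obtain U where U: "\<And>i. i < n \<Longrightarrow> open (U i)" "x \<in> PiE {..<n} U" "PiE {..<n} U \<subseteq> T"
      by blast
    have "\<exists>b. b \<in> B \<and> x i \<in> b \<and> b \<subseteq> U i" if "i < n" for i
      using topological_basisE[OF B(2) U(1)[OF that], of "x i"] U(2) that
      by (metis PiE_mem lessThan_iff)
    then obtain b where b: "\<And>i. i < n \<Longrightarrow> b i \<in> B \<and> x i \<in> b i \<and> b i \<subseteq> U i"
      by metis
    have "PiE {..<n} (restrict b {..<n}) \<subseteq> PiE {..<n} U" "x \<in> PiE {..<n} (restrict b {..<n})"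
      using b U(2) by (auto simp: PiE_iff) blast
    moreover have "restrict b {..<n} \<in> PiE {..<n} (\<lambda>_. B)"
      using b by auto
    ultimately have "PiE {..<n} (restrict b {..<n}) \<in> C"
      using U(3) unfolding C_def by (intro CollectI conjI imageI) auto
    then show "x \<in> \<Union>C"
      using \<open>x \<in> PiE {..<n} (restrict b {..<n})\<close> by (rule UnionI)
  next
    fix x assume "x \<in> \<Union>C"
    then show "x \<in> T"
      unfolding C_def by blast
  qed
  ultimately show ?thesis
    using sets.countable_Union[of C] by (simp add: subset_eq)
qed

lemma measurable_config_of:
  "config_of n \<in> borel_measurable
     (restrict_space (PiM {..<n} (\<lambda>_. lborel :: 'a :: euclidean_space measure)) {x. inj_on x {..<n}})"
proof (rule borel_measurableI)
  let ?M = "PiM {..<n} (\<lambda>_. lborel :: 'a measure)"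
  fix U :: "'a fset set" assume "open U"
  then have "openin (distinct_tuples n) {x \<in> topspace (distinct_tuples n). config_of n x \<in> U}"
    by (simp add: open_fset_def)
  then have "\<exists>T. openin (product_topology (\<lambda>_. euclidean) {..<n}) T \<and>
    {x \<in> topspace (distinct_tuples n). config_of n x \<in> U} = T \<inter> {x. inj_on x {..<n}}"
    by (subst (asm) distinct_tuples_def) (simp only: openin_subtopology)
  then obtain T where T: "openin (product_topology (\<lambda>_. euclidean) {..<n}) T"
    "{x \<in> topspace (distinct_tuples n). config_of n x \<in> U} = T \<inter> {x. inj_on x {..<n}}"
    by blast
  have "sets ?M = sets (PiM {..<n} (\<lambda>_. borel))"
    by (intro sets_PiM_cong) auto
  then have "T \<in> sets ?M"
    using sets_PiM_openin[OF T(1)] by simp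
  moreover have "config_of n -` U \<inter> space (restrict_space ?M {x. inj_on x {..<n}}) =
      {x \<in> topspace (distinct_tuples n). config_of n x \<in> U}"
    by (auto simp: space_restrict_space space_PiM topspace_distinct_tuples)
  ultimately show "config_of n -` U \<inter> space (restrict_space ?M {x. inj_on x {..<n}}) \<in>
      sets (restrict_space ?M {x. inj_on x {..<n}})"
    using T(2) by (auto simp: sets_restrict_space)
qed

subsection \<open>Measurability of unions\<close>

lemma open_not_fmember: "open {\<zeta>. (y :: 'a :: t1_space) |\<notin>| \<zeta>}"
  unfolding open_fset_def
proof
  fix n
  have "openin (distinct_tuples n) {x \<in> topspace (distinct_tuples n). x i \<in> - {y}}" if "i < n" for i
    by (rule openin_continuous_map_preimage[where Y = euclidean])
      (auto simp: distinct_tuples_def that open_openin[symmetric]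
        intro!: continuous_map_from_subtopology continuous_map_product_coordinates)
  then have "openin (distinct_tuples n)
      (topspace (distinct_tuples n) \<inter> (\<Inter>i\<in>{..<n}. {x \<in> topspace (distinct_tuples n). x i \<in> - {y}}))"
    by (intro openin_Int_Inter) auto
  moreover have "topspace (distinct_tuples n) \<inter> (\<Inter>i\<in>{..<n}. {x \<in> topspace (distinct_tuples n). x i \<in> - {y}})
      = {x \<in> topspace (distinct_tuples n). config_of n x \<in> {\<zeta>. y |\<notin>| \<zeta>}}"
    by auto
  ultimately show "openin (distinct_tuples n)
      {x \<in> topspace (distinct_tuples n). config_of n x \<in> {\<zeta>. y |\<notin>| \<zeta>}}"
    by simp
qed

lemma continuous_on_finsert: "continuous_on {\<zeta>. (y :: 'a :: t1_space) |\<notin>| \<zeta>} (finsert y)"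
  unfolding continuous_on_open_vimage[OF open_not_fmember]
proof (intro allI impI)
  fix U :: "'a fset set" assume U: "open U"
  show "open (finsert y -` U \<inter> {\<zeta>. y |\<notin>| \<zeta>})"
    unfolding open_fset_def
  proof
    fix n
    define W where "W = {x \<in> topspace (distinct_tuples n). config_of n x \<in> {\<zeta>. y |\<notin>| \<zeta>}}"
    have W: "openin (distinct_tuples n) W"
      using open_not_fmember[of y] by (simp add: open_fset_def W_def)
    let ?h = "\<lambda>x :: nat \<Rightarrow> 'a. x(n := y)"
    have "continuous_map (subtopology (distinct_tuples n) W) (product_topology (\<lambda>_. euclidean) {..<Suc n}) ?h"
      unfolding continuous_map_componentwise
    proof (intro conjI ballI)
      show "?h ` topspace (subtopology (distinct_tuples n) W) \<subseteq> extensional {..<Suc n}"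
        by (auto simp: topspace_distinct_tuples PiE_iff extensional_def)
    next
      fix k assume "k \<in> {..<Suc n}"
      then show "continuous_map (subtopology (distinct_tuples n) W) euclidean (\<lambda>x. ?h x k)"
        by (cases "k = n") (auto simp: distinct_tuples_def
            intro!: continuous_map_from_subtopology continuous_map_product_coordinates)
    qed
    moreover have h: "inj_on (?h x) {..<Suc n}" if "x \<in> W" for x
      using that unfolding W_def topspace_distinct_tuples lessThan_Suc
      by (auto simp: inj_on_def)
    ultimately have "continuous_map (subtopology (distinct_tuples n) W) (distinct_tuples (Suc n)) ?h"
      unfolding distinct_tuples_def[of "Suc n"] continuous_map_in_subtopology by auto
    then have 1: "openin (subtopology (distinct_tuples n) W)
       {x \<in> topspace (subtopology (distinct_tuples n) W).
          ?h x \<in> {x \<in> topspace (distinct_tuples (Suc n)). config_of (Suc n) x \<in> U}}"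
      using U by (intro openin_continuous_map_preimage) (auto simp: open_fset_def)
    have 2: "config_of (Suc n) (?h x) = finsert y (config_of n x)" for x
    proof -
      have "?h x ` {..<n} = x ` {..<n}"
        by (rule image_cong) auto
      then have "fset (config_of (Suc n) (?h x)) = fset (finsert y (config_of n x))"
        by (simp only: fset_config_of lessThan_Suc image_insert fun_upd_same finsert.rep_eq)
      then show ?thesis
        by (simp only: fset_inject)
    qed
    have 3: "?h x \<in> topspace (distinct_tuples (Suc n))" if "x \<in> W" for x
      using that h[OF that] by (auto simp: W_def topspace_distinct_tuples PiE_iff extensional_def)
    have "openin (distinct_tuples n) {x \<in> topspace (subtopology (distinct_tuples n) W).
          ?h x \<in> {x \<in> topspace (distinct_tuples (Suc n)). config_of (Suc n) x \<in> U}}"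
      using 1 openin_open_subtopology[OF W] by blast
    also have "{x \<in> topspace (subtopology (distinct_tuples n) W).
          ?h x \<in> {x \<in> topspace (distinct_tuples (Suc n)). config_of (Suc n) x \<in> U}}
        = {x \<in> topspace (distinct_tuples n). config_of n x \<in> finsert y -` U \<inter> {\<zeta>. y |\<notin>| \<zeta>}}"
      using 2 3 by (auto simp del: fun_upd_apply simp: W_def)
    finally show "openin (distinct_tuples n)
       {x \<in> topspace (distinct_tuples n). config_of n x \<in> finsert y -` U \<inter> {\<zeta>. y |\<notin>| \<zeta>}}" .
  qed
qed

lemma borel_measurable_finsert: "finsert (y :: 'a :: t1_space) \<in> borel_measurable borel"
proof -
  have "(\<lambda>\<zeta>. if \<zeta> \<in> {\<zeta>. y |\<in>| \<zeta>} then \<zeta> else finsert y \<zeta>) \<in> borel_measurable borel"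
  proof (rule borel_measurable_continuous_on_if)
    have "- {\<zeta>. y |\<notin>| \<zeta>} \<in> sets borel"
      by (intro borel_comp borel_open open_not_fmember)
    then show "{\<zeta>. y |\<in>| \<zeta>} \<in> sets borel"
      by (simp add: Collect_neg_eq)
    show "continuous_on (- {\<zeta>. y |\<in>| \<zeta>}) (finsert y)"
      using continuous_on_finsert[of y] by (simp add: Collect_neg_eq)
  qed (rule continuous_on_id)
  also have "(\<lambda>\<zeta>. if \<zeta> \<in> {\<zeta>. y |\<in>| \<zeta>} then \<zeta> else finsert y \<zeta>) = finsert y"
    by (intro ext) (auto simp: fset_inject[symmetric])
  finally show ?thesis .
qed

lemma borel_measurable_funion: "(\<lambda>\<zeta>. \<beta> |\<union>| \<zeta>) \<in> borel_measurable (borel :: 'a :: t1_space fset measure)"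
proof (induction \<beta>)
  case empty
  then show ?case by simp
next
  case (insert y \<beta>)
  then show ?case
    using measurable_compose[OF insert.IH borel_measurable_finsert[of y]] by simp
qed

section \<open>Jump kernels\<close>

definition non_atomic :: "'b measure \<Rightarrow> bool" where
  "non_atomic M \<longleftrightarrow> (\<forall>A\<in>sets M. 0 < emeasure M A \<longrightarrow>
     (\<exists>B\<in>sets M. B \<subseteq> A \<and> 0 < emeasure M B \<and> emeasure M B < emeasure M A))"

definition usual_conditions ::
  "(real \<Rightarrow> 'a :: euclidean_space fset \<Rightarrow> 'a fset \<Rightarrow> 'a fset measure) \<Rightarrow> bool" where
  "usual_conditions K \<longleftrightarrow>
     (\<forall>t\<ge>0. \<forall>\<xi> \<eta>. sets (K t \<xi> \<eta>) = sets borel \<and> finite_measure (K t \<xi> \<eta>) \<and> non_atomic (K t \<xi> \<eta>)) \<and>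
     (\<forall>A\<in>sets borel. (\<lambda>(t, \<xi>, \<eta>). emeasure (K t \<xi> \<eta>) A)
        \<in> borel_measurable (restrict_space borel {0..} \<Otimes>\<^sub>M borel \<Otimes>\<^sub>M borel))"

text \<open>The kernel \<open>Q(t, \<eta>, \<cdot>)\<close> and its total mass \<open>q(t, \<eta>)\<close>.\<close>

definition jump_kernel ::
  "(real \<Rightarrow> 'a :: euclidean_space fset \<Rightarrow> 'a fset \<Rightarrow> 'a fset measure) \<Rightarrow> real \<Rightarrow> 'a fset \<Rightarrow> 'a fset measure" where
  "jump_kernel K t \<eta> = measure_of UNIV (sets borel)
     (\<lambda>A. \<Sum>\<xi> | \<xi> |\<subseteq>| \<eta>. \<integral>\<^sup>+\<zeta>. indicator A (\<eta> |-| \<xi> |\<union>| \<zeta>) \<partial>K t \<xi> \<eta>)"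

definition jump_rate ::
  "(real \<Rightarrow> 'a :: euclidean_space fset \<Rightarrow> 'a fset \<Rightarrow> 'a fset measure) \<Rightarrow> real \<Rightarrow> 'a fset \<Rightarrow> real" where
  "jump_rate K t \<eta> = measure (jump_kernel K t \<eta>) UNIV"

lemma sets_jump_kernel [simp, measurable_cong]: "sets (jump_kernel K t \<eta>) = sets borel"
  using sets.sigma_sets_eq[of borel] by (simp add: jump_kernel_def)

lemma space_jump_kernel [simp]: "space (jump_kernel K t \<eta>) = UNIV"
  by (simp add: jump_kernel_def)

lemma emeasure_jump_kernel:
  assumes K: "\<And>\<xi>. sets (K t \<xi> \<eta>) = sets borel" and A: "A \<in> sets borel"
  shows "emeasure (jump_kernel K t \<eta>) A =
    (\<Sum>\<xi> | \<xi> |\<subseteq>| \<eta>. \<integral>\<^sup>+\<zeta>. indicator A (\<eta> |-| \<xi> |\<union>| \<zeta>) \<partial>K t \<xi> \<eta>)"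
proof (rule emeasure_measure_of[OF jump_kernel_def])
  let ?D = "\<lambda>\<xi>. distr (K t \<xi> \<eta>) borel (\<lambda>\<zeta>. \<eta> |-| \<xi> |\<union>| \<zeta>)"
  let ?\<mu> = "\<lambda>A. \<Sum>\<xi> | \<xi> |\<subseteq>| \<eta>. \<integral>\<^sup>+\<zeta>. indicator A (\<eta> |-| \<xi> |\<union>| \<zeta>) \<partial>K t \<xi> \<eta>"
  have m: "(\<lambda>\<zeta>. \<eta> |-| \<xi> |\<union>| \<zeta>) \<in> K t \<xi> \<eta> \<rightarrow>\<^sub>M borel" for \<xi>
    using borel_measurable_funion measurable_cong_sets[OF K refl] by blast
  have *: "?\<mu> A = (\<Sum>\<xi> | \<xi> |\<subseteq>| \<eta>. emeasure (?D \<xi>) A)" if "A \<in> sets borel" for A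
  proof (rule sum.cong[OF refl])
    fix \<xi>
    show "(\<integral>\<^sup>+\<zeta>. indicator A (\<eta> |-| \<xi> |\<union>| \<zeta>) \<partial>K t \<xi> \<eta>) = emeasure (?D \<xi>) A"
      using that by (subst nn_integral_distr[OF m, symmetric]) auto
  qed
  show "positive (sets (jump_kernel K t \<eta>)) ?\<mu>"
    by (simp add: positive_def)
  show "countably_additive (sets (jump_kernel K t \<eta>)) ?\<mu>"
  proof (rule countably_additiveI)
    fix B :: "nat \<Rightarrow> 'a fset set"
    assume B: "range B \<subseteq> sets (jump_kernel K t \<eta>)" "disjoint_family B"
    then have "(\<Sum>i. ?\<mu> (B i)) = (\<Sum>i. \<Sum>\<xi> | \<xi> |\<subseteq>| \<eta>. emeasure (?D \<xi>) (B i))"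
      by (intro suminf_cong *) auto
    also have "\<dots> = (\<Sum>\<xi> | \<xi> |\<subseteq>| \<eta>. \<Sum>i. emeasure (?D \<xi>) (B i))"
      by (rule suminf_sum) auto
    also have "\<dots> = (\<Sum>\<xi> | \<xi> |\<subseteq>| \<eta>. emeasure (?D \<xi>) (\<Union>i. B i))"
      using B by (intro sum.cong suminf_emeasure) auto
    also have "\<dots> = ?\<mu> (\<Union>i. B i)"
      using B by (intro *[symmetric]) auto
    finally show "(\<Sum>i. ?\<mu> (B i)) = ?\<mu> (\<Union>i. B i)" .
  qed
qed (use A in auto)

section \<open>The evolution system\<close>

text \<open>The terms \<open>P\<^bsup>(n)\<^esup>(s, \<eta>; t, A)\<close> of the series for the transition function.\<close>

primrec transition_term ::
  "(real \<Rightarrow> 'a :: euclidean_space fset \<Rightarrow> 'a fset \<Rightarrow> 'a fset measure) \<Rightarrow>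
   nat \<Rightarrow> real \<Rightarrow> 'a fset \<Rightarrow> real \<Rightarrow> 'a fset set \<Rightarrow> ennreal" where
  "transition_term K 0 s \<eta> t A = indicator A \<eta> * ennreal (exp (- (LBINT r:{s..t}. jump_rate K r \<eta>)))"
| "transition_term K (Suc n) s \<eta> t A =
     (\<integral>\<^sup>+r\<in>{s..t}. ennreal (exp (- (LBINT \<tau>:{s..r}. jump_rate K \<tau> \<eta>))) *
        (\<integral>\<^sup>+\<omega>. transition_term K n r \<omega> t A \<partial>jump_kernel K r \<eta>) \<partial>lborel)"

definition transition ::
  "(real \<Rightarrow> 'a :: euclidean_space fset \<Rightarrow> 'a fset \<Rightarrow> 'a fset measure) \<Rightarrow>
   real \<Rightarrow> 'a fset \<Rightarrow> real \<Rightarrow> 'a fset set \<Rightarrow> ennreal" where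
  "transition K s \<eta> t A = (\<Sum>n. transition_term K n s \<eta> t A)"

subsection \<open>Finite signed Borel measures\<close>

text \<open>A finite signed Borel measure is a set function that is countably additive on the Borel sets,
  with value 0 elsewhere by convention.\<close>

definition signed_measures :: "('b :: topological_space set \<Rightarrow> real) set" where
  "signed_measures = {\<mu>. (\<forall>A. A \<notin> sets borel \<longrightarrow> \<mu> A = 0) \<and>
     (\<forall>A :: nat \<Rightarrow> 'b set. range A \<subseteq> sets borel \<longrightarrow> disjoint_family A \<longrightarrow>
        (\<lambda>i. \<mu> (A i)) sums \<mu> (\<Union>i. A i))}"

text \<open>The positive part \<open>\<mu>\<^sup>+\<close> of the Jordan decomposition; the negative part is the positive part
  of \<open>- \<mu>\<close>. Note that \<^const>\<open>ennreal\<close> maps negative numbers to 0.\<close>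

definition positive_variation :: "('b :: topological_space set \<Rightarrow> real) \<Rightarrow> 'b measure" where
  "positive_variation \<mu> = measure_of UNIV (sets borel)
     (\<lambda>A. SUP B\<in>{B \<in> sets borel. B \<subseteq> A}. ennreal (\<mu> B))"

definition signed_integral :: "('b :: topological_space set \<Rightarrow> real) \<Rightarrow> ('b \<Rightarrow> real) \<Rightarrow> real" where
  "signed_integral \<mu> f =
     (\<integral>x. f x \<partial>positive_variation \<mu>) - (\<integral>x. f x \<partial>positive_variation (\<lambda>A. - \<mu> A))"

text \<open>The adjoint evolution system \<open>U\<^sup>*(t, s)\<close>.\<close>

definition adjoint_evolution ::
  "(real \<Rightarrow> 'a :: euclidean_space fset \<Rightarrow> 'a fset \<Rightarrow> 'a fset measure) \<Rightarrow>
   real \<Rightarrow> real \<Rightarrow> ('a fset set \<Rightarrow> real) \<Rightarrow> 'a fset set \<Rightarrow> real" where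
  "adjoint_evolution K t s \<mu> = (\<lambda>A. if A \<in> sets borel
     then signed_integral \<mu> (\<lambda>\<eta>. enn2real (transition K s \<eta> t A)) else 0)"

subsection \<open>The subspace \<open>L\<^sup>1\<close>\<close>

text \<open>The embedding \<open>R \<mapsto> R d\<lambda>\<close>.\<close>

definition L1_embed :: "('a :: euclidean_space fset \<Rightarrow> real) \<Rightarrow> 'a fset set \<Rightarrow> real" where
  "L1_embed R = (\<lambda>A. if A \<in> sets borel then LINT \<eta>:A|lebesgue_poisson. R \<eta> else 0)"

definition L1_measures :: "('a :: euclidean_space fset set \<Rightarrow> real) set" where
  "L1_measures = L1_embed ` {R. integrable lebesgue_poisson R}"

lemma L1_measures_subset: "L1_measures \<subseteq> signed_measures"
proof
  fix \<mu> :: "'a fset set \<Rightarrow> real" assume "\<mu> \<in> L1_measures"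
  then obtain R where R: "integrable lebesgue_poisson R" "\<mu> = L1_embed R"
    by (auto simp: L1_measures_def)
  have "(\<lambda>i. L1_embed R (A i)) sums L1_embed R (\<Union>i. A i)"
    if A: "range A \<subseteq> sets borel" "disjoint_family A" for A :: "nat \<Rightarrow> 'a fset set"
  proof -
    have *: "A i \<in> sets borel" "(\<Union>i. A i) \<in> sets borel" for i
      using A by auto
    have int: "set_integrable lebesgue_poisson B R" if "B \<in> sets borel" for B
      unfolding set_integrable_def using R that by (intro integrable_mult_indicator) auto
    have "(\<lambda>n. LINT x:(\<Union>i<n. A i)|lebesgue_poisson. R x)
        \<longlonglongrightarrow> (LINT x:(\<Union>n. \<Union>i<n. A i)|lebesgue_poisson. R x)"
      using * by (intro set_integral_cont_up int) (auto simp: incseq_def intro: less_le_trans)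
    moreover have "(\<Union>n. \<Union>i<n. A i) = (\<Union>i. A i)"
      by auto
    moreover have "(LINT x:(\<Union>i<n. A i)|lebesgue_poisson. R x) = (\<Sum>i<n. LINT x:A i|lebesgue_poisson. R x)" for n
      using * A(2) by (intro set_integral_finite_Union int)
        (auto intro: disjoint_family_on_mono[of "{..<n}" UNIV])
    ultimately have "(\<lambda>i. LINT x:A i|lebesgue_poisson. R x) sums (LINT x:(\<Union>i. A i)|lebesgue_poisson. R x)"
      by (simp add: sums_def)
    then show ?thesis
      using * by (simp add: L1_embed_def)
  qed
  then show "\<mu> \<in> signed_measures"
    by (auto simp: signed_measures_def R L1_embed_def)
qed

lemma positive_variation_L1_embed:
  fixes R :: "'a :: euclidean_space fset \<Rightarrow> real"
  assumes R: "integrable lebesgue_poisson R"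
  shows "positive_variation (L1_embed R) = density lebesgue_poisson (\<lambda>\<eta>. ennreal (R \<eta>))"
proof -
  let ?M = "lebesgue_poisson :: 'a fset measure"
  have Rm[measurable]: "R \<in> borel_measurable ?M"
    using R by auto
  have int: "integrable ?M (\<lambda>\<eta>. indicator B \<eta> * f \<eta>)"
    if "B \<in> sets borel" "integrable ?M f" for B and f :: "'a fset \<Rightarrow> real"
    using integrable_mult_indicator[of B ?M f] that by simp
  have SUP_eq: "(SUP B\<in>{B \<in> sets borel. B \<subseteq> A}. ennreal (L1_embed R B)) =
      emeasure (density ?M (\<lambda>\<eta>. ennreal (R \<eta>))) A" if A: "A \<in> sets borel" for A
  proof (rule antisym)
    have "ennreal (L1_embed R B) \<le> (\<integral>\<^sup>+\<eta>. ennreal (R \<eta>) * indicator A \<eta> \<partial>?M)"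
      if B: "B \<in> sets borel" "B \<subseteq> A" for B
    proof -
      have "L1_embed R B = (\<integral>\<eta>. indicator B \<eta> * R \<eta> \<partial>?M)"
        using B by (simp add: L1_embed_def set_lebesgue_integral_def)
      also have "\<dots> \<le> (\<integral>\<eta>. indicator B \<eta> * max 0 (R \<eta>) \<partial>?M)"
        using B R by (intro integral_mono int integrable_max) (auto simp: indicator_def)
      finally have "ennreal (L1_embed R B) \<le> ennreal (\<integral>\<eta>. indicator B \<eta> * max 0 (R \<eta>) \<partial>?M)"
        by (rule ennreal_leI)
      also have "\<dots> = (\<integral>\<^sup>+\<eta>. ennreal (indicator B \<eta> * max 0 (R \<eta>)) \<partial>?M)"
        using B R by (intro nn_integral_eq_integral[symmetric] int integrable_max) auto
      also have "\<dots> \<le> (\<integral>\<^sup>+\<eta>. ennreal (R \<eta>) * indicator A \<eta> \<partial>?M)"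
        using B by (intro nn_integral_mono) (auto simp: indicator_def max_def ennreal_neg)
      finally show ?thesis .
    qed
    then show "(SUP B\<in>{B \<in> sets borel. B \<subseteq> A}. ennreal (L1_embed R B)) \<le>
        emeasure (density ?M (\<lambda>\<eta>. ennreal (R \<eta>))) A"
      using A by (auto simp: emeasure_density intro!: SUP_least)
  next
    define B where "B = A \<inter> {\<eta> \<in> space ?M. 0 \<le> R \<eta>}"
    have B: "B \<in> sets borel" "B \<subseteq> A"
      using A unfolding B_def sets_lebesgue_poisson[symmetric] by auto
    have "emeasure (density ?M (\<lambda>\<eta>. ennreal (R \<eta>))) A = (\<integral>\<^sup>+\<eta>. ennreal (R \<eta>) * indicator A \<eta> \<partial>?M)"
      using A by (simp add: emeasure_density)
    also have "\<dots> = (\<integral>\<^sup>+\<eta>. ennreal (indicator B \<eta> * R \<eta>) \<partial>?M)"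
      by (intro nn_integral_cong) (auto simp: B_def indicator_def ennreal_neg)
    also have "\<dots> = ennreal (\<integral>\<eta>. indicator B \<eta> * R \<eta> \<partial>?M)"
      using B R by (intro nn_integral_eq_integral int) (auto simp: B_def indicator_def)
    also have "\<dots> = ennreal (L1_embed R B)"
      using B by (simp add: L1_embed_def set_lebesgue_integral_def)
    finally show "emeasure (density ?M (\<lambda>\<eta>. ennreal (R \<eta>))) A \<le>
        (SUP B\<in>{B \<in> sets borel. B \<subseteq> A}. ennreal (L1_embed R B))"
      using B by (auto intro!: SUP_upper)
  qed
  have "positive_variation (L1_embed R) =
      measure_of UNIV (sets borel) (emeasure (density ?M (\<lambda>\<eta>. ennreal (R \<eta>))))"
    unfolding positive_variation_def
    using sets.sigma_sets_eq[of borel] SUP_eq by (intro measure_of_eq) auto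
  also have "\<dots> = density ?M (\<lambda>\<eta>. ennreal (R \<eta>))"
    using measure_of_of_measure[of "density ?M (\<lambda>\<eta>. ennreal (R \<eta>))"] by simp
  finally show ?thesis .
qed

definition L1_invariant ::
  "(real \<Rightarrow> real \<Rightarrow> ('a :: euclidean_space fset set \<Rightarrow> real) \<Rightarrow> 'a fset set \<Rightarrow> real) \<Rightarrow> bool" where
  "L1_invariant U \<longleftrightarrow> (\<forall>s t. 0 \<le> s \<longrightarrow> s \<le> t \<longrightarrow> U t s ` L1_measures \<subseteq> L1_measures)"

text \<open>Here \<open>\<rho> s t\<close> is a density of \<open>U(t, s) (R d\<lambda>)\<close>. Densities are unique up to null sets, so that the
  choice of \<open>\<rho>\<close> does not affect the \<open>L\<^sup>1\<close> distances.\<close>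

definition L1_strongly_continuous ::
  "(real \<Rightarrow> real \<Rightarrow> ('a :: euclidean_space fset set \<Rightarrow> real) \<Rightarrow> 'a fset set \<Rightarrow> real) \<Rightarrow> bool" where
  "L1_strongly_continuous U \<longleftrightarrow> (\<forall>R. integrable lebesgue_poisson R \<longrightarrow>
     (\<exists>\<rho>. (\<forall>s t. 0 \<le> s \<longrightarrow> s \<le> t \<longrightarrow>
              integrable lebesgue_poisson (\<rho> s t) \<and> U t s (L1_embed R) = L1_embed (\<rho> s t)) \<and>
          (\<forall>s\<^sub>0 t\<^sub>0. 0 \<le> s\<^sub>0 \<longrightarrow> s\<^sub>0 \<le> t\<^sub>0 \<longrightarrow>
              ((\<lambda>(s, t). \<integral>\<eta>. \<bar>\<rho> s t \<eta> - \<rho> s\<^sub>0 t\<^sub>0 \<eta>\<bar> \<partial>lebesgue_poisson) \<longlongrightarrow> 0)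
                (at (s\<^sub>0, t\<^sub>0) within {(s, t). 0 \<le> s \<and> s \<le> t}))))"

end

theory Submission
  imports Defs "HOL-Probability.Giry_Monad"
begin

text \<open>
  Write \<open>q\<close> for the jump rate, \<open>Q\<close> for the jump kernel and \<open>P(s, \<eta>; t, A)\<close> for the transition function.
  Both claims are reduced to statements about \<open>P\<close> for a fixed starting configuration \<open>\<eta>\<close>.

  Invariance. If \<open>N\<close> is Lebesgue--Poisson null, then for almost every \<open>\<eta>\<close> no subset \<open>\<beta>\<close> of \<open>\<eta>\<close> can be
  completed to an element of \<open>N\<close> by a set of new points of positive measure: on tuples this is Fubini's
  theorem. Since the \<open>K\<^sub>t(\<xi>, \<eta>, \<cdot>)\<close> are absolutely continuous, \<open>Q(t, \<eta>, N) = 0\<close> for almost every \<open>\<eta>\<close>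
  (\<open>AE_jump_kernel_null\<close>), and one more use of Fubini's theorem, in the jump time, gives
  \<open>P(s, \<eta>; t, N) = 0\<close> for almost every \<open>\<eta>\<close> (\<open>AE_transition_null\<close>). Hence the image of \<open>R d\<lambda>\<close> is
  absolutely continuous, and the Radon--Nikodym theorem provides its density.

  Strong continuity. The \<open>L\<^sup>1\<close> distance of two densities is at most twice the supremum over Borel sets \<open>A\<close>
  of the difference of the two measures at \<open>A\<close> (\<open>integral_abs_diff_le_sets\<close>). So it suffices to bound
  \<open>\<bar>P(s, \<eta>; t, A) - P(s', \<eta>; t', A)\<bar>\<close> uniformly in \<open>A\<close> by a quantity which tends to \<open>0\<close> for every \<open>\<eta>\<close>;
  dominated convergence with the majorant \<open>\<bar>R\<bar>\<close> does the rest. The bound is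
  \<open>(\<bar>s - s'\<bar> + \<bar>t - t'\<bar>) L V(\<eta>)\<close> on every bounded time interval (\<open>transition_lipschitz\<close>). Changing the
  starting time costs at most the probability of a jump between \<open>s\<close> and \<open>s'\<close> out of \<open>\<eta>\<close> itself, and
  \<open>q \<le> a V\<close> makes this small. Changing the final time costs the probability of a jump between \<open>t\<close> and \<open>t'\<close>
  out of the configuration reached at time \<open>t\<close>; its mean is at most \<open>a \<bar>t - t'\<bar>\<close> times the mean of \<open>V\<close> at time
  \<open>t\<close>, which the Lyapunov condition \<open>\<integral> V dQ \<le> (c + q) V\<close> bounds by \<open>e\<^bsup>CT\<^esup> V(\<eta>)\<close>. Without such a condition infinitely
  many jumps could accumulate at time \<open>t\<close> and the evolution could lose mass discontinuously.
  Both estimates are proved for the partial sums of the series defining \<open>P\<close>, which satisfy the backward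
  equation with one term fewer under the integral (\<open>transition_sum_Suc\<close>): the first one splits that
  equation at the later starting time, the second one is an induction on the number of terms.

  All integrals over \<open>Q\<close> must be measurable in time and configuration. This is derived from the continuity
  of \<open>\<integral> F dQ\<close> for bounded continuous \<open>F\<close>: open sets of configurations are cozero sets
  (\<open>open_fset_cozero\<close>), so their indicators are increasing limits of such functions.
\<close>

section \<open>Open sets of configurations and continuous functions\<close>

definition tuple_dist :: "nat \<Rightarrow> (nat \<Rightarrow> 'a :: metric_space) \<Rightarrow> (nat \<Rightarrow> 'a) \<Rightarrow> real" where
  "tuple_dist n x y = (\<Sum>i<n. dist (x i) (y i))"

text \<open>The distance of a tuple to the tuples whose configuration lies outside \<open>U\<close>, truncated at 1; the
  number 1 also keeps the infimum meaningful when there are no such tuples.\<close>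

definition dist_outside :: "'a :: metric_space fset set \<Rightarrow> nat \<Rightarrow> (nat \<Rightarrow> 'a) \<Rightarrow> real" where
  "dist_outside U n x =
     Inf (insert 1 (tuple_dist n x ` {y \<in> topspace (distinct_tuples n). config_of n y \<notin> U}))"

lemma tuple_dist_nonneg: "0 \<le> tuple_dist n x y"
  by (simp add: tuple_dist_def sum_nonneg)

lemma tuple_dist_triangle: "tuple_dist n x z \<le> tuple_dist n x y + tuple_dist n y z"
  unfolding tuple_dist_def sum.distrib[symmetric] by (intro sum_mono dist_triangle)

lemma tuple_dist_commute: "tuple_dist n x y = tuple_dist n y x"
  by (simp add: tuple_dist_def dist_commute)

lemma continuous_map_tuple_dist:
  "continuous_map (distinct_tuples n) euclideanreal (tuple_dist n x)"
proof -
  have *: "continuous_map (distinct_tuples n) euclidean (\<lambda>y. y i)" if "i < n" for i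
    using that by (auto simp: distinct_tuples_def
        intro!: continuous_map_from_subtopology continuous_map_product_coordinates)
  have "continuous_map (distinct_tuples n) euclideanreal (\<lambda>y. dist (x i) (y i))" if "i < n" for i
  proof -
    have "continuous_map euclidean euclideanreal (dist (x i))"
      by (simp add: continuous_on_dist)
    from continuous_map_compose[OF *[OF that] this] show ?thesis
      by (simp add: o_def)
  qed
  then show ?thesis
    unfolding tuple_dist_def[abs_def] by (intro continuous_map_sum) auto
qed

lemma bdd_below_tuple_dist: "bdd_below (insert 1 (tuple_dist n x ` S))"
  by (intro bdd_belowI[of _ 0]) (auto simp: tuple_dist_nonneg)

text \<open>The permutation that turns \<open>x\<close> into \<open>x'\<close> can be applied to every competitor \<open>y\<close> as well. This is why
  the distance to the complement only depends on the configuration.\<close>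

lemma tuple_dist_reorder:
  assumes x: "x \<in> topspace (distinct_tuples n)" "x' \<in> topspace (distinct_tuples n)"
    and eq: "config_of n x = config_of n x'" and y: "y \<in> topspace (distinct_tuples n)"
  shows "\<exists>y' \<in> topspace (distinct_tuples n). config_of n y' = config_of n y \<and>
    tuple_dist n x' y' = tuple_dist n x y"
proof -
  define \<pi> where "\<pi> i = inv_into {..<n} x (x' i)" for i
  have img: "x ` {..<n} = x' ` {..<n}"
    using eq by (metis fset_config_of)
  have "bij_betw (inv_into {..<n} x \<circ> x') {..<n} {..<n}"
    using x img by (intro bij_betw_trans[of _ _ "x ` {..<n}"] bij_betw_inv_into)
      (auto simp: topspace_distinct_tuples bij_betw_def)
  then have \<pi>: "bij_betw \<pi> {..<n} {..<n}"
    by (simp add: \<pi>_def[abs_def] o_def)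
  have x': "x (\<pi> i) = x' i" if "i < n" for i
    unfolding \<pi>_def using that img by (intro f_inv_into_f) auto
  define y' where "y' = restrict (y \<circ> \<pi>) {..<n}"
  have "inj_on y' {..<n}"
    unfolding y'_def inj_on_restrict_eq using \<pi> y
    by (intro comp_inj_on) (auto simp: bij_betw_def topspace_distinct_tuples)
  then have "y' \<in> topspace (distinct_tuples n)"
    by (auto simp: topspace_distinct_tuples y'_def)
  moreover have "config_of n y' = config_of n y"
  proof -
    have "y' ` {..<n} = y ` (\<pi> ` {..<n})"
      by (auto simp: y'_def)
    then show ?thesis
      using \<pi> by (simp add: bij_betw_def flip: fset_inject)
  qed
  moreover have "tuple_dist n x' y' = (\<Sum>i<n. dist (x (\<pi> i)) (y (\<pi> i)))"
    unfolding tuple_dist_def by (intro sum.cong) (auto simp: y'_def x')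
  then have "tuple_dist n x' y' = tuple_dist n x y"
    using sum.reindex_bij_betw[OF \<pi>, of "\<lambda>i. dist (x i) (y i)"] by (simp add: tuple_dist_def)
  ultimately show ?thesis by blast
qed

lemma dist_outside_cong:
  assumes x: "x \<in> topspace (distinct_tuples n)" "x' \<in> topspace (distinct_tuples n)"
    and eq: "config_of n x = config_of n x'"
  shows "dist_outside U n x = dist_outside U n x'"
proof -
  have "tuple_dist n x ` {y \<in> topspace (distinct_tuples n). config_of n y \<notin> U} \<subseteq>
      tuple_dist n x' ` {y \<in> topspace (distinct_tuples n). config_of n y \<notin> U}"
    if "x \<in> topspace (distinct_tuples n)" "x' \<in> topspace (distinct_tuples n)"
      "config_of n x = config_of n x'" for x x' :: "nat \<Rightarrow> 'a"
  proof
    fix r assume "r \<in> tuple_dist n x ` {y \<in> topspace (distinct_tuples n). config_of n y \<notin> U}"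
    then obtain y where y: "r = tuple_dist n x y" "y \<in> topspace (distinct_tuples n)" "config_of n y \<notin> U"
      by blast
    from tuple_dist_reorder[OF that y(2)] y(1,3)
    show "r \<in> tuple_dist n x' ` {y \<in> topspace (distinct_tuples n). config_of n y \<notin> U}"
      by (metis (mono_tags, lifting) image_eqI mem_Collect_eq)
  qed
  note subset_antisym[OF this[OF x eq] this[OF x(2,1) eq[symmetric]]]
  then show ?thesis
    by (simp only: dist_outside_def)
qed

lemma dist_outside_lipschitz:
  "dist_outside U n x \<le> dist_outside U n x' + tuple_dist n x x'"
proof -
  have "dist_outside U n x - tuple_dist n x x' \<le> r"
    if r: "r \<in> insert 1 (tuple_dist n x' ` {y \<in> topspace (distinct_tuples n). config_of n y \<notin> U})" for r
  proof (cases "r = 1")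
    case True
    have "dist_outside U n x \<le> 1"
      unfolding dist_outside_def by (intro cInf_lower bdd_below_tuple_dist) auto
    then show ?thesis using True tuple_dist_nonneg[of n x x'] by simp
  next
    case False
    then obtain y where y: "r = tuple_dist n x' y" "y \<in> topspace (distinct_tuples n)" "config_of n y \<notin> U"
      using r by blast
    then have "dist_outside U n x \<le> tuple_dist n x y"
      unfolding dist_outside_def by (intro cInf_lower bdd_below_tuple_dist) auto
    then show ?thesis using y tuple_dist_triangle[of n x y x'] by simp
  qed
  then have "dist_outside U n x - tuple_dist n x x' \<le> dist_outside U n x'"
    unfolding dist_outside_def[of U n x'] by (intro cInf_greatest) auto
  then show ?thesis by simp
qed

lemma continuous_map_dist_outside:
  "continuous_map (distinct_tuples n) euclideanreal (dist_outside U n)"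
  unfolding continuous_map_def
proof (intro conjI allI impI)
  fix W :: "real set" assume "openin euclideanreal W"
  then have W: "open W" by simp
  show "openin (distinct_tuples n) {x \<in> topspace (distinct_tuples n). dist_outside U n x \<in> W}"
  proof (subst openin_subopen, safe)
    fix x :: "nat \<Rightarrow> 'a" assume x: "x \<in> topspace (distinct_tuples n)" "dist_outside U n x \<in> W"
    obtain e where e: "e > 0" "ball (dist_outside U n x) e \<subseteq> W"
      using W x(2) open_contains_ball by blast
    define T where "T = {y \<in> topspace (distinct_tuples n). tuple_dist n x y \<in> {..<e}}"
    have "openin (distinct_tuples n) T"
      unfolding T_def by (intro openin_continuous_map_preimage[OF continuous_map_tuple_dist]) auto
    moreover have "x \<in> T"
      using x e by (simp add: T_def tuple_dist_def)
    moreover have "dist_outside U n y \<in> W" if "y \<in> T" for y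
    proof -
      have "\<bar>dist_outside U n x - dist_outside U n y\<bar> \<le> tuple_dist n x y"
        using dist_outside_lipschitz[of U n x y] dist_outside_lipschitz[of U n y x]
          tuple_dist_commute[of n x y] by linarith
      then have "dist_outside U n y \<in> ball (dist_outside U n x) e"
        using that by (auto simp: T_def dist_real_def)
      then show ?thesis using e by blast
    qed
    ultimately show "\<exists>T. openin (distinct_tuples n) T \<and> x \<in> T \<and>
        T \<subseteq> {x \<in> topspace (distinct_tuples n). dist_outside U n x \<in> W}"
      by (intro exI[of _ T]) (auto simp: T_def)
  qed
qed simp

lemma dist_outside_pos:
  assumes U: "open U" and x: "x \<in> topspace (distinct_tuples n)" "config_of n x \<in> U"
  shows "0 < dist_outside U n x"
proof -
  have "openin (distinct_tuples n) {x \<in> topspace (distinct_tuples n). config_of n x \<in> U}"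
    using U by (simp add: open_fset_def)
  then have "\<exists>T. openin (product_topology (\<lambda>_. euclidean) {..<n}) T \<and>
    {x \<in> topspace (distinct_tuples n). config_of n x \<in> U} = T \<inter> {x. inj_on x {..<n}}"
    by (subst (asm) distinct_tuples_def) (simp only: openin_subtopology)
  then obtain T where T: "openin (product_topology (\<lambda>_. euclidean) {..<n}) T"
    "{x \<in> topspace (distinct_tuples n). config_of n x \<in> U} = T \<inter> {x. inj_on x {..<n}}"
    by blast
  have "x \<in> T" using x T(2) by blast
  then have "\<exists>W. (\<forall>i\<in>{..<n}. open (W i)) \<and> x \<in> PiE {..<n} W \<and> PiE {..<n} W \<subseteq> T"
    using T(1) by (auto simp: openin_product_topology_alt)
  then obtain W where W: "\<And>i. i < n \<Longrightarrow> open (W i)" "x \<in> PiE {..<n} W" "PiE {..<n} W \<subseteq> T"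
    by blast
  have "\<exists>e>0. ball (x i) e \<subseteq> W i" if "i < n" for i
    using W(1)[OF that] W(2) that open_contains_ball by (metis PiE_mem lessThan_iff)
  then obtain e where e: "\<And>i. i < n \<Longrightarrow> e i > 0 \<and> ball (x i) (e i) \<subseteq> W i"
    by metis
  define \<delta> where "\<delta> = Min (insert 1 (e ` {..<n}))"
  have \<delta>: "0 < \<delta>" "\<delta> \<le> 1" "\<And>i. i < n \<Longrightarrow> \<delta> \<le> e i"
    using e by (auto simp: \<delta>_def)
  have "\<delta> \<le> tuple_dist n x y" if y: "y \<in> topspace (distinct_tuples n)" "config_of n y \<notin> U" for y
  proof (rule ccontr)
    assume *: "\<not> \<delta> \<le> tuple_dist n x y"
    have "y i \<in> W i" if "i < n" for i
    proof -
      have "dist (x i) (y i) \<le> tuple_dist n x y"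
        unfolding tuple_dist_def using that by (intro member_le_sum) auto
      then have "y i \<in> ball (x i) (e i)"
        using * \<delta>(3)[OF that] by auto
      then show ?thesis using e[OF that] by blast
    qed
    then have "y \<in> PiE {..<n} W"
      using y by (auto simp: topspace_distinct_tuples PiE_iff)
    then have "y \<in> T \<inter> {x. inj_on x {..<n}}"
      using W y by (auto simp: topspace_distinct_tuples)
    then show False using T(2) y by blast
  qed
  then have "\<delta> \<le> dist_outside U n x"
    unfolding dist_outside_def using \<delta> by (intro cInf_greatest) auto
  then show ?thesis using \<delta> by simp
qed

text \<open>The distance to the complement does not depend on the enumeration of a configuration, so it descends
  along the quotient maps \<^const>\<open>config_of\<close>.\<close>

lemma open_fset_cozero:
  fixes U :: "'a :: metric_space fset set"
  assumes U: "open U"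
  obtains f :: "'a fset \<Rightarrow> real" where "continuous_on UNIV f" "\<And>\<eta>. 0 \<le> f \<eta>" "\<And>\<eta>. 0 < f \<eta> \<longleftrightarrow> \<eta> \<in> U"
proof -
  define tup :: "'a fset \<Rightarrow> nat \<Rightarrow> 'a" where
    "tup \<eta> = (SOME x. x \<in> topspace (distinct_tuples (fcard \<eta>)) \<and> config_of (fcard \<eta>) x = \<eta>)" for \<eta>
  have tup: "tup \<eta> \<in> topspace (distinct_tuples (fcard \<eta>))" "config_of (fcard \<eta>) (tup \<eta>) = \<eta>" for \<eta>
    using someI_ex[of "\<lambda>x. x \<in> topspace (distinct_tuples (fcard \<eta>)) \<and> config_of (fcard \<eta>) x = \<eta>"]
      ex_config_of[of \<eta>] unfolding tup_def by blast+
  define f where "f \<eta> = dist_outside U (fcard \<eta>) (tup \<eta>)" for \<eta>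
  have f: "f (config_of n x) = dist_outside U n x" if "x \<in> topspace (distinct_tuples n)" for n x
    using dist_outside_cong[of "tup (config_of n x)" n x U] tup[of "config_of n x"]
    by (simp add: f_def fcard_config_of[OF that] that)
  show thesis
  proof
    show "continuous_on UNIV f"
      unfolding continuous_on_open_vimage[OF open_UNIV]
    proof (intro allI impI)
      fix W :: "real set" assume "open W"
      then have "openin (distinct_tuples n) {x \<in> topspace (distinct_tuples n). dist_outside U n x \<in> W}" for n
        by (intro openin_continuous_map_preimage[OF continuous_map_dist_outside]) auto
      moreover have "{x \<in> topspace (distinct_tuples n). dist_outside U n x \<in> W} =
          {x \<in> topspace (distinct_tuples n). config_of n x \<in> f -` W \<inter> UNIV}" for n
        using f by auto
      ultimately show "open (f -` W \<inter> UNIV)"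
        by (simp add: open_fset_def)
    qed
    show nonneg: "0 \<le> f \<eta>" for \<eta>
      unfolding f_def dist_outside_def by (intro cInf_greatest) (auto simp: tuple_dist_nonneg)
    show "0 < f \<eta> \<longleftrightarrow> \<eta> \<in> U" for \<eta>
    proof
      show "0 < f \<eta>" if "\<eta> \<in> U"
        using dist_outside_pos[OF U tup(1)] that tup(2) by (simp add: f_def)
    next
      assume "0 < f \<eta>"
      show "\<eta> \<in> U"
      proof (rule ccontr)
        assume "\<eta> \<notin> U"
        then have "f \<eta> \<le> tuple_dist (fcard \<eta>) (tup \<eta>) (tup \<eta>)"
          unfolding f_def dist_outside_def
          using tup[of \<eta>] by (intro cInf_lower bdd_below_tuple_dist) auto
        then show False using \<open>0 < f \<eta>\<close> by (simp add: tuple_dist_def)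
      qed
    qed
  qed
qed

section \<open>Measurability of the jump kernel\<close>

lemma nn_integral_jump_kernel:
  assumes K: "\<And>\<xi>. sets (K t \<xi> \<eta>) = sets borel" and f: "f \<in> borel_measurable borel"
  shows "(\<integral>\<^sup>+\<omega>. f \<omega> \<partial>jump_kernel K t \<eta>) =
    (\<Sum>\<xi> | \<xi> |\<subseteq>| \<eta>. \<integral>\<^sup>+\<zeta>. f (\<eta> |-| \<xi> |\<union>| \<zeta>) \<partial>K t \<xi> \<eta>)"
proof -
  have [measurable]: "(\<lambda>\<zeta>. \<eta> |-| \<xi> |\<union>| \<zeta>) \<in> K t \<xi> \<eta> \<rightarrow>\<^sub>M borel" for \<xi>
    using borel_measurable_funion measurable_cong_sets[OF K refl] by blast
  show ?thesis
    using f
  proof induction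
    case (cong f g)
    then have "f = g" by auto
    then show ?case using cong by simp
  next
    case (set A)
    then show ?case
      using emeasure_jump_kernel[of K t \<eta> A] K by simp
  next
    case (mult u c)
    note [measurable] = \<open>u \<in> borel_measurable borel\<close>
    show ?case
      using mult by (simp add: nn_integral_cmult sum_distrib_left)
  next
    case (add u v)
    note [measurable] = \<open>u \<in> borel_measurable borel\<close> \<open>v \<in> borel_measurable borel\<close>
    show ?case
      using add by (simp add: nn_integral_add sum.distrib)
  next
    case (seq U)
    note [measurable] = seq(1)
    have inc: "incseq (\<lambda>i. \<integral>\<^sup>+\<zeta>. U i (\<eta> |-| \<xi> |\<union>| \<zeta>) \<partial>K t \<xi> \<eta>)" for \<xi>
      using \<open>incseq U\<close> by (intro incseq_SucI nn_integral_mono) (simp add: incseq_Suc_iff le_fun_def)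
    have "(\<integral>\<^sup>+\<omega>. (SUP i. U i) \<omega> \<partial>jump_kernel K t \<eta>) = (SUP i. \<integral>\<^sup>+\<omega>. U i \<omega> \<partial>jump_kernel K t \<eta>)"
      unfolding SUP_apply using seq by (intro nn_integral_monotone_convergence_SUP) auto
    also have "\<dots> = (SUP i. \<Sum>\<xi> | \<xi> |\<subseteq>| \<eta>. \<integral>\<^sup>+\<zeta>. U i (\<eta> |-| \<xi> |\<union>| \<zeta>) \<partial>K t \<xi> \<eta>)"
      using seq by simp
    also have "\<dots> = (\<Sum>\<xi> | \<xi> |\<subseteq>| \<eta>. SUP i. \<integral>\<^sup>+\<zeta>. U i (\<eta> |-| \<xi> |\<union>| \<zeta>) \<partial>K t \<xi> \<eta>)"
      using inc by (intro ennreal_SUP_sum) auto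
    also have "\<dots> = (\<Sum>\<xi> | \<xi> |\<subseteq>| \<eta>. \<integral>\<^sup>+\<zeta>. (SUP i. U i) (\<eta> |-| \<xi> |\<union>| \<zeta>) \<partial>K t \<xi> \<eta>)"
      unfolding SUP_apply using \<open>incseq U\<close>
      by (intro sum.cong refl nn_integral_monotone_convergence_SUP[symmetric])
        (auto simp: incseq_def le_fun_def)
    finally show ?case .
  qed
qed

text \<open>The function is the pointwise limit of the functions that freeze the time at the grid points
  \<open>\<lfloor>n t\<rfloor> / n\<close>, and these involve only countably many of the functions \<open>f t\<close>.\<close>

lemma borel_measurable_caratheodory:
  fixes f :: "real \<Rightarrow> 'b \<Rightarrow> real"
  assumes meas: "\<And>t. f t \<in> borel_measurable N" and cont: "\<And>\<eta>. continuous_on UNIV (\<lambda>t. f t \<eta>)"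
  shows "(\<lambda>(t, \<eta>). f t \<eta>) \<in> borel_measurable (borel \<Otimes>\<^sub>M N)"
proof -
  \<comment> \<open>The grid points have mesh \<open>1 / (i + 1)\<close>, which avoids a division by zero at \<open>i = 0\<close>.\<close>
  define u where "u i p = (case p of (t, \<eta>) \<Rightarrow> f (of_int \<lfloor>real (Suc i) * t\<rfloor> / real (Suc i)) \<eta>)" for i and p :: "real \<times> 'b"
  show ?thesis
  proof (rule borel_measurable_LIMSEQ_real[of _ u])
    show "u i \<in> borel_measurable (borel \<Otimes>\<^sub>M N)" for i
    proof -
      have "(\<lambda>p. f (of_int j / real (Suc i)) (snd p)) \<in> borel_measurable (borel \<Otimes>\<^sub>M N)" for j :: int
        using meas by measurable
      moreover have "(\<lambda>p :: real \<times> 'b. \<lfloor>real (Suc i) * fst p\<rfloor>) \<in> borel \<Otimes>\<^sub>M N \<rightarrow>\<^sub>M count_space UNIV"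
        by measurable
      ultimately have "(\<lambda>p. f (of_int \<lfloor>real (Suc i) * fst p\<rfloor> / real (Suc i)) (snd p)) \<in> borel_measurable (borel \<Otimes>\<^sub>M N)"
        by (rule measurable_compose_countable)
      then show ?thesis by (simp add: u_def[abs_def] case_prod_unfold)
    qed
    show "(\<lambda>i. u i p) \<longlonglongrightarrow> (case p of (t, \<eta>) \<Rightarrow> f t \<eta>)" for p
    proof (cases p)
      case (Pair t \<eta>)
      have "(\<lambda>i. of_int \<lfloor>real (Suc i) * t\<rfloor> / real (Suc i)) \<longlonglongrightarrow> t"
      proof (rule LIMSEQ_norm_0[of "\<lambda>i. of_int \<lfloor>real (Suc i) * t\<rfloor> / real (Suc i) - t", THEN Lim_null[THEN iffD2]])
        fix i
        have "\<bar>of_int \<lfloor>real (Suc i) * t\<rfloor> - real (Suc i) * t\<bar> < 1"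
          by linarith
        then have "\<bar>of_int \<lfloor>real (Suc i) * t\<rfloor> - real (Suc i) * t\<bar> / real (Suc i) < 1 / real (Suc i)"
          by (intro divide_strict_right_mono) auto
        also have "\<bar>of_int \<lfloor>real (Suc i) * t\<rfloor> - real (Suc i) * t\<bar> / real (Suc i) =
            \<bar>(of_int \<lfloor>real (Suc i) * t\<rfloor> - real (Suc i) * t) / real (Suc i)\<bar>"
          by simp
        also have "(of_int \<lfloor>real (Suc i) * t\<rfloor> - real (Suc i) * t) / real (Suc i) =
            of_int \<lfloor>real (Suc i) * t\<rfloor> / real (Suc i) - t"
          by (simp add: diff_divide_distrib del: of_nat_Suc)
        finally show "norm (of_int \<lfloor>real (Suc i) * t\<rfloor> / real (Suc i) - t) < 1 / real (Suc i)"
          by simp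
      qed
      then show ?thesis
        using continuous_on_tendsto_compose[OF cont[of \<eta>], of "\<lambda>i. of_int \<lfloor>real (Suc i) * t\<rfloor> / real (Suc i)" t]
        by (simp add: Pair u_def)
    qed
  qed
qed

text \<open>The regularity of the jump kernel on which the analysis of the backward equation rests.
  Time runs through all of \<open>\<real>\<close>, which keeps case distinctions on the sign of the time out of the proofs.\<close>

locale jump_evolution =
  fixes K :: "real \<Rightarrow> 'a :: euclidean_space fset \<Rightarrow> 'a fset \<Rightarrow> 'a fset measure"
  assumes emeasure_finite: "emeasure (jump_kernel K t \<eta>) UNIV < \<infinity>"
    and continuous_rate: "continuous_on UNIV (\<lambda>t. jump_rate K t \<eta>)"
    and measurable_open: "open U \<Longrightarrow>
      (\<lambda>(t, \<eta>). emeasure (jump_kernel K t \<eta>) U) \<in> borel_measurable (borel \<Otimes>\<^sub>M borel)"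

text \<open>The indicator of an open set is an increasing limit of continuous functions with values in the unit
  interval, so that the continuity hypothesis turns into measurability by monotone convergence.\<close>

lemma jump_evolutionI:
  assumes sets: "\<And>t \<xi> \<eta>. sets (K t \<xi> \<eta>) = sets borel"
    and fin: "\<And>t \<xi> \<eta>. finite_measure (K t \<xi> \<eta>)"
    and cont: "\<And>F :: 'a :: euclidean_space fset \<Rightarrow> real. continuous_on UNIV F \<Longrightarrow>
      (\<And>\<eta>. 0 \<le> F \<eta> \<and> F \<eta> \<le> 1) \<Longrightarrow>
      continuous_on UNIV (\<lambda>(t, \<eta>). \<Sum>\<xi> | \<xi> |\<subseteq>| \<eta>. \<integral>\<zeta>. F (\<eta> |-| \<xi> |\<union>| \<zeta>) \<partial>K t \<xi> \<eta>)"
  shows "jump_evolution K"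
proof -
  define I where "I F t \<eta> = (\<Sum>\<xi> | \<xi> |\<subseteq>| \<eta>. \<integral>\<zeta>. F (\<eta> |-| \<xi> |\<union>| \<zeta>) \<partial>K t \<xi> \<eta>)"
    for F :: "'a fset \<Rightarrow> real" and t \<eta>
  have [measurable]: "(\<lambda>\<zeta>. \<beta> |\<union>| \<zeta>) \<in> K t \<xi> \<eta> \<rightarrow>\<^sub>M borel" for t \<xi> \<eta> \<beta>
    using borel_measurable_funion measurable_cong_sets[OF sets refl] by blast
  have I: "(\<integral>\<^sup>+\<omega>. ennreal (F \<omega>) \<partial>jump_kernel K t \<eta>) = ennreal (I F t \<eta>)" "0 \<le> I F t \<eta>"
    if F: "continuous_on UNIV F" "\<And>\<eta>. 0 \<le> F \<eta> \<and> F \<eta> \<le> 1" for F t \<eta>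
  proof -
    have [measurable]: "F \<in> borel_measurable borel"
      using F by (intro borel_measurable_continuous_onI)
    have "(\<integral>\<^sup>+\<omega>. ennreal (F \<omega>) \<partial>jump_kernel K t \<eta>) =
        (\<Sum>\<xi> | \<xi> |\<subseteq>| \<eta>. \<integral>\<^sup>+\<zeta>. ennreal (F (\<eta> |-| \<xi> |\<union>| \<zeta>)) \<partial>K t \<xi> \<eta>)"
      by (intro nn_integral_jump_kernel sets) auto
    also have "\<dots> = (\<Sum>\<xi> | \<xi> |\<subseteq>| \<eta>. ennreal (\<integral>\<zeta>. F (\<eta> |-| \<xi> |\<union>| \<zeta>) \<partial>K t \<xi> \<eta>))"
      using F(2) by (intro sum.cong refl nn_integral_eq_integral finite_measure.integrable_const_bound[OF fin, of _ 1])
        auto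
    also have "\<dots> = ennreal (I F t \<eta>)"
      unfolding I_def using F(2) by (intro sum_ennreal integral_nonneg_AE) auto
    finally show "(\<integral>\<^sup>+\<omega>. ennreal (F \<omega>) \<partial>jump_kernel K t \<eta>) = ennreal (I F t \<eta>)" .
    show "0 \<le> I F t \<eta>"
      unfolding I_def using F(2) by (intro sum_nonneg integral_nonneg_AE) auto
  qed
  have cont_I: "continuous_on UNIV (\<lambda>(t, \<eta>). I F t \<eta>)"
    if "continuous_on UNIV F" "\<And>\<eta>. 0 \<le> F \<eta> \<and> F \<eta> \<le> 1" for F
    unfolding I_def using that by (rule cont)
  have cont_t: "continuous_on UNIV (\<lambda>t. I F t \<eta>)" and cont_\<eta>: "continuous_on UNIV (\<lambda>\<eta>. I F t \<eta>)"
    if "continuous_on UNIV F" "\<And>\<eta>. 0 \<le> F \<eta> \<and> F \<eta> \<le> 1" for F t \<eta>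
    using continuous_on_compose2[OF cont_I[OF that], of UNIV "\<lambda>t. (t, \<eta>)"]
      continuous_on_compose2[OF cont_I[OF that], of UNIV "\<lambda>\<eta>. (t, \<eta>)"]
    by (simp_all add: continuous_on_Pair continuous_on_id continuous_on_const)
  have meas_I: "(\<lambda>(t, \<eta>). I F t \<eta>) \<in> borel_measurable (borel \<Otimes>\<^sub>M borel)"
    if "continuous_on UNIV F" "\<And>\<eta>. 0 \<le> F \<eta> \<and> F \<eta> \<le> 1" for F
    using cont_t[OF that] cont_\<eta>[OF that]
    by (intro borel_measurable_caratheodory borel_measurable_continuous_onI)
  have one: "emeasure (jump_kernel K t \<eta>) UNIV = ennreal (I (\<lambda>_. 1) t \<eta>)" for t \<eta>
    using I(1)[of "\<lambda>_. 1" t \<eta>] by simp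
  show ?thesis
  proof
    show "emeasure (jump_kernel K t \<eta>) UNIV < \<infinity>" for t \<eta>
      by (simp add: one)
    have "jump_rate K t \<eta> = I (\<lambda>_. 1) t \<eta>" for t \<eta>
      using I(2)[of "\<lambda>_. 1" t \<eta>] by (simp add: jump_rate_def measure_def one)
    then show "continuous_on UNIV (\<lambda>t. jump_rate K t \<eta>)" for \<eta>
      using cont_t[of "\<lambda>_. 1" \<eta>] by simp
    fix U :: "'a fset set" assume U: "open U"
    then obtain f :: "'a fset \<Rightarrow> real" where f: "continuous_on UNIV f" "\<And>\<eta>. 0 \<le> f \<eta>" "\<And>\<eta>. 0 < f \<eta> \<longleftrightarrow> \<eta> \<in> U"
      by (rule open_fset_cozero) (rule that)
    define F where "F n \<omega> = min 1 (real n * f \<omega>)" for n \<omega>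
    have F: "continuous_on UNIV (F n)" "\<And>\<omega>. 0 \<le> F n \<omega> \<and> F n \<omega> \<le> 1" for n
      unfolding F_def[abs_def] using f by (auto intro!: continuous_intros)
    have F_mono: "F m \<omega> \<le> F n \<omega>" if "m \<le> n" for m n \<omega>
      unfolding F_def using that f(2) by (intro min.mono mult_right_mono) auto
    have Fm: "F n \<in> borel_measurable borel" for n
      using F by (intro borel_measurable_continuous_onI)
    have ind: "indicator U \<omega> = (SUP n. ennreal (F n \<omega>))" for \<omega>
    proof (cases "\<omega> \<in> U")
      case True
      then obtain n where "1 < real n * f \<omega>"
        using f(3) reals_Archimedean3 by blast
      then have "ennreal (F n \<omega>) = 1"
        by (simp add: F_def)
      then have "1 \<le> (SUP n. ennreal (F n \<omega>))"
        by (metis SUP_upper UNIV_I)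
      moreover have "(SUP n. ennreal (F n \<omega>)) \<le> 1"
        using F(2) by (intro SUP_least) (simp add: ennreal_le_1)
      ultimately show ?thesis using True by simp
    next
      case False
      then have "f \<omega> = 0" using f(2,3) by (metis less_eq_real_def)
      then show ?thesis using False by (simp add: F_def)
    qed
    have "emeasure (jump_kernel K t \<eta>) U = (SUP n. ennreal (I (F n) t \<eta>))" for t \<eta>
    proof -
      have "emeasure (jump_kernel K t \<eta>) U = (\<integral>\<^sup>+\<omega>. (SUP n. ennreal (F n \<omega>)) \<partial>jump_kernel K t \<eta>)"
        using U by (simp flip: ind)
      also have "\<dots> = (SUP n. \<integral>\<^sup>+\<omega>. ennreal (F n \<omega>) \<partial>jump_kernel K t \<eta>)"
        using Fm F_mono by (intro nn_integral_monotone_convergence_SUP)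
          (auto simp: incseq_def le_fun_def intro!: ennreal_leI)
      finally show ?thesis using I(1)[OF F] by simp
    qed
    moreover have "(\<lambda>p. SUP n. ennreal (case p of (t, \<eta>) \<Rightarrow> I (F n) t \<eta>)) \<in> borel_measurable (borel \<Otimes>\<^sub>M borel)"
      using meas_I[OF F] by (intro borel_measurable_SUP) auto
    ultimately show "(\<lambda>(t, \<eta>). emeasure (jump_kernel K t \<eta>) U) \<in> borel_measurable (borel \<Otimes>\<^sub>M borel)"
      by (simp add: case_prod_unfold)
  qed
qed

context jump_evolution
begin

lemma rate_nonneg: "0 \<le> jump_rate K t \<eta>"
  by (simp add: jump_rate_def)

lemma emeasure_eq_rate: "emeasure (jump_kernel K t \<eta>) UNIV = ennreal (jump_rate K t \<eta>)"
  using emeasure_finite[of t \<eta>] by (simp add: jump_rate_def measure_def less_top)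

lemma measurable_rate [measurable]:
  "(\<lambda>p. jump_rate K (fst p) (snd p)) \<in> borel_measurable (borel \<Otimes>\<^sub>M borel)"
  using measurable_open[OF open_UNIV] unfolding jump_rate_def measure_def case_prod_unfold
  by measurable

text \<open>The kernel \<open>Q / (1 + q)\<close> has mass at most 1, which makes the theory of the Giry monad
  applicable; the factor \<open>1 + q\<close> is restored afterwards. Open sets are an intersection-stable generator.\<close>

lemma measurable_kernel_integral:
  assumes f: "(\<lambda>(p, \<omega>). f p \<omega>) \<in> borel_measurable ((borel \<Otimes>\<^sub>M borel) \<Otimes>\<^sub>M borel)"
  shows "(\<lambda>p. \<integral>\<^sup>+\<omega>. f p \<omega> \<partial>jump_kernel K (fst p) (snd p)) \<in> borel_measurable (borel \<Otimes>\<^sub>M borel)"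
proof -
  define c where "c p = 1 / (1 + jump_rate K (fst p) (snd p))" for p
  define \<kappa> where "\<kappa> p = scale_measure (ennreal (c p)) (jump_kernel K (fst p) (snd p))" for p
  have c: "0 < c p" "c p * jump_rate K (fst p) (snd p) \<le> 1" for p
    using rate_nonneg[of "fst p" "snd p"] by (auto simp: c_def divide_simps add_nonneg_eq_0_iff add_pos_nonneg)
  have [measurable]: "c \<in> borel_measurable (borel \<Otimes>\<^sub>M borel)"
    unfolding c_def by measurable
  have open_meas: "(\<lambda>p. emeasure (\<kappa> p) U) \<in> borel_measurable (borel \<Otimes>\<^sub>M borel)" if "open U" for U
    using measurable_open[OF that] unfolding \<kappa>_def case_prod_unfold by simp
  have [measurable]: "\<kappa> \<in> borel \<Otimes>\<^sub>M borel \<rightarrow>\<^sub>M subprob_algebra borel"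
  proof (rule measurable_subprob_algebra_generated[where G = "{U. open U}" and \<Omega> = UNIV])
    show "sets borel = sigma_sets UNIV {U :: 'a fset set. open U}"
      by (simp add: borel_def)
    show "subprob_space (\<kappa> p)" for p
    proof
      have "emeasure (\<kappa> p) UNIV = ennreal (c p * jump_rate K (fst p) (snd p))"
        using c[of p] by (simp add: \<kappa>_def emeasure_eq_rate ennreal_mult' rate_nonneg)
      then show "emeasure (\<kappa> p) (space (\<kappa> p)) \<le> 1"
        using c[of p] by (simp add: \<kappa>_def ennreal_le_1 space_scale_measure)
      show "space (\<kappa> p) \<noteq> {}" by (simp add: \<kappa>_def space_scale_measure)
    qed
  qed (auto simp: Int_stable_def open_meas, simp_all add: \<kappa>_def)
  have "(\<lambda>p. \<integral>\<^sup>+\<omega>. f p \<omega> \<partial>\<kappa> p) \<in> borel_measurable (borel \<Otimes>\<^sub>M borel)"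
    by (rule nn_integral_measurable_subprob_algebra2[where N = borel]) (use f in auto)
  then have "(\<lambda>p. ennreal (1 / c p) * (\<integral>\<^sup>+\<omega>. f p \<omega> \<partial>\<kappa> p)) \<in> borel_measurable (borel \<Otimes>\<^sub>M borel)"
    by measurable
  moreover have "ennreal (1 / c p) * (\<integral>\<^sup>+\<omega>. f p \<omega> \<partial>\<kappa> p) = (\<integral>\<^sup>+\<omega>. f p \<omega> \<partial>jump_kernel K (fst p) (snd p))" for p
  proof -
    have "f p \<in> borel_measurable borel"
      using measurable_Pair2[OF f, of p] by (simp add: space_pair_measure)
    then have "(\<integral>\<^sup>+\<omega>. f p \<omega> \<partial>\<kappa> p) = ennreal (c p) * (\<integral>\<^sup>+\<omega>. f p \<omega> \<partial>jump_kernel K (fst p) (snd p))"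
      by (simp add: \<kappa>_def nn_integral_scale_measure)
    moreover have "ennreal (1 / c p) * ennreal (c p) = 1"
      using c(1)[of p] by (simp flip: ennreal_mult)
    ultimately show ?thesis by (simp flip: mult.assoc)
  qed
  ultimately show ?thesis by simp
qed

end

section \<open>Null sets of the Lebesgue--Poisson measure\<close>

abbreviation (input) lebesgue_tuples :: "nat set \<Rightarrow> (nat \<Rightarrow> 'a :: euclidean_space) measure" where
  "lebesgue_tuples J \<equiv> PiM J (\<lambda>_. lborel)"

interpretation lebesgue_tuples: product_sigma_finite "\<lambda>_ :: nat. lborel :: 'a :: euclidean_space measure"
  by standard

lemma sets_inj_on:
  "finite J \<Longrightarrow> {x. inj_on x J} \<inter> space (lebesgue_tuples J) \<in> sets (lebesgue_tuples J :: (nat \<Rightarrow> 'a :: euclidean_space) measure)"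
proof -
  assume J: "finite J"
  have "{x. inj_on x J} \<inter> space (lebesgue_tuples J :: (nat \<Rightarrow> 'a) measure) =
      {x \<in> space (lebesgue_tuples J). \<forall>i\<in>J. \<forall>j\<in>J. i \<noteq> j \<longrightarrow> x i - x j \<noteq> 0}"
    by (auto simp: inj_on_def)
  also have "\<dots> \<in> sets (lebesgue_tuples J :: (nat \<Rightarrow> 'a) measure)"
    using J by measurable
  finally show ?thesis .
qed

text \<open>The atom at the empty configuration is the case \<open>n = 0\<close>: the product of no factors is a point mass.\<close>

lemma null_sets_lebesgue_poisson_iff:
  fixes N :: "'a :: euclidean_space fset set"
  assumes N: "N \<in> sets borel"
  shows "N \<in> null_sets lebesgue_poisson \<longleftrightarrow>
    (\<forall>n. AE x in lebesgue_tuples {..<n}. inj_on x {..<n} \<longrightarrow> config_of n x \<notin> N)"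
proof -
  let ?AE = "\<lambda>n. AE x in lebesgue_tuples {..<n}. inj_on x {..<n} \<longrightarrow> config_of n x \<notin> N"
  have 1: "emeasure (lebesgue_config n) N = 0 \<longleftrightarrow> ?AE n" for n
  proof -
    let ?R = "restrict_space (lebesgue_tuples {..<n}) {x. inj_on x {..<n}} :: (nat \<Rightarrow> 'a) measure"
    have "emeasure (lebesgue_config n) N = 0 \<longleftrightarrow> (AE \<eta> in distr ?R borel (config_of n). \<eta> \<notin> N)"
      using N by (subst AE_iff_null_sets[symmetric]) (auto simp: lebesgue_config_def null_sets_def)
    also have "\<dots> \<longleftrightarrow> (AE x in ?R. config_of n x \<notin> N)"
      using N by (intro AE_distr_iff measurable_config_of) auto
    also have "\<dots> \<longleftrightarrow> ?AE n"
      by (subst AE_restrict_space_iff) (auto intro: sets_inj_on)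
    finally show ?thesis .
  qed
  have 0: "{||} \<notin> N \<longleftrightarrow> ?AE 0"
  proof -
    have c0: "config_of 0 x = {||}" for x :: "nat \<Rightarrow> 'a"
      by (simp flip: fset_inject)
    have "\<not> (AE x in lebesgue_tuples {} :: (nat \<Rightarrow> 'a) measure. False)"
    proof
      assume "AE x in lebesgue_tuples {} :: (nat \<Rightarrow> 'a) measure. False"
      then have "emeasure (lebesgue_tuples {} :: (nat \<Rightarrow> 'a) measure) (space (lebesgue_tuples {})) = 0"
        by (auto simp: AE_iff_null_sets eventually_ae_filter intro: antisym emeasure_mono dest: emeasure_eq_0)
      then show False by (simp add: space_PiM)
    qed
    then show ?thesis unfolding lessThan_0 by (auto simp: c0)
  qed
  have "N \<in> null_sets lebesgue_poisson \<longleftrightarrow> {||} \<notin> N \<and> (\<forall>n. emeasure (lebesgue_config (Suc n)) N = 0)"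
  proof -
    have "N \<in> null_sets lebesgue_poisson \<longleftrightarrow> indicator N {||} +
        (\<Sum>n. ennreal (1 / fact (Suc n)) * emeasure (lebesgue_config (Suc n)) N) = (0 :: ennreal)"
      using N by (simp add: null_sets_def emeasure_lebesgue_poisson del: fact_Suc)
    also have "\<dots> \<longleftrightarrow> {||} \<notin> N \<and> (\<forall>n. ennreal (1 / fact (Suc n)) * emeasure (lebesgue_config (Suc n)) N = 0)"
      by (simp add: add_eq_0_iff_both_eq_0 suminf_eq_zero_iff indicator_eq_0_iff del: fact_Suc)
    also have "\<dots> \<longleftrightarrow> {||} \<notin> N \<and> (\<forall>n. emeasure (lebesgue_config (Suc n)) N = 0)"
    proof -
      have "ennreal (1 / fact k) \<noteq> 0" for k
        by (simp add: ennreal_eq_0_iff not_le)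
      then show ?thesis
        by (simp only: mult_eq_0_iff) simp
    qed
    finally show ?thesis .
  qed
  also have "\<dots> \<longleftrightarrow> (\<forall>n. ?AE n)"
  proof -
    have "(\<forall>n. P n) \<longleftrightarrow> P 0 \<and> (\<forall>n. P (Suc n))" for P :: "nat \<Rightarrow> bool"
      by (metis not0_implies_Suc)
    from this[of ?AE] show ?thesis
      by (simp only: 0 1)
  qed
  finally show ?thesis .
qed

lemma lebesgue_tuples_reindex:
  assumes h: "bij_betw h I J" and fin: "finite J"
  shows "distr (lebesgue_tuples J) (lebesgue_tuples I) (\<lambda>w. \<lambda>i\<in>I. w (h i)) =
    (lebesgue_tuples I :: (nat \<Rightarrow> 'a :: euclidean_space) measure)"
proof (rule lebesgue_tuples.PiM_eqI)
  show finI: "finite I"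
    using bij_betw_finite[OF h] fin by simp
  have [measurable]: "(\<lambda>w. \<lambda>i\<in>I. w (h i)) \<in> lebesgue_tuples J \<rightarrow>\<^sub>M (lebesgue_tuples I :: (nat \<Rightarrow> 'a) measure)"
    using h by (intro measurable_restrict measurable_component_singleton) (auto simp: bij_betw_def)
  fix A :: "nat \<Rightarrow> 'a set" assume A: "\<And>i. i \<in> I \<Longrightarrow> A i \<in> sets lborel"
  let ?g = "inv_into I h"
  have g: "?g j \<in> I" "h (?g j) = j" if "j \<in> J" for j
    using h that by (auto simp: bij_betw_def inv_into_into f_inv_into_f)
  have gh: "?g (h i) = i" "h i \<in> J" if "i \<in> I" for i
    using h that by (auto simp: bij_betw_def)
  have eq: "(\<lambda>w. \<lambda>i\<in>I. w (h i)) -` PiE I A \<inter> space (lebesgue_tuples J) = PiE J (\<lambda>j. A (?g j))"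
  proof (intro set_eqI iffI)
    fix w assume w: "w \<in> (\<lambda>w. \<lambda>i\<in>I. w (h i)) -` PiE I A \<inter> space (lebesgue_tuples J)"
    have "w j \<in> A (?g j)" if "j \<in> J" for j
      using w g[OF that] by (auto simp: PiE_iff dest!: bspec[of I _ "?g j"])
    then show "w \<in> PiE J (\<lambda>j. A (?g j))"
      using w by (auto simp: space_PiM PiE_iff)
  next
    fix w assume w: "w \<in> PiE J (\<lambda>j. A (?g j))"
    have "w (h i) \<in> A i" if "i \<in> I" for i
      using PiE_mem[OF w gh(2)[OF that]] gh(1)[OF that] by simp
    then show "w \<in> (\<lambda>w. \<lambda>i\<in>I. w (h i)) -` PiE I A \<inter> space (lebesgue_tuples J)"
      using w by (auto simp: space_PiM PiE_iff)
  qed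
  have "emeasure (distr (lebesgue_tuples J) (lebesgue_tuples I) (\<lambda>w. \<lambda>i\<in>I. w (h i))) (PiE I A) =
      emeasure (lebesgue_tuples J) (PiE J (\<lambda>j. A (?g j)))"
    using A finI by (subst emeasure_distr) (auto simp: eq)
  also have "\<dots> = (\<Prod>j\<in>J. emeasure lborel (A (?g j)))"
    using A g fin by (intro lebesgue_tuples.emeasure_PiM) auto
  also have "\<dots> = (\<Prod>i\<in>I. emeasure lborel (A i))"
    using prod.reindex_bij_betw[OF h, of "\<lambda>j. emeasure lborel (A (?g j))"] gh by simp
  finally show "emeasure (distr (lebesgue_tuples J) (lebesgue_tuples I) (\<lambda>w. \<lambda>i\<in>I. w (h i))) (PiE I A) =
      (\<Prod>i\<in>I. emeasure lborel (A i))" .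
qed simp

text \<open>Only the number of points of a configuration matters, not the index set that enumerates it. The
  sections below need index sets disjoint from \<open>{..<n}\<close>.\<close>

lemma AE_tuples_reindex:
  fixes P :: "'a :: euclidean_space fset \<Rightarrow> bool"
  assumes I: "finite I" "finite J" "card I = card J"
    and AE: "AE x in lebesgue_tuples I. inj_on x I \<longrightarrow> P (Abs_fset (x ` I))"
  shows "AE x in lebesgue_tuples J. inj_on x J \<longrightarrow> P (Abs_fset (x ` J))"
proof -
  obtain h where h: "bij_betw h I J"
    using finite_same_card_bij[OF I] by blast
  have m: "(\<lambda>w. \<lambda>i\<in>I. w (h i)) \<in> lebesgue_tuples J \<rightarrow>\<^sub>M (lebesgue_tuples I :: (nat \<Rightarrow> 'a) measure)"
    using h by (intro measurable_restrict measurable_component_singleton) (auto simp: bij_betw_def)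
  have "AE w in lebesgue_tuples J. inj_on (\<lambda>i\<in>I. w (h i)) I \<longrightarrow> P (Abs_fset ((\<lambda>i\<in>I. w (h i)) ` I))"
    by (rule AE_distrD[OF m]) (simp only: lebesgue_tuples_reindex[OF h I(2)] AE)
  then show ?thesis
  proof eventually_elim
    case (elim w)
    have "(\<lambda>i\<in>I. w (h i)) ` I = w ` (h ` I)"
      by auto
    moreover have "inj_on (\<lambda>i\<in>I. w (h i)) I" if "inj_on w J"
      using comp_inj_on[of h I w] h that by (auto simp: bij_betw_def o_def)
    ultimately show ?case using elim h by (auto simp: bij_betw_def)
  qed
qed

text \<open>Points are null because the dimension is at least 1. New points therefore almost surely avoid the old
  ones, and the union of two disjointly indexed tuples has pairwise distinct entries.\<close>

lemma AE_tuples_avoid: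
  assumes J: "finite J" and S: "finite S"
  shows "AE y in lebesgue_tuples J. \<forall>i\<in>J. y i \<notin> (S :: 'a :: euclidean_space set)"
proof (rule AE_finite_allI[OF J])
  fix i assume i: "i \<in> J"
  let ?B = "PiE J (\<lambda>k. if k = i then S else UNIV)"
  have S': "S \<in> sets borel"
    using S by (intro borel_closed finite_imp_closed)
  then have B: "?B \<in> sets (lebesgue_tuples J)"
    by (intro sets_PiM_I_finite J) simp
  have "emeasure (lebesgue_tuples J) ?B = (\<Prod>k\<in>J. emeasure lborel (if k = i then S else UNIV))"
    using S' by (intro lebesgue_tuples.emeasure_PiM J) simp
  also have "\<dots> = 0"
    using i emeasure_lborel_countable[OF countable_finite[OF S]]
    by (intro prod_zero J bexI[of _ i]) simp_all
  finally have "?B \<in> null_sets (lebesgue_tuples J)"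
    using B by (simp add: null_sets_def)
  moreover have "{y \<in> space (lebesgue_tuples J). \<not> y i \<notin> S} \<subseteq> ?B"
    by (auto simp: space_PiM PiE_iff extensional_def)
  ultimately show "AE y in lebesgue_tuples J. y i \<notin> S"
    by (rule AE_I')
qed

text \<open>The cylinder over a null set is a null set.\<close>

lemma AE_tuples_restrict:
  assumes L: "finite L" "I \<subseteq> L" and AE: "AE x in lebesgue_tuples I. P (x :: nat \<Rightarrow> 'a :: euclidean_space)"
  shows "AE x in lebesgue_tuples L. P (restrict x I)"
proof -
  interpret R: finite_product_sigma_finite "\<lambda>_. lborel :: 'a measure" "L - I"
    using L by unfold_locales auto
  obtain N where N: "{x \<in> space (lebesgue_tuples I). \<not> P x} \<subseteq> N" "N \<in> null_sets (lebesgue_tuples I)"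
    using AE by (auto simp: eventually_ae_filter)
  have fin: "finite I" "finite (L - I)" and LI: "I \<union> (L - I) = L"
    using L by (auto intro: finite_subset)
  have m: "(\<lambda>x. restrict x I) \<in> lebesgue_tuples L \<rightarrow>\<^sub>M (lebesgue_tuples I :: (nat \<Rightarrow> 'a) measure)"
    using L(2) by (rule measurable_restrict_subset)
  let ?Q = "(\<lambda>x. restrict x I) -` N \<inter> space (lebesgue_tuples L)"
  have Q: "?Q \<in> sets (lebesgue_tuples L)"
    using measurable_sets[OF m] N by auto
  have "emeasure (lebesgue_tuples L) ?Q =
      emeasure (distr (lebesgue_tuples I \<Otimes>\<^sub>M lebesgue_tuples (L - I)) (lebesgue_tuples (I \<union> (L - I))) (merge I (L - I))) ?Q"
    using fin LI by (subst lebesgue_tuples.distr_merge) auto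
  also have "\<dots> = emeasure (lebesgue_tuples I \<Otimes>\<^sub>M lebesgue_tuples (L - I))
      (merge I (L - I) -` ?Q \<inter> space (lebesgue_tuples I \<Otimes>\<^sub>M lebesgue_tuples (L - I)))"
    using Q LI by (intro emeasure_distr measurable_merge) auto
  also have "\<dots> \<le> emeasure (lebesgue_tuples I \<Otimes>\<^sub>M lebesgue_tuples (L - I)) (N \<times> space (lebesgue_tuples (L - I) :: (nat \<Rightarrow> 'a) measure))"
  proof (intro emeasure_mono pair_measureI)
    have "restrict a I = a" if "a \<in> space (lebesgue_tuples I :: (nat \<Rightarrow> 'a) measure)" for a
      using that by (auto simp: space_PiM PiE_restrict)
    then show "merge I (L - I) -` ?Q \<inter> space (lebesgue_tuples I \<Otimes>\<^sub>M lebesgue_tuples (L - I))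
        \<subseteq> N \<times> space (lebesgue_tuples (L - I) :: (nat \<Rightarrow> 'a) measure)"
      by (auto simp: space_pair_measure)
  qed (use N(2) in auto)
  also have "\<dots> = 0"
    using N(2) by (simp add: R.emeasure_pair_measure_Times null_sets_def)
  finally have "?Q \<in> null_sets (lebesgue_tuples L)"
    using Q by (simp add: null_sets_def le_zero_eq)
  then show ?thesis
    by (rule AE_I') (use N(1) measurable_space[OF m] in auto)
qed

lemma AE_tuples_merge:
  assumes fin: "finite I" "finite J" "I \<inter> J = {}"
    and AE: "AE w in lebesgue_tuples (I \<union> J). P (w :: nat \<Rightarrow> 'a :: euclidean_space)"
  shows "AE x in lebesgue_tuples I. AE y in lebesgue_tuples J. P (merge I J (x, y))"
proof -
  interpret pair_sigma_finite "lebesgue_tuples I :: (nat \<Rightarrow> 'a) measure" "lebesgue_tuples J :: (nat \<Rightarrow> 'a) measure"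
    using fin by (intro pair_sigma_finite.intro lebesgue_tuples.sigma_finite)
  have "AE z in lebesgue_tuples I \<Otimes>\<^sub>M lebesgue_tuples J. P (merge I J z)"
    by (rule AE_distrD[OF measurable_merge]) (simp only: lebesgue_tuples.distr_merge[OF fin(3,1,2)] AE)
  then show ?thesis by (rule AE_pair)
qed

lemma sets_union_section:
  "N \<in> sets borel \<Longrightarrow> {\<zeta>. \<beta> |\<union>| \<zeta> \<in> N} \<in> sets (borel :: 'a :: euclidean_space fset measure)"
  using measurable_sets[OF borel_measurable_funion[of \<beta>], of N] by (simp add: vimage_def)

lemma fset_Abs_fset: "finite A \<Longrightarrow> fset (Abs_fset A) = A"
  by (simp add: Abs_fset_inverse)

text \<open>For an index set \<open>I\<close>, a tuple over \<open>I\<close> and \<open>k\<close> further points form a tuple over \<open>I \<union> {n..<n+k}\<close>.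
  Almost no such tuple enumerates an element of \<open>N\<close>, so Fubini's theorem yields the section property for
  almost every tuple over \<open>I\<close>. A tuple over \<open>{..<n}\<close> has only finitely many subtuples.\<close>

lemma AE_null_union_section:
  fixes N :: "'a :: euclidean_space fset set"
  assumes N: "N \<in> null_sets lebesgue_poisson"
  shows "AE x in lebesgue_tuples {..<n}. inj_on x {..<n} \<longrightarrow>
    (\<forall>I\<in>Pow {..<n}. {\<zeta>. Abs_fset (x ` I) |\<union>| \<zeta> \<in> N} \<in> null_sets lebesgue_poisson)"
proof -
  have Nb: "N \<in> sets borel" using N by auto
  have tuples: "AE x in lebesgue_tuples J. inj_on x J \<longrightarrow> Abs_fset (x ` J) \<notin> N" if "finite J" for J
  proof (rule AE_tuples_reindex)
    show "AE x in lebesgue_tuples {..<card J}. inj_on x {..<card J} \<longrightarrow> Abs_fset (x ` {..<card J}) \<notin> N"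
      using N null_sets_lebesgue_poisson_iff[OF Nb] by (simp add: config_of_def)
  qed (use that in simp_all)
  have I: "AE x in lebesgue_tuples I. inj_on x I \<longrightarrow> {\<zeta>. Abs_fset (x ` I) |\<union>| \<zeta> \<in> N} \<in> null_sets lebesgue_poisson"
    if I: "I \<subseteq> {..<n}" for I
  proof -
    have fin: "finite I" using I finite_subset by blast
    define J where "J k = {n..<n+k}" for k
    have J: "finite (J k)" "card (J k) = k" "I \<inter> J k = {}" for k
      using I by (auto simp: J_def)
    have "AE x in lebesgue_tuples I. \<forall>k. AE y in lebesgue_tuples (J k).
        inj_on (merge I (J k) (x, y)) (I \<union> J k) \<longrightarrow> Abs_fset (merge I (J k) (x, y) ` (I \<union> J k)) \<notin> N"
      using fin J by (intro AE_all_countable[THEN iffD2] allI AE_tuples_merge tuples) auto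
    then show ?thesis
    proof eventually_elim
      case (elim x)
      show ?case
      proof
        assume inj: "inj_on x I"
        have "AE y in lebesgue_tuples (J k). inj_on y (J k) \<longrightarrow> Abs_fset (y ` J k) \<notin> {\<zeta>. Abs_fset (x ` I) |\<union>| \<zeta> \<in> N}" for k
          using elim[THEN spec, of k] AE_tuples_avoid[OF J(1)[of k] finite_imageI[OF fin, of x]]
        proof eventually_elim
          case (elim y)
          let ?w = "merge I (J k) (x, y)"
          have w: "?w i = x i" if "i \<in> I" for i using that by (simp add: merge_def)
          have w': "?w i = y i" if "i \<in> J k" for i using that J(3)[of k] by (auto simp: merge_def)
          have img: "?w ` (I \<union> J k) = x ` I \<union> y ` J k"
            using w w' by (auto simp: image_Un)
          have "inj_on ?w (I \<union> J k)" if "inj_on y (J k)"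
            unfolding inj_on_Un
          proof (intro conjI)
            show "inj_on ?w I" "inj_on ?w (J k)"
              using inj that w w' by (simp_all add: inj_on_def)
            show "?w ` (I - J k) \<inter> ?w ` (J k - I) = {}"
            proof -
              have "?w ` (I - J k) \<subseteq> x ` I" "?w ` (J k - I) \<subseteq> y ` J k"
                using w w' by auto
              moreover have "x ` I \<inter> y ` J k = {}"
                using elim(2) by (force simp: disjoint_iff)
              ultimately show ?thesis by blast
            qed
          qed
          moreover have "Abs_fset (x ` I \<union> y ` J k) = Abs_fset (x ` I) |\<union>| Abs_fset (y ` J k)"
            using fin J(1)[of k] by (simp add: fset_Abs_fset flip: fset_inject)
          ultimately show ?case using elim(1) img by auto
        qed
        then have "AE y in lebesgue_tuples {..<k}. inj_on y {..<k} \<longrightarrow> config_of k y \<notin> {\<zeta>. Abs_fset (x ` I) |\<union>| \<zeta> \<in> N}" for k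
          unfolding config_of_def
          by (rule AE_tuples_reindex[of "J k" "{..<k}" "\<lambda>\<zeta>. \<zeta> \<notin> {\<zeta>. Abs_fset (x ` I) |\<union>| \<zeta> \<in> N}", rotated 3])
            (simp_all only: J finite_lessThan card_lessThan)
        then show "{\<zeta>. Abs_fset (x ` I) |\<union>| \<zeta> \<in> N} \<in> null_sets lebesgue_poisson"
          by (subst null_sets_lebesgue_poisson_iff) (auto intro: sets_union_section[OF Nb])
      qed
    qed
  qed
  have "AE x in lebesgue_tuples {..<n}. \<forall>I\<in>Pow {..<n}. inj_on (restrict x I) I \<longrightarrow>
      {\<zeta>. Abs_fset (restrict x I ` I) |\<union>| \<zeta> \<in> N} \<in> null_sets lebesgue_poisson"
    using I by (intro AE_finite_allI AE_tuples_restrict) auto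
  then show ?thesis
    by eventually_elim (auto intro: inj_on_subset)
qed

text \<open>After the departure of \<open>\<xi>\<close> the surviving points \<open>\<eta> |-| \<xi>\<close> form a subtuple of \<open>\<eta>\<close>, and for almost
  every \<open>\<eta>\<close> all sections over subtuples are null.\<close>

lemma (in jump_evolution) AE_jump_kernel_null:
  assumes K: "\<And>\<xi> \<eta>. sets (K t \<xi> \<eta>) = sets borel"
    and ac: "\<And>\<xi> \<eta>. absolutely_continuous lebesgue_poisson (K t \<xi> \<eta>)"
    and N: "N \<in> null_sets lebesgue_poisson"
  shows "AE \<eta> in lebesgue_poisson. emeasure (jump_kernel K t \<eta>) N = 0"
proof -
  have Nb[measurable]: "N \<in> sets borel" using N by auto
  define B where "B = {\<eta> \<in> space borel. emeasure (jump_kernel K t \<eta>) N \<noteq> 0}"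
  have "(\<lambda>p. \<integral>\<^sup>+\<omega>. indicator N \<omega> \<partial>jump_kernel K (fst p) (snd p)) \<in> borel_measurable (borel \<Otimes>\<^sub>M borel)"
    by (rule measurable_kernel_integral) measurable
  then have "(\<lambda>\<eta>. \<integral>\<^sup>+\<omega>. indicator N \<omega> \<partial>jump_kernel K (fst (t, \<eta>)) (snd (t, \<eta>))) \<in> borel_measurable borel"
    by (rule measurable_compose[rotated]) measurable
  then have "(\<lambda>\<eta>. emeasure (jump_kernel K t \<eta>) N) \<in> borel_measurable borel"
    by (simp add: nn_integral_indicator)
  then have [measurable]: "B \<in> sets borel"
    unfolding B_def by measurable
  have "AE x in lebesgue_tuples {..<n}. inj_on x {..<n} \<longrightarrow> config_of n x \<notin> B" for n
    using AE_null_union_section[OF N, of n]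
  proof eventually_elim
    case (elim x)
    show ?case
    proof
      assume inj: "inj_on x {..<n}"
      let ?\<eta> = "config_of n x"
      have "emeasure (K t \<xi> ?\<eta>) {\<zeta>. ?\<eta> |-| \<xi> |\<union>| \<zeta> \<in> N} = 0" if "\<xi> |\<subseteq>| ?\<eta>" for \<xi>
      proof -
        define I where "I = {i. i < n \<and> x i |\<notin>| \<xi>}"
        have "finite I" unfolding I_def by simp
        then have "Abs_fset (x ` I) = ?\<eta> |-| \<xi>"
          by (auto simp: fset_Abs_fset I_def simp flip: fset_inject)
        moreover have "I \<in> Pow {..<n}" by (auto simp: I_def)
        ultimately have "{\<zeta>. ?\<eta> |-| \<xi> |\<union>| \<zeta> \<in> N} \<in> null_sets lebesgue_poisson"
          using elim inj by metis
        then show ?thesis using ac by (auto simp: absolutely_continuous_def)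
      qed
      moreover have "(\<integral>\<^sup>+\<zeta>. indicator N (?\<eta> |-| \<xi> |\<union>| \<zeta>) \<partial>K t \<xi> ?\<eta>) = emeasure (K t \<xi> ?\<eta>) {\<zeta>. ?\<eta> |-| \<xi> |\<union>| \<zeta> \<in> N}" for \<xi>
      proof -
        have "(\<integral>\<^sup>+\<zeta>. indicator N (?\<eta> |-| \<xi> |\<union>| \<zeta>) \<partial>K t \<xi> ?\<eta>) =
            (\<integral>\<^sup>+\<zeta>. indicator {\<zeta>. ?\<eta> |-| \<xi> |\<union>| \<zeta> \<in> N} \<zeta> \<partial>K t \<xi> ?\<eta>)"
          by (simp add: indicator_def)
        also have "\<dots> = emeasure (K t \<xi> ?\<eta>) {\<zeta>. ?\<eta> |-| \<xi> |\<union>| \<zeta> \<in> N}"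
          by (rule nn_integral_indicator) (simp only: K sets_union_section[OF Nb])
        finally show ?thesis .
      qed
      ultimately have "emeasure (jump_kernel K t ?\<eta>) N = 0"
        by (subst emeasure_jump_kernel) (auto simp: K)
      then show "?\<eta> \<notin> B" by (simp add: B_def)
    qed
  qed
  then have "B \<in> null_sets lebesgue_poisson"
    by (subst null_sets_lebesgue_poisson_iff) auto
  then show ?thesis
    by (rule AE_I') (auto simp: B_def)
qed

text \<open>The configurations inside a ball of volume \<open>v\<close> have measure at most \<open>e\<^sup>v\<close>.\<close>

lemma sigma_finite_lebesgue_poisson: "sigma_finite_measure (lebesgue_poisson :: 'a :: euclidean_space fset measure)"
proof
  define A where "A m = {\<eta> :: 'a fset. fset \<eta> \<subseteq> ball 0 (real m)}" for m
  have "open (A m)" for m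
    unfolding open_fset_def
  proof
    fix n
    have "openin (distinct_tuples n) {x \<in> topspace (distinct_tuples n). x i \<in> ball (0 :: 'a) (real m)}" if "i < n" for i
      by (rule openin_continuous_map_preimage[where Y = euclidean])
        (auto simp: distinct_tuples_def that intro!: continuous_map_from_subtopology continuous_map_product_coordinates)
    then have "openin (distinct_tuples n)
        (topspace (distinct_tuples n) \<inter> (\<Inter>i\<in>{..<n}. {x \<in> topspace (distinct_tuples n). x i \<in> ball (0 :: 'a) (real m)}))"
      by (intro openin_Int_Inter) auto
    moreover have "topspace (distinct_tuples n) \<inter> (\<Inter>i\<in>{..<n}. {x \<in> topspace (distinct_tuples n). x i \<in> ball (0 :: 'a) (real m)})
        = {x \<in> topspace (distinct_tuples n). config_of n x \<in> A m}"
      by (auto simp: A_def)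
    ultimately show "openin (distinct_tuples n) {x \<in> topspace (distinct_tuples n). config_of n x \<in> A m}"
      by (simp only:)
  qed
  then have A[measurable]: "A m \<in> sets borel" for m by (intro borel_open)
  have fin: "emeasure lebesgue_poisson (A m) \<noteq> \<infinity>" for m
  proof -
    obtain v where v: "emeasure lborel (ball (0 :: 'a) (real m)) = ennreal v" "0 \<le> v"
      using emeasure_lborel_ball_finite[of "0 :: 'a" "real m"] by (cases "emeasure lborel (ball (0 :: 'a) (real m))") auto
    have le: "emeasure (lebesgue_config n) (A m) \<le> ennreal (v ^ n)" for n
    proof -
      let ?M = "lebesgue_tuples {..<n} :: (nat \<Rightarrow> 'a) measure"
      let ?R = "restrict_space ?M {x. inj_on x {..<n}}"
      have "emeasure (lebesgue_config n) (A m) = emeasure ?R (config_of n -` A m \<inter> space ?R)"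
        unfolding lebesgue_config_def by (intro emeasure_distr measurable_config_of A)
      also have "\<dots> = emeasure ?M (config_of n -` A m \<inter> space ?R)"
        by (intro emeasure_restrict_space sets_inj_on) (auto simp: space_restrict_space)
      also have "\<dots> \<le> emeasure ?M (PiE {..<n} (\<lambda>_. ball 0 (real m)))"
        by (intro emeasure_mono sets_PiM_I_finite) (auto simp: A_def space_restrict_space space_PiM PiE_iff)
      also have "\<dots> = ennreal (v ^ n)"
        using v by (subst lebesgue_tuples.emeasure_PiM) (auto simp: ennreal_power)
      finally show ?thesis .
    qed
    have sm: "summable (\<lambda>n. v ^ Suc n / fact (Suc n))"
      using summable_exp[of v] by (subst summable_Suc_iff) (simp add: divide_inverse ac_simps)
    have "emeasure lebesgue_poisson (A m) \<le> 1 + (\<Sum>n. ennreal (1 / fact (Suc n)) * ennreal (v ^ Suc n))"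
      unfolding emeasure_lebesgue_poisson[OF A] using le
      by (intro add_mono suminf_le mult_left_mono le) (auto simp: indicator_def)
    also have "\<dots> = 1 + (\<Sum>n. ennreal (v ^ Suc n / fact (Suc n)))"
      using v(2) by (simp flip: ennreal_mult del: power_Suc fact_Suc)
    also have "\<dots> < \<infinity>"
      using sm v(2) by (simp add: suminf_ennreal2 less_top[symmetric] del: power_Suc fact_Suc)
    finally show ?thesis by simp
  qed
  have cover: "\<exists>m. \<eta> \<in> A m" for \<eta>
  proof -
    obtain r where r: "\<And>x. x \<in> fset \<eta> \<Longrightarrow> norm x \<le> r"
      using finite_imp_bounded[OF finite_fset[of \<eta>]] by (auto simp: bounded_iff)
    obtain m where "r < real m" using reals_Archimedean2 by blast
    then show ?thesis using r by (intro exI[of _ m]) (fastforce simp: A_def)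
  qed
  show "\<exists>C. countable C \<and> C \<subseteq> sets lebesgue_poisson \<and> \<Union>C = space lebesgue_poisson \<and>
      (\<forall>a\<in>C. emeasure (lebesgue_poisson :: 'a fset measure) a \<noteq> \<infinity>)"
    using fin cover by (intro exI[of _ "range A"]) auto
qed

section \<open>The backward equation\<close>

context jump_evolution
begin

definition survival :: "real \<Rightarrow> real \<Rightarrow> 'a fset \<Rightarrow> real" where
  "survival s r \<eta> = exp (- (LBINT \<tau>:{s..r}. jump_rate K \<tau> \<eta>))"

text \<open>The contribution to the backward equation of the paths that jump before time \<open>t\<close>: the process sits in \<open>\<eta>\<close>
  until the first jump at time \<open>r\<close>, and \<open>g r\<close> is the value collected from the configuration reached.\<close>

definition first_jump :: "(real \<Rightarrow> 'a fset \<Rightarrow> ennreal) \<Rightarrow> real \<Rightarrow> real \<Rightarrow> 'a fset \<Rightarrow> ennreal" where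
  "first_jump g s t \<eta> =
     (\<integral>\<^sup>+r\<in>{s..t}. ennreal (survival s r \<eta>) * (\<integral>\<^sup>+\<omega>. g r \<omega> \<partial>jump_kernel K r \<eta>) \<partial>lborel)"

definition transition_sum :: "nat \<Rightarrow> real \<Rightarrow> 'a fset \<Rightarrow> real \<Rightarrow> 'a fset set \<Rightarrow> ennreal" where
  "transition_sum n s \<eta> t A = (\<Sum>k<n. transition_term K k s \<eta> t A)"

text \<open>The antiderivative is defined on the whole line, so that it has a two-sided derivative also at \<open>s\<close>,
  where the survival exponent as a function of \<open>r\<close> has a kink.\<close>

lemma rate_antiderivative:
  obtains F where "\<And>r. DERIV F r :> jump_rate K r \<eta>"
    "\<And>s r. s \<le> r \<Longrightarrow> survival s r \<eta> = exp (F s - F r)"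
proof -
  have "\<exists>F. \<forall>r. - \<infinity> < ereal r \<longrightarrow> ereal r < \<infinity> \<longrightarrow> (F has_vector_derivative jump_rate K r \<eta>) (at r)"
    using continuous_rate[of \<eta>] by (intro einterval_antiderivative) (auto simp: continuous_on_eq_continuous_at)
  then obtain F where F: "\<And>r. (F has_vector_derivative jump_rate K r \<eta>) (at r)" by auto
  show thesis
  proof (rule that)
    show "DERIV F r :> jump_rate K r \<eta>" for r
      using F by (simp add: has_real_derivative_iff_has_vector_derivative)
    fix s r :: real assume "s \<le> r"
    then have "(LBINT \<tau>:{s..r}. jump_rate K \<tau> \<eta>) = F r - F s"
      unfolding set_lebesgue_integral_def using F continuous_rate[of \<eta>]
      by (intro integral_FTC_Icc) (auto intro: has_vector_derivative_at_within continuous_on_subset)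
    then show "survival s r \<eta> = exp (F s - F r)"
      by (simp only: survival_def minus_diff_eq)
  qed
qed

lemma survival_pos: "0 < survival s r \<eta>"
  by (simp add: survival_def)

lemma survival_late: "r \<le> s \<Longrightarrow> survival s r \<eta> = 1"
proof (cases "r = s")
  case True
  obtain F where F: "\<And>r. DERIV F r :> jump_rate K r \<eta>"
    "\<And>s r. s \<le> r \<Longrightarrow> survival s r \<eta> = exp (F s - F r)"
    by (rule rate_antiderivative) (rule that)
  then show ?thesis using True F(2)[of s s] by simp
qed (simp add: survival_def set_lebesgue_integral_def)

lemma survival_split:
  assumes "s \<le> u" "u \<le> r"
  shows "survival s r \<eta> = survival s u \<eta> * survival u r \<eta>"
proof -
  obtain F where F: "\<And>r. DERIV F r :> jump_rate K r \<eta>"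
    "\<And>s r. s \<le> r \<Longrightarrow> survival s r \<eta> = exp (F s - F r)"
    by (rule rate_antiderivative) (rule that)
  show ?thesis using assms by (simp add: F(2) flip: exp_add)
qed

lemma survival_le_1: "survival s r \<eta> \<le> 1"
  unfolding survival_def set_lebesgue_integral_def
  using rate_nonneg by (auto intro!: integral_nonneg_AE)

lemma one_minus_survival_le:
  assumes "s \<le> u" and B: "\<And>r. s \<le> r \<Longrightarrow> r \<le> u \<Longrightarrow> jump_rate K r \<eta> \<le> B"
  shows "1 - survival s u \<eta> \<le> (u - s) * B"
proof (cases "s = u")
  case True
  then show ?thesis by (simp add: survival_late)
next
  case False
  obtain F where F: "\<And>r. DERIV F r :> jump_rate K r \<eta>"
    "\<And>s r. s \<le> r \<Longrightarrow> survival s r \<eta> = exp (F s - F r)"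
    by (rule rate_antiderivative) (rule that)
  obtain z where z: "s < z" "z < u" "F u - F s = (u - s) * jump_rate K z \<eta>"
    using MVT2[of s u F "\<lambda>r. jump_rate K r \<eta>"] F(1) False assms(1) by auto
  have "1 - survival s u \<eta> \<le> F u - F s"
    using exp_ge_add_one_self[of "F s - F u"] unfolding F(2)[OF assms(1)] by linarith
  also have "\<dots> \<le> (u - s) * B"
    unfolding z(3) using z assms by (intro mult_left_mono) auto
  finally show ?thesis .
qed

lemma measurable_rate' [measurable (raw)]:
  "f \<in> borel_measurable M \<Longrightarrow> h \<in> M \<rightarrow>\<^sub>M borel \<Longrightarrow> (\<lambda>x. jump_rate K (f x) (h x)) \<in> borel_measurable M"
  using measurable_compose[OF measurable_Pair measurable_rate, of f M h] by simp

lemma measurable_survival [measurable (raw)]: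
  assumes [measurable]: "f \<in> borel_measurable M" "g \<in> borel_measurable M" "h \<in> M \<rightarrow>\<^sub>M borel"
  shows "(\<lambda>x. survival (f x) (g x) (h x)) \<in> borel_measurable M"
proof -
  have "(\<lambda>x. LINT \<tau>|lborel. (if f x \<le> \<tau> \<and> \<tau> \<le> g x then jump_rate K \<tau> (h x) else 0)) \<in> borel_measurable M"
    by measurable
  also have "(\<lambda>x. LINT \<tau>|lborel. (if f x \<le> \<tau> \<and> \<tau> \<le> g x then jump_rate K \<tau> (h x) else 0)) =
      (\<lambda>x. LBINT \<tau>:{f x..g x}. jump_rate K \<tau> (h x))"
    unfolding set_lebesgue_integral_def by (intro ext Bochner_Integration.integral_cong) auto
  finally show ?thesis unfolding survival_def by measurable
qed

text \<open>The integrand is minus the derivative in \<open>r\<close> of \<open>e\<^bsup>C (t - r)\<^esup>\<close> times the survival probability. For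
  \<open>C = 0\<close> the identity says that there either is a jump before \<open>t\<close> or there is none.\<close>

lemma renewal:
  assumes "s \<le> t" "0 \<le> C"
  shows "ennreal (survival s t \<eta>) +
      (\<integral>\<^sup>+r\<in>{s..t}. ennreal (survival s r \<eta> * (exp (C * (t - r)) * (C + jump_rate K r \<eta>))) \<partial>lborel) =
    ennreal (exp (C * (t - s)))"
proof -
  obtain F where F: "\<And>r. DERIV F r :> jump_rate K r \<eta>"
    "\<And>s r. s \<le> r \<Longrightarrow> survival s r \<eta> = exp (F s - F r)"
    by (rule rate_antiderivative) (rule that)
  note [derivative_intros] = DERIV_chain2[OF F(1)]
  have [measurable]: "F \<in> borel_measurable borel"
    using F(1) by (intro borel_measurable_continuous_onI)
      (metis DERIV_isCont continuous_at_imp_continuous_on)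
  define f where "f r = exp (F s - F r + C * (t - r)) * (C + jump_rate K r \<eta>)" for r
  define G where "G r = - exp (F s - F r + C * (t - r))" for r
  have "(\<integral>\<^sup>+r. ennreal (f r) * indicator {s..t} r \<partial>lborel) = ennreal (G t - G s)"
  proof (rule nn_integral_FTC_Icc)
    show "f \<in> borel_measurable borel"
      unfolding f_def by measurable
    show "DERIV G r :> f r" for r
      unfolding G_def f_def by (auto intro!: derivative_eq_intros simp: algebra_simps)
    show "0 \<le> f r" for r
      unfolding f_def using assms rate_nonneg by (intro mult_nonneg_nonneg add_nonneg_nonneg) auto
  qed fact
  also have "(\<integral>\<^sup>+r. ennreal (f r) * indicator {s..t} r \<partial>lborel) =
      (\<integral>\<^sup>+r\<in>{s..t}. ennreal (survival s r \<eta> * (exp (C * (t - r)) * (C + jump_rate K r \<eta>))) \<partial>lborel)"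
    by (intro nn_integral_cong)
      (auto simp: f_def F(2) indicator_def exp_add mult.assoc)
  finally have eq: "(\<integral>\<^sup>+r\<in>{s..t}. ennreal (survival s r \<eta> * (exp (C * (t - r)) * (C + jump_rate K r \<eta>))) \<partial>lborel)
      = ennreal (G t - G s)" .
  have G: "survival s t \<eta> = - G t" "G s = - exp (C * (t - s))"
    by (simp_all add: G_def F(2) assms)
  have "survival s t \<eta> \<le> exp (C * (t - s))"
    using survival_le_1[of s t \<eta>] one_le_exp_iff[of "C * (t - s)"] assms by (meson diff_ge_0_iff_ge mult_nonneg_nonneg order_trans)
  then show ?thesis
    unfolding eq using G survival_pos[of s t \<eta>] by (subst ennreal_plus[symmetric]) auto
qed

subsection \<open>The first-jump operator\<close>

lemma measurable_kernel_integral' [measurable (raw)]: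
  assumes g: "(\<lambda>p. g (fst p) (snd p)) \<in> borel_measurable (borel \<Otimes>\<^sub>M borel)"
    and "f \<in> borel_measurable M" "h \<in> M \<rightarrow>\<^sub>M borel"
  shows "(\<lambda>x. \<integral>\<^sup>+\<omega>. g (f x) \<omega> \<partial>jump_kernel K (f x) (h x)) \<in> borel_measurable M"
proof -
  have "(\<lambda>(p, \<omega>). g (fst p) \<omega>) \<in> borel_measurable ((borel \<Otimes>\<^sub>M (borel :: 'a fset measure)) \<Otimes>\<^sub>M borel)"
  proof -
    have "(\<lambda>p. (fst (fst p), snd p)) \<in> (borel \<Otimes>\<^sub>M (borel :: 'a fset measure)) \<Otimes>\<^sub>M borel \<rightarrow>\<^sub>M borel \<Otimes>\<^sub>M borel"
      by measurable
    from measurable_compose[OF this g] show ?thesis by (simp add: case_prod_unfold)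
  qed
  from measurable_compose[OF measurable_Pair[OF assms(2,3)] measurable_kernel_integral[OF this]]
  show ?thesis by simp
qed

lemma measurable_first_jump:
  assumes [measurable]: "(\<lambda>p. g (fst p) (snd p)) \<in> borel_measurable (borel \<Otimes>\<^sub>M borel)"
  shows "(\<lambda>p. first_jump g (fst p) t (snd p)) \<in> borel_measurable (borel \<Otimes>\<^sub>M borel)"
proof -
  have "(\<lambda>p. \<integral>\<^sup>+r. (if fst p \<le> r \<and> r \<le> t then ennreal (survival (fst p) r (snd p)) *
      (\<integral>\<^sup>+\<omega>. g r \<omega> \<partial>jump_kernel K r (snd p)) else 0) \<partial>lborel) \<in> borel_measurable (borel \<Otimes>\<^sub>M borel)"
    by measurable
  also have "(\<lambda>p. \<integral>\<^sup>+r. (if fst p \<le> r \<and> r \<le> t then ennreal (survival (fst p) r (snd p)) *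
      (\<integral>\<^sup>+\<omega>. g r \<omega> \<partial>jump_kernel K r (snd p)) else 0) \<partial>lborel) = (\<lambda>p. first_jump g (fst p) t (snd p))"
    unfolding first_jump_def by (intro ext nn_integral_cong) auto
  finally show ?thesis .
qed

lemma first_jump_add:
  assumes [measurable]: "(\<lambda>p. g (fst p) (snd p)) \<in> borel_measurable (borel \<Otimes>\<^sub>M borel)"
    "(\<lambda>p. h (fst p) (snd p)) \<in> borel_measurable (borel \<Otimes>\<^sub>M borel)"
  shows "first_jump (\<lambda>r \<omega>. g r \<omega> + h r \<omega>) s t \<eta> = first_jump g s t \<eta> + first_jump h s t \<eta>"
proof -
  have m: "g r \<in> borel_measurable borel" "h r \<in> borel_measurable borel" for r
    using measurable_compose[OF measurable_Pair1' assms(1), of r]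
      measurable_compose[OF measurable_Pair1' assms(2), of r] by simp_all
  then have "(\<integral>\<^sup>+\<omega>. g r \<omega> + h r \<omega> \<partial>jump_kernel K r \<eta>) =
      (\<integral>\<^sup>+\<omega>. g r \<omega> \<partial>jump_kernel K r \<eta>) + (\<integral>\<^sup>+\<omega>. h r \<omega> \<partial>jump_kernel K r \<eta>)" for r
    by (intro nn_integral_add) simp_all
  then show ?thesis
    unfolding first_jump_def by (simp add: ring_distribs nn_integral_add)
qed

lemma first_jump_cmult:
  assumes [measurable]: "(\<lambda>p. g (fst p) (snd p)) \<in> borel_measurable (borel \<Otimes>\<^sub>M borel)"
  shows "first_jump (\<lambda>r \<omega>. c * g r \<omega>) s t \<eta> = c * first_jump g s t \<eta>"
proof -
  have m: "g r \<in> borel_measurable borel" for r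
    using measurable_compose[OF measurable_Pair1' assms(1), of r] by simp
  then have "(\<integral>\<^sup>+\<omega>. c * g r \<omega> \<partial>jump_kernel K r \<eta>) = c * (\<integral>\<^sup>+\<omega>. g r \<omega> \<partial>jump_kernel K r \<eta>)" for r
    by (intro nn_integral_cmult) simp_all
  then show ?thesis
    unfolding first_jump_def by (subst nn_integral_cmult[symmetric]) (simp_all add: ac_simps)
qed

lemma first_jump_mono:
  assumes "\<And>r \<omega>. s \<le> r \<Longrightarrow> r \<le> t \<Longrightarrow> g r \<omega> \<le> h r \<omega>"
  shows "first_jump g s t \<eta> \<le> first_jump h s t \<eta>"
  unfolding first_jump_def
  by (intro nn_integral_mono) (auto simp: indicator_def intro!: mult_left_mono nn_integral_mono assms)

lemma first_jump_late: "t \<le> s \<Longrightarrow> first_jump g s t \<eta> = 0"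
proof -
  assume "t \<le> s"
  have "AE r in lborel. r \<noteq> s" by (rule AE_lborel_singleton)
  then have "first_jump g s t \<eta> = (\<integral>\<^sup>+r. 0 \<partial>(lborel :: real measure))"
    unfolding first_jump_def
    by (intro nn_integral_cong_AE) (use \<open>t \<le> s\<close> in \<open>auto elim!: eventually_mono simp: indicator_def\<close>)
  then show ?thesis by simp
qed

text \<open>A path without a jump before \<open>u\<close> starts afresh at time \<open>u\<close>.\<close>

lemma first_jump_split:
  assumes st: "s \<le> u" "u \<le> t" and [measurable]: "(\<lambda>p. g (fst p) (snd p)) \<in> borel_measurable (borel \<Otimes>\<^sub>M borel)"
  shows "first_jump g s t \<eta> = first_jump g s u \<eta> + ennreal (survival s u \<eta>) * first_jump g u t \<eta>"
proof -
  let ?G = "\<lambda>r. \<integral>\<^sup>+\<omega>. g r \<omega> \<partial>jump_kernel K r \<eta>"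
  have "AE r in lborel. r \<noteq> u" by (rule AE_lborel_singleton)
  then have "first_jump g s t \<eta> = (\<integral>\<^sup>+r. ennreal (survival s r \<eta>) * ?G r * indicator {s..u} r +
      ennreal (survival s u \<eta>) * (ennreal (survival u r \<eta>) * ?G r * indicator {u..t} r) \<partial>lborel)"
    unfolding first_jump_def
  proof (intro nn_integral_cong_AE, eventually_elim)
    case (elim r)
    consider "r < u" | "u < r" using elim by linarith
    then show ?case
    proof cases
      case 1
      then show ?thesis using st by (simp add: indicator_def)
    next
      case 2
      then have "survival s r \<eta> = survival s u \<eta> * survival u r \<eta>"
        using st by (intro survival_split) auto
      then show ?thesis
        using 2 st survival_pos by (simp add: indicator_def ennreal_mult less_imp_le mult.assoc)
    qed
  qed
  also have "\<dots> = first_jump g s u \<eta> + ennreal (survival s u \<eta>) * first_jump g u t \<eta>"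
    unfolding first_jump_def by (simp add: nn_integral_add nn_integral_cmult)
  finally show ?thesis .
qed

text \<open>If the generator maps \<open>V\<close> below \<open>C V\<close>, then \<open>e\<^bsup>C (t - s)\<^esup> V\<close> is a supersolution of the backward
  equation with final value \<open>V\<close>. With \<open>V = 1\<close> and \<open>C = 0\<close> this bounds the total mass by 1.\<close>

lemma first_jump_lyapunov:
  assumes "s \<le> t" "0 \<le> C" and V: "V \<in> borel_measurable borel" "\<And>\<eta>. 0 \<le> V \<eta>"
    and L: "\<And>r. s \<le> r \<Longrightarrow> r \<le> t \<Longrightarrow>
      (\<integral>\<^sup>+\<omega>. ennreal (V \<omega>) \<partial>jump_kernel K r \<eta>) \<le> ennreal ((C + jump_rate K r \<eta>) * V \<eta>)"
  shows "ennreal (survival s t \<eta> * V \<eta>) + first_jump (\<lambda>r \<omega>. ennreal (exp (C * (t - r)) * V \<omega>)) s t \<eta>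
    \<le> ennreal (exp (C * (t - s)) * V \<eta>)"
proof -
  note [measurable] = V(1)
  let ?f = "\<lambda>r. survival s r \<eta> * (exp (C * (t - r)) * (C + jump_rate K r \<eta>))"
  have f: "0 \<le> ?f r" for r
    using survival_pos[of s r \<eta>] assms(2) rate_nonneg[of r \<eta>] by simp
  have "first_jump (\<lambda>r \<omega>. ennreal (exp (C * (t - r)) * V \<omega>)) s t \<eta> \<le>
      (\<integral>\<^sup>+r. ennreal (V \<eta>) * (ennreal (?f r) * indicator {s..t} r) \<partial>lborel)"
    unfolding first_jump_def
  proof (intro nn_integral_mono)
    fix r :: real
    show "ennreal (survival s r \<eta>) * (\<integral>\<^sup>+\<omega>. ennreal (exp (C * (t - r)) * V \<omega>) \<partial>jump_kernel K r \<eta>) * indicator {s..t} r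
      \<le> ennreal (V \<eta>) * (ennreal (?f r) * indicator {s..t} r)"
    proof (cases "r \<in> {s..t}")
      case True
      have "(\<integral>\<^sup>+\<omega>. ennreal (exp (C * (t - r)) * V \<omega>) \<partial>jump_kernel K r \<eta>) =
          ennreal (exp (C * (t - r))) * (\<integral>\<^sup>+\<omega>. ennreal (V \<omega>) \<partial>jump_kernel K r \<eta>)"
        using V by (simp add: ennreal_mult nn_integral_cmult)
      also have "\<dots> \<le> ennreal (exp (C * (t - r))) * ennreal ((C + jump_rate K r \<eta>) * V \<eta>)"
        using True by (intro mult_left_mono L) auto
      finally have "ennreal (survival s r \<eta>) * (\<integral>\<^sup>+\<omega>. ennreal (exp (C * (t - r)) * V \<omega>) \<partial>jump_kernel K r \<eta>) \<le>
          ennreal (survival s r \<eta>) * (ennreal (exp (C * (t - r))) * ennreal ((C + jump_rate K r \<eta>) * V \<eta>))"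
        by (rule mult_left_mono) simp
      also have "\<dots> = ennreal (V \<eta>) * ennreal (?f r)"
        using V(2)[of \<eta>] survival_pos[of s r \<eta>] assms(2) rate_nonneg[of r \<eta>] f[of r]
        by (simp add: ac_simps flip: ennreal_mult')
      finally show ?thesis using True by simp
    qed simp
  qed
  also have "\<dots> = ennreal (V \<eta>) * (\<integral>\<^sup>+r\<in>{s..t}. ennreal (?f r) \<partial>lborel)"
    by (intro nn_integral_cmult) measurable
  finally have "ennreal (survival s t \<eta> * V \<eta>) + first_jump (\<lambda>r \<omega>. ennreal (exp (C * (t - r)) * V \<omega>)) s t \<eta>
      \<le> ennreal (survival s t \<eta> * V \<eta>) + ennreal (V \<eta>) * (\<integral>\<^sup>+r\<in>{s..t}. ennreal (?f r) \<partial>lborel)"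
    by (intro add_left_mono)
  also have "\<dots> = ennreal (V \<eta>) * (ennreal (survival s t \<eta>) + (\<integral>\<^sup>+r\<in>{s..t}. ennreal (?f r) \<partial>lborel))"
    using V(2) survival_pos[of s t \<eta>] by (simp add: ring_distribs ennreal_mult ac_simps)
  also have "\<dots> = ennreal (exp (C * (t - s)) * V \<eta>)"
    unfolding renewal[OF assms(1,2)] using V(2) by (simp add: ennreal_mult ac_simps)
  finally show ?thesis .
qed

lemma first_jump_1:
  assumes "s \<le> t"
  shows "ennreal (survival s t \<eta>) + first_jump (\<lambda>_ _. 1) s t \<eta> \<le> 1"
  using first_jump_lyapunov[of s t 0 "\<lambda>_. 1" \<eta>] assms by (simp add: emeasure_eq_rate)

subsection \<open>Partial sums of the transition series\<close>

lemma transition_term_Suc: "transition_term K (Suc n) s \<eta> t A = first_jump (\<lambda>r \<omega>. transition_term K n r \<omega> t A) s t \<eta>"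
  by (simp add: first_jump_def survival_def)

lemma measurable_transition_term [measurable]:
  assumes [measurable]: "A \<in> sets borel"
  shows "(\<lambda>p. transition_term K n (fst p) (snd p) t A) \<in> borel_measurable (borel \<Otimes>\<^sub>M borel)"
proof (induction n)
  case 0
  have "(\<lambda>p. indicator A (snd p) * ennreal (survival (fst p) t (snd p))) \<in> borel_measurable (borel \<Otimes>\<^sub>M borel)"
    by measurable
  then show ?case by (simp add: survival_def)
next
  case (Suc n)
  then show ?case unfolding transition_term_Suc by (rule measurable_first_jump)
qed

lemma measurable_transition_sum [measurable]:
  "A \<in> sets borel \<Longrightarrow> (\<lambda>p. transition_sum n (fst p) (snd p) t A) \<in> borel_measurable (borel \<Otimes>\<^sub>M borel)"
  unfolding transition_sum_def by (intro borel_measurable_sum measurable_transition_term)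

lemma transition_sum_Suc:
  assumes A: "A \<in> sets borel"
  shows "transition_sum (Suc n) s \<eta> t A =
    indicator A \<eta> * ennreal (survival s t \<eta>) + first_jump (\<lambda>r \<omega>. transition_sum n r \<omega> t A) s t \<eta>"
proof (induction n)
  case 0
  show ?case by (simp add: transition_sum_def first_jump_def survival_def)
next
  case (Suc n)
  have "transition_sum (Suc (Suc n)) s \<eta> t A =
      transition_sum (Suc n) s \<eta> t A + first_jump (\<lambda>r \<omega>. transition_term K n r \<omega> t A) s t \<eta>"
    unfolding transition_sum_def transition_term_Suc[symmetric] by simp
  also have "\<dots> = indicator A \<eta> * ennreal (survival s t \<eta>) +
      first_jump (\<lambda>r \<omega>. transition_sum n r \<omega> t A + transition_term K n r \<omega> t A) s t \<eta>"
    unfolding Suc.IH using A by (subst first_jump_add) (auto simp: ac_simps)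
  finally show ?case by (simp add: transition_sum_def)
qed

text \<open>For starting times after the final time the series is the identity. This makes the Lipschitz
  estimate below valid for all positions of the four times relative to each other.\<close>

lemma transition_sum_late:
  assumes "A \<in> sets borel" "t \<le> s"
  shows "transition_sum (Suc n) s \<eta> t A = indicator A \<eta>"
  using assms by (simp add: transition_sum_Suc first_jump_late survival_late)

lemma transition_sum_le_1:
  assumes A: "A \<in> sets borel"
  shows "transition_sum n s \<eta> t A \<le> 1"
proof (induction n arbitrary: s \<eta>)
  case 0
  show ?case by (simp add: transition_sum_def)
next
  case (Suc n)
  show ?case
  proof (cases "s \<le> t")
    case True
    have "transition_sum (Suc n) s \<eta> t A \<le> 1 * ennreal (survival s t \<eta>) + first_jump (\<lambda>_ _. 1) s t \<eta>"
      unfolding transition_sum_Suc[OF A]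
      by (intro add_mono mult_right_mono first_jump_mono Suc.IH) (auto simp: indicator_def)
    then show ?thesis using first_jump_1[OF True, of \<eta>] by simp
  next
    case False
    then show ?thesis using transition_sum_late[OF A, of t s n \<eta>] by (simp add: indicator_def)
  qed
qed

lemma transition_sum_split:
  assumes A: "A \<in> sets borel" and "s \<le> u" "u \<le> t"
  shows "transition_sum (Suc n) s \<eta> t A = ennreal (survival s u \<eta>) * transition_sum (Suc n) u \<eta> t A +
    first_jump (\<lambda>r \<omega>. transition_sum n r \<omega> t A) s u \<eta>"
proof -
  have "ennreal (survival s t \<eta>) = ennreal (survival s u \<eta>) * ennreal (survival u t \<eta>)"
    using survival_split[OF assms(2,3)] survival_pos by (simp add: ennreal_mult less_imp_le)
  then show ?thesis
    unfolding transition_sum_Suc[OF A] using A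
    by (subst first_jump_split[OF assms(2,3)]) (auto simp: ring_distribs ac_simps)
qed

text \<open>A path that does not jump before \<open>u\<close> cannot tell the starting times \<open>s\<close> and \<open>u\<close> apart, and all
  values lie between 0 and 1.\<close>

lemma transition_sum_start:
  assumes A: "A \<in> sets borel" and su: "s \<le> u"
  shows "transition_sum (Suc n) s \<eta> t A \<le> transition_sum (Suc n) u \<eta> t A + ennreal (1 - survival s u \<eta>) \<and>
    transition_sum (Suc n) u \<eta> t A \<le> transition_sum (Suc n) s \<eta> t A + ennreal (1 - survival s u \<eta>)"
proof -
  have main: "transition_sum (Suc n) s \<eta> t A \<le> transition_sum (Suc n) u \<eta> t A + ennreal (1 - survival s u \<eta>) \<and>
    transition_sum (Suc n) u \<eta> t A \<le> transition_sum (Suc n) s \<eta> t A + ennreal (1 - survival s u \<eta>)"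
    if "s \<le> u" "u \<le> t" for u
  proof -
    let ?p = "survival s u \<eta>" and ?T = "transition_sum (Suc n) u \<eta> t A"
    have p: "0 < ?p" "?p \<le> 1" by (rule survival_pos survival_le_1)+
    have "first_jump (\<lambda>r \<omega>. transition_sum n r \<omega> t A) s u \<eta> \<le> first_jump (\<lambda>_ _. 1) s u \<eta>"
      by (intro first_jump_mono transition_sum_le_1 A)
    also have "\<dots> \<le> ennreal (1 - ?p)"
    proof -
      have "ennreal ?p + first_jump (\<lambda>_ _. 1) s u \<eta> \<le> ennreal ?p + ennreal (1 - ?p)"
        using first_jump_1[OF that(1), of \<eta>] p by (simp flip: ennreal_plus)
      then show ?thesis by (simp add: ennreal_add_left_cancel_le)
    qed
    finally have fj: "first_jump (\<lambda>r \<omega>. transition_sum n r \<omega> t A) s u \<eta> \<le> ennreal (1 - ?p)" .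
    have "transition_sum (Suc n) s \<eta> t A \<le> 1 * ?T + ennreal (1 - ?p)"
      unfolding transition_sum_split[OF A that] using p
      by (intro add_mono mult_right_mono fj) auto
    \<comment> \<open>The reverse bound splits \<open>1 = p + (1 - p)\<close> in front of the later sum.\<close>
    moreover have "?T = ennreal ?p * ?T + ennreal (1 - ?p) * ?T"
      using p by (simp flip: distrib_right ennreal_plus)
    then have "?T \<le> ennreal ?p * ?T + ennreal (1 - ?p) * 1"
      using transition_sum_le_1[OF A, of "Suc n" u \<eta> t]
      by (metis add_left_mono mult_left_mono zero_le)
    then have "?T \<le> transition_sum (Suc n) s \<eta> t A + ennreal (1 - ?p)"
      unfolding transition_sum_split[OF A that] by (elim order_trans) (simp add: add_right_mono)
    ultimately show ?thesis by simp
  qed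
  consider "u \<le> t" | "s \<le> t" "t < u" | "t < s" by linarith
  then show ?thesis
  proof cases
    case 1
    then show ?thesis using main su by blast
  next
    case 2
    have "survival s u \<eta> \<le> survival s t \<eta>"
      using survival_split[of s t u \<eta>] 2 survival_pos[of s t \<eta>] survival_le_1[of t u \<eta>] by simp
    then have le: "ennreal (1 - survival s t \<eta>) \<le> ennreal (1 - survival s u \<eta>)"
      by (intro ennreal_leI) simp
    have "transition_sum (Suc n) u \<eta> t A = transition_sum (Suc n) t \<eta> t A"
      using 2 by (simp add: transition_sum_late[OF A])
    then show ?thesis
      using main[of t] 2 add_left_mono[OF le] by (auto intro: order_trans)
  next
    case 3
    then show ?thesis using su by (simp add: transition_sum_late[OF A])
  qed
qed

text \<open>The difference of the partial sums for the final times \<open>t\<close> and \<open>t'\<close> satisfies, on \<open>[s, t]\<close>, the backward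
  equation with a final value of size at most \<open>D V\<close>. The supersolution \<open>D e\<^bsup>C (t - s)\<^esup> V\<close> therefore
  dominates it, with constants that do not depend on \<open>n\<close>. Truncating the series at the same \<open>n\<close> for
  both final times starts the induction at difference 0.\<close>

lemma transition_sum_end:
  assumes A: "A \<in> sets borel" and st: "s \<le> t" "t \<le> t'" and C: "0 \<le> C" and D: "0 \<le> D"
    and V: "V \<in> borel_measurable borel" "\<And>\<eta>. 0 \<le> V \<eta>"
    and L: "\<And>r \<eta>. s \<le> r \<Longrightarrow> r \<le> t \<Longrightarrow>
      (\<integral>\<^sup>+\<omega>. ennreal (V \<omega>) \<partial>jump_kernel K r \<eta>) \<le> ennreal ((C + jump_rate K r \<eta>) * V \<eta>)"
    and surv: "\<And>\<eta>. 1 - survival t t' \<eta> \<le> D * V \<eta>"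
  shows "transition_sum n s \<eta> t A \<le> transition_sum n s \<eta> t' A + ennreal (D * (exp (C * (t - s)) * V \<eta>)) \<and>
    transition_sum n s \<eta> t' A \<le> transition_sum n s \<eta> t A + ennreal (D * (exp (C * (t - s)) * V \<eta>))"
  using st(1) L
proof (induction n arbitrary: s \<eta>)
  case 0
  show ?case by (simp add: transition_sum_def)
next
  case (Suc n)
  note [measurable] = V(1) A
  let ?p = "ennreal (survival s t \<eta>)"
  let ?H = "\<lambda>r \<omega>. ennreal (exp (C * (t - r)) * V \<omega>)"
  let ?S = "\<lambda>t r \<omega>. transition_sum n r \<omega> t A"
  have IH: "?S t r \<omega> \<le> ?S t' r \<omega> + ennreal D * ?H r \<omega>" "?S t' r \<omega> \<le> ?S t r \<omega> + ennreal D * ?H r \<omega>"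
    if "s \<le> r" "r \<le> t" for r \<omega>
    using Suc.IH[OF that(2), of \<omega>] Suc.prems(2) that D by (auto simp: ennreal_mult')
  have add: "first_jump (\<lambda>r \<omega>. g r \<omega> + ennreal D * ?H r \<omega>) s t \<eta> = first_jump g s t \<eta> + ennreal D * first_jump ?H s t \<eta>"
    if [measurable]: "(\<lambda>p. g (fst p) (snd p)) \<in> borel_measurable (borel \<Otimes>\<^sub>M borel)" for g
    by (subst first_jump_add) (auto simp: first_jump_cmult)
  have fj: "first_jump (?S t) s t \<eta> \<le> first_jump (?S t') s t \<eta> + ennreal D * first_jump ?H s t \<eta>"
    "first_jump (?S t') s t \<eta> \<le> first_jump (?S t) s t \<eta> + ennreal D * first_jump ?H s t \<eta>"
    using IH by (subst add[symmetric]; auto intro!: first_jump_mono)+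
  have "ennreal (1 - survival t t' \<eta>) \<le> ennreal (D * V \<eta>)"
    using surv by (rule ennreal_leI)
  then have ind: "indicator A \<eta> \<le> transition_sum (Suc n) t \<eta> t' A + ennreal (D * V \<eta>)"
    "transition_sum (Suc n) t \<eta> t' A \<le> indicator A \<eta> + ennreal (D * V \<eta>)"
    using transition_sum_start[OF A st(2), of n \<eta> t'] transition_sum_late[OF A order_refl, of n t' \<eta>]
    by (auto intro: order_trans add_left_mono)
  \<comment> \<open>The two errors add up to the left-hand side of the supersolution inequality.\<close>
  have bound: "?p * ennreal (D * V \<eta>) + ennreal D * first_jump ?H s t \<eta> \<le> ennreal (D * (exp (C * (t - s)) * V \<eta>))"
  proof -
    have "?p * ennreal (D * V \<eta>) + ennreal D * first_jump ?H s t \<eta> =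
        ennreal D * (ennreal (survival s t \<eta> * V \<eta>) + first_jump ?H s t \<eta>)"
      using D V(2)[of \<eta>] survival_pos[of s t \<eta>] by (simp add: ring_distribs ennreal_mult ac_simps)
    also have "\<dots> \<le> ennreal D * ennreal (exp (C * (t - s)) * V \<eta>)"
      using Suc.prems C V by (intro mult_left_mono first_jump_lyapunov) auto
    finally show ?thesis using D by (simp add: ennreal_mult')
  qed
  have t: "transition_sum (Suc n) s \<eta> t A = ?p * indicator A \<eta> + first_jump (?S t) s t \<eta>"
    by (simp add: transition_sum_Suc mult.commute)
  have t': "transition_sum (Suc n) s \<eta> t' A = ?p * transition_sum (Suc n) t \<eta> t' A + first_jump (?S t') s t \<eta>"
    by (rule transition_sum_split[OF A Suc.prems(1) st(2)])
  have "transition_sum (Suc n) s \<eta> t A \<le> ?p * (transition_sum (Suc n) t \<eta> t' A + ennreal (D * V \<eta>)) +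
      (first_jump (?S t') s t \<eta> + ennreal D * first_jump ?H s t \<eta>)"
    unfolding t by (intro add_mono mult_left_mono ind fj) auto
  also have "\<dots> = transition_sum (Suc n) s \<eta> t' A + (?p * ennreal (D * V \<eta>) + ennreal D * first_jump ?H s t \<eta>)"
    unfolding t' by (simp add: ring_distribs ac_simps)
  finally have 1: "transition_sum (Suc n) s \<eta> t A \<le> \<dots>" .
  have "transition_sum (Suc n) s \<eta> t' A \<le> ?p * (indicator A \<eta> + ennreal (D * V \<eta>)) +
      (first_jump (?S t) s t \<eta> + ennreal D * first_jump ?H s t \<eta>)"
    unfolding t' by (intro add_mono mult_left_mono ind fj) auto
  also have "\<dots> = transition_sum (Suc n) s \<eta> t A + (?p * ennreal (D * V \<eta>) + ennreal D * first_jump ?H s t \<eta>)"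
    unfolding t by (simp add: ring_distribs ac_simps)
  finally have 2: "transition_sum (Suc n) s \<eta> t' A \<le> \<dots>" .
  show ?case
    using order_trans[OF 1 add_left_mono[OF bound]] order_trans[OF 2 add_left_mono[OF bound]] by simp
qed

end

section \<open>Regularity of the transition function\<close>

context jump_evolution
begin

lemma transition_eq_SUP: "transition K s \<eta> t A = (SUP n. transition_sum n s \<eta> t A)"
  by (simp add: transition_def transition_sum_def suminf_eq_SUP)

lemma transition_le_1: "A \<in> sets borel \<Longrightarrow> transition K s \<eta> t A \<le> 1"
  unfolding transition_eq_SUP by (intro SUP_least transition_sum_le_1)

lemma measurable_transition:
  assumes [measurable]: "A \<in> sets borel"
  shows "(\<lambda>\<eta>. transition K s \<eta> t A) \<in> borel_measurable borel"
proof -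
  have "(\<lambda>\<eta>. transition_term K n s \<eta> t A) \<in> borel_measurable borel" for n
    using measurable_compose[OF measurable_Pair1' measurable_transition_term[OF assms], of s] by simp
  then show ?thesis unfolding transition_def by measurable
qed

text \<open>Combines \<open>transition_sum_start\<close> and \<open>transition_sum_end\<close>. When the starting time lies between the two
  final times, the sum for the earlier one is the identity, and only the starting time has to be moved.\<close>

lemma transition_sum_lipschitz:
  assumes A: "A \<in> sets borel" and C: "0 \<le> C" and a: "0 \<le> a"
    and V: "V \<in> borel_measurable borel" "\<And>\<eta>. 0 \<le> V \<eta>"
    and L: "\<And>r \<eta>. 0 \<le> r \<Longrightarrow> r \<le> T \<Longrightarrow>
      (\<integral>\<^sup>+\<omega>. ennreal (V \<omega>) \<partial>jump_kernel K r \<eta>) \<le> ennreal ((C + jump_rate K r \<eta>) * V \<eta>)"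
    and q: "\<And>r \<eta>. 0 \<le> r \<Longrightarrow> r \<le> T \<Longrightarrow> jump_rate K r \<eta> \<le> a * V \<eta>"
    and T: "s \<in> {0..T}" "s' \<in> {0..T}" "t \<in> {0..T}" "t' \<in> {0..T}"
  shows "transition_sum (Suc n) s \<eta> t A \<le> transition_sum (Suc n) s' \<eta> t' A +
    ennreal ((\<bar>s - s'\<bar> + \<bar>t - t'\<bar>) * (a * exp (C * T) * V \<eta>))"
proof -
  let ?S = "\<lambda>s t. transition_sum (Suc n) s \<eta> t A"
  let ?L = "a * exp (C * T) * V \<eta>"
  have T0: "0 \<le> T" using T by auto
  have aV: "a * V \<eta> \<le> ?L"
  proof -
    have "a * 1 \<le> a * exp (C * T)"
      using a C T0 by (intro mult_left_mono) auto
    from mult_right_mono[OF this V(2)[of \<eta>]] show ?thesis by simp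
  qed
  have surv: "1 - survival s u \<eta> \<le> (u - s) * (a * V \<eta>)" if "s \<in> {0..T}" "u \<in> {0..T}" "s \<le> u" for s u \<eta>
    using that by (intro one_minus_survival_le q) auto
  have L0: "0 \<le> ?L" using a V by simp
  have start: "?S s t \<le> ?S u t + ennreal (\<bar>s - u\<bar> * ?L)" if "s \<in> {0..T}" "u \<in> {0..T}" for s u t
  proof -
    have *: "?S s t \<le> ?S u t + ennreal (\<bar>s - u\<bar> * ?L) \<and> ?S u t \<le> ?S s t + ennreal (\<bar>s - u\<bar> * ?L)"
      if "s \<in> {0..T}" "u \<in> {0..T}" "s \<le> u" for s u
    proof -
      have "1 - survival s u \<eta> \<le> \<bar>s - u\<bar> * ?L"
        using surv[OF that, of \<eta>] mult_left_mono[OF aV, of "u - s"] that(3) by simp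
      then have "ennreal (1 - survival s u \<eta>) \<le> ennreal (\<bar>s - u\<bar> * ?L)"
        by (rule ennreal_leI)
      then show ?thesis
        using transition_sum_start[OF A that(3), of n \<eta> t] by (auto intro: order_trans add_left_mono)
    qed
    show ?thesis
      using *[of s u] *[of u s] that by (cases "s \<le> u") (auto simp: abs_minus_commute)
  qed
  have fin: "?S s t \<le> ?S s t' + ennreal (\<bar>t - t'\<bar> * ?L)" if "t \<in> {0..T}" "t' \<in> {0..T}" for t t'
  proof -
    have *: "?S s t \<le> ?S s t' + ennreal (\<bar>t - t'\<bar> * ?L) \<and> ?S s t' \<le> ?S s t + ennreal (\<bar>t - t'\<bar> * ?L)"
      if t: "t \<in> {0..T}" "t' \<in> {0..T}" "t \<le> t'" for t t'
    proof -
      consider "s \<le> t" | "t < s" "s \<le> t'" | "t' < s" by linarith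
      then show ?thesis
      proof cases
        case 1
        let ?D = "(t' - t) * a"
        have D: "0 \<le> ?D" using t a by simp
        have "?D * (exp (C * (t - s)) * V \<eta>) \<le> ?D * (exp (C * T) * V \<eta>)"
          using D V(2)[of \<eta>] C t T(1) by (intro mult_left_mono mult_right_mono) (auto intro!: mult_left_mono)
        also have "\<dots> = \<bar>t - t'\<bar> * ?L" using t by simp
        finally have "ennreal (?D * (exp (C * (t - s)) * V \<eta>)) \<le> ennreal (\<bar>t - t'\<bar> * ?L)"
          by (rule ennreal_leI)
        moreover have "?S s t \<le> ?S s t' + ennreal (?D * (exp (C * (t - s)) * V \<eta>)) \<and>
            ?S s t' \<le> ?S s t + ennreal (?D * (exp (C * (t - s)) * V \<eta>))"
          using 1 t T(1) surv[OF t] by (intro transition_sum_end[OF A 1 t(3) C D V]) (auto intro: L simp: mult.assoc)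
        ultimately show ?thesis by (auto intro: order_trans add_left_mono)
      next
        case 2
        have eq: "?S s t = ?S t' t'"
          using 2 by (simp add: transition_sum_late[OF A])
        have "\<bar>s - t'\<bar> * ?L \<le> \<bar>t - t'\<bar> * ?L"
          using 2 L0 by (intro mult_right_mono) auto
        then have "ennreal (\<bar>s - t'\<bar> * ?L) \<le> ennreal (\<bar>t - t'\<bar> * ?L)"
          by (rule ennreal_leI)
        then show ?thesis
          using start[OF T(1) t(2), of t'] start[OF t(2) T(1), of t']
          by (auto simp: eq abs_minus_commute intro: order_trans add_left_mono)
      next
        case 3
        then show ?thesis using t by (simp add: transition_sum_late[OF A])
      qed
    qed
    show ?thesis
      using *[of t t'] *[of t' t] that by (cases "t \<le> t'") (auto simp: abs_minus_commute)
  qed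
  have "?S s t \<le> ?S s t' + ennreal (\<bar>t - t'\<bar> * ?L)"
    by (rule fin[OF T(3,4)])
  also have "\<dots> \<le> ?S s' t' + ennreal (\<bar>s - s'\<bar> * ?L) + ennreal (\<bar>t - t'\<bar> * ?L)"
    by (intro add_right_mono start T)
  also have "\<dots> = ?S s' t' + ennreal ((\<bar>s - s'\<bar> + \<bar>t - t'\<bar>) * ?L)"
    using L0 by (simp add: ring_distribs add.assoc)
  finally show ?thesis .
qed

lemma transition_lipschitz:
  assumes A: "A \<in> sets borel" and C: "0 \<le> C" and a: "0 \<le> a"
    and V: "V \<in> borel_measurable borel" "\<And>\<eta>. 0 \<le> V \<eta>"
    and L: "\<And>r \<eta>. 0 \<le> r \<Longrightarrow> r \<le> T \<Longrightarrow>
      (\<integral>\<^sup>+\<omega>. ennreal (V \<omega>) \<partial>jump_kernel K r \<eta>) \<le> ennreal ((C + jump_rate K r \<eta>) * V \<eta>)"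
    and q: "\<And>r \<eta>. 0 \<le> r \<Longrightarrow> r \<le> T \<Longrightarrow> jump_rate K r \<eta> \<le> a * V \<eta>"
    and T: "s \<in> {0..T}" "s' \<in> {0..T}" "t \<in> {0..T}" "t' \<in> {0..T}"
  shows "\<bar>enn2real (transition K s \<eta> t A) - enn2real (transition K s' \<eta> t' A)\<bar> \<le>
    (\<bar>s - s'\<bar> + \<bar>t - t'\<bar>) * (a * exp (C * T) * V \<eta>)"
proof -
  have le: "enn2real (transition K s \<eta> t A) \<le> enn2real (transition K s' \<eta> t' A) +
      (\<bar>s - s'\<bar> + \<bar>t - t'\<bar>) * (a * exp (C * T) * V \<eta>)"
    if "s \<in> {0..T}" "s' \<in> {0..T}" "t \<in> {0..T}" "t' \<in> {0..T}" for s s' t t'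
  proof -
    let ?d = "(\<bar>s - s'\<bar> + \<bar>t - t'\<bar>) * (a * exp (C * T) * V \<eta>)"
    have d: "0 \<le> ?d" using a V by simp
    have "transition K s \<eta> t A \<le> transition K s' \<eta> t' A + ennreal ?d"
      unfolding transition_eq_SUP[of s]
    proof (rule SUP_least)
      fix n
      have "transition_sum n s \<eta> t A \<le> transition_sum (Suc n) s \<eta> t A"
        by (simp add: transition_sum_def)
      also have "\<dots> \<le> transition_sum (Suc n) s' \<eta> t' A + ennreal ?d"
        by (rule transition_sum_lipschitz[OF A C a V L q that])
      also have "\<dots> \<le> transition K s' \<eta> t' A + ennreal ?d"
        unfolding transition_eq_SUP by (intro add_right_mono SUP_upper) simp
      finally show "transition_sum n s \<eta> t A \<le> transition K s' \<eta> t' A + ennreal ?d" .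
    qed
    moreover have fin: "transition K s \<eta> t A < top" for s t
      using transition_le_1[OF A, of s \<eta> t] by (rule le_less_trans) simp
    ultimately have "enn2real (transition K s \<eta> t A) \<le> enn2real (transition K s' \<eta> t' A + ennreal ?d)"
      using fin[of s' t'] by (intro enn2real_mono) (auto simp: less_top)
    also have "\<dots> = enn2real (transition K s' \<eta> t' A) + ?d"
      using fin[of s' t'] d by (subst enn2real_plus) auto
    finally show ?thesis .
  qed
  show ?thesis
    using le[OF T] le[OF T(2,1,4,3)] by (simp add: abs_minus_commute abs_le_iff)
qed

lemma transition_term_countably_additive:
  assumes B: "range B \<subseteq> sets borel" "disjoint_family B"
  shows "(\<Sum>i. transition_term K n s \<eta> t (B i)) = transition_term K n s \<eta> t (\<Union>i. B i)"
proof (induction n arbitrary: s \<eta>)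
  case 0
  show ?case
    by (simp add: suminf_indicator[OF B(2)])
next
  case (Suc n)
  have [measurable]: "B i \<in> sets borel" for i using B by auto
  have m: "(\<lambda>\<omega>. transition_term K n r \<omega> t (B i)) \<in> borel_measurable borel" for r i
    using measurable_compose[OF measurable_Pair1' measurable_transition_term, of r] by simp
  have "(\<Sum>i. transition_term K (Suc n) s \<eta> t (B i)) =
      (\<integral>\<^sup>+r. (\<Sum>i. ennreal (survival s r \<eta>) * (\<integral>\<^sup>+\<omega>. transition_term K n r \<omega> t (B i) \<partial>jump_kernel K r \<eta>) * indicator {s..t} r) \<partial>lborel)"
    unfolding transition_term_Suc first_jump_def by (intro nn_integral_suminf[symmetric]) measurable
  also have "\<dots> = (\<integral>\<^sup>+r\<in>{s..t}. ennreal (survival s r \<eta>) * (\<integral>\<^sup>+\<omega>. (\<Sum>i. transition_term K n r \<omega> t (B i)) \<partial>jump_kernel K r \<eta>) \<partial>lborel)"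
    using m by (simp add: nn_integral_suminf)
  finally show ?case
    by (simp only: Suc.IH transition_term_Suc first_jump_def)
qed

lemma transition_countably_additive:
  assumes B: "range B \<subseteq> sets borel" "disjoint_family B"
  shows "(\<Sum>i. transition K s \<eta> t (B i)) = transition K s \<eta> t (\<Union>i. B i)"
proof -
  have swap: "(\<Sum>i n. f n i) = (\<Sum>n i. f n i)" for f :: "nat \<Rightarrow> nat \<Rightarrow> ennreal"
    using nn_integral_suminf[of f "count_space UNIV"] by (simp add: nn_integral_count_space_nat)
  show ?thesis
    unfolding transition_def
    by (subst swap) (simp only: transition_term_countably_additive[OF B])
qed

text \<open>The null set of exceptional configurations for a jump at time \<open>r\<close> depends on \<open>r\<close>; joint
  measurability allows to exchange the order of the two quantifiers.\<close>

lemma AE_transition_null: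
  assumes K: "\<And>t \<xi> \<eta>. sets (K t \<xi> \<eta>) = sets borel"
    and ac: "\<And>t \<xi> \<eta>. absolutely_continuous lebesgue_poisson (K t \<xi> \<eta>)"
    and N: "N \<in> null_sets lebesgue_poisson"
  shows "AE \<eta> in lebesgue_poisson. transition K s \<eta> t N = 0"
proof -
  interpret lp: sigma_finite_measure "lebesgue_poisson :: 'a fset measure"
    by (rule sigma_finite_lebesgue_poisson)
  interpret pair_sigma_finite lborel "lebesgue_poisson :: 'a fset measure" ..
  have Nb[measurable]: "N \<in> sets borel" using N by auto
  have "AE \<eta> in lebesgue_poisson. transition_term K n s \<eta> t N = 0" for n s
  proof (induction n arbitrary: s)
    case 0
    have "AE \<eta> in lebesgue_poisson. \<eta> \<notin> N" using N by (rule AE_not_in)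
    then show ?case by eventually_elim simp
  next
    case (Suc n)
    define g where "g r \<eta> = (\<integral>\<^sup>+\<omega>. transition_term K n r \<omega> t N \<partial>jump_kernel K r \<eta>)" for r \<eta>
    have m[measurable]: "(\<lambda>\<omega>. transition_term K n r \<omega> t N) \<in> borel_measurable borel" for r
      using measurable_compose[OF measurable_Pair1' measurable_transition_term[OF Nb], of r] by simp
    have g: "(\<lambda>p. g (fst p) (snd p)) \<in> borel_measurable (lborel \<Otimes>\<^sub>M (lebesgue_poisson :: 'a fset measure))"
      unfolding g_def by measurable
    have "AE \<eta> in lebesgue_poisson. g r \<eta> = 0" for r
    proof -
      define M where "M = {\<omega> \<in> space borel. transition_term K n r \<omega> t N \<noteq> 0}"
      have [measurable]: "M \<in> sets borel" unfolding M_def by measurable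
      have "M \<in> null_sets lebesgue_poisson"
        using Suc.IH[of r] by (subst AE_iff_null_sets) (auto simp: M_def)
      then have "AE \<eta> in lebesgue_poisson. emeasure (jump_kernel K r \<eta>) M = 0"
        using K ac by (intro AE_jump_kernel_null)
      then show ?thesis
      proof eventually_elim
        case (elim \<eta>)
        then have "AE \<omega> in jump_kernel K r \<eta>. \<omega> \<notin> M"
          by (intro AE_not_in) (simp add: null_sets_def)
        then have "AE \<omega> in jump_kernel K r \<eta>. transition_term K n r \<omega> t N = 0"
          by eventually_elim (simp add: M_def)
        then show ?case
          unfolding g_def by (subst nn_integral_0_iff_AE) auto
      qed
    qed
    then have "AE r in lborel. AE \<eta> in lebesgue_poisson. g r \<eta> = 0" by simp
    then have "AE \<eta> in lebesgue_poisson. AE r in lborel. g r \<eta> = 0"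
    proof (rule AE_commute[THEN iffD1, rotated])
      show "{p \<in> space (lborel \<Otimes>\<^sub>M lebesgue_poisson). g (fst p) (snd p) = 0} \<in>
          sets (lborel \<Otimes>\<^sub>M (lebesgue_poisson :: 'a fset measure))"
        using g by (rule borel_measurable_eq) simp
    qed
    then show ?case
    proof eventually_elim
      case (elim \<eta>)
      then have "first_jump (\<lambda>r \<omega>. transition_term K n r \<omega> t N) s t \<eta> = (\<integral>\<^sup>+r. 0 \<partial>(lborel :: real measure))"
        unfolding first_jump_def g_def[symmetric] by (intro nn_integral_cong_AE) auto
      then show ?case unfolding transition_term_Suc by simp
    qed
  qed
  then have "AE \<eta> in lebesgue_poisson. \<forall>n. transition_term K n s \<eta> t N = 0"
    by (simp add: AE_all_countable)
  then show ?thesis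
    by eventually_elim (simp add: transition_def)
qed

end

section \<open>Densities of images under a kernel\<close>

text \<open>The image of \<open>R dM\<close> under the kernel is finite since \<open>P \<le> 1\<close>, and the almost everywhere vanishing of
  \<open>P x N\<close> makes it absolutely continuous, so that the Radon--Nikodym theorem applies.\<close>

lemma (in sigma_finite_measure) kernel_density_nonneg:
  fixes P :: "'a \<Rightarrow> 'a set \<Rightarrow> ennreal" and R :: "'a \<Rightarrow> real"
  assumes le1: "\<And>x A. A \<in> sets M \<Longrightarrow> P x A \<le> 1"
    and meas: "\<And>A. A \<in> sets M \<Longrightarrow> (\<lambda>x. P x A) \<in> borel_measurable M"
    and add: "\<And>x B. range B \<subseteq> sets M \<Longrightarrow> disjoint_family B \<Longrightarrow> (\<Sum>i :: nat. P x (B i)) = P x (\<Union>i. B i)"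
    and null: "\<And>N. N \<in> null_sets M \<Longrightarrow> AE x in M. P x N = 0"
    and R: "integrable M R" "\<And>x. 0 \<le> R x"
  shows "\<exists>\<rho>. integrable M \<rho> \<and> (\<forall>A\<in>sets M. (\<integral>x. R x * enn2real (P x A) \<partial>M) = (LINT x:A|M. \<rho> x))"
proof -
  have [measurable]: "R \<in> borel_measurable M" using R by auto
  note [measurable] = meas
  define \<nu> where "\<nu> = measure_of (space M) (sets M) (\<lambda>A. \<integral>\<^sup>+x. ennreal (R x) * P x A \<partial>M)"
  have sets\<nu>: "sets \<nu> = sets M" and space\<nu>: "space \<nu> = space M"
    by (simp_all add: \<nu>_def sets.sigma_sets_eq sets.space_closed)
  have em: "emeasure \<nu> A = (\<integral>\<^sup>+x. ennreal (R x) * P x A \<partial>M)" if A: "A \<in> sets M" for A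
  proof (rule emeasure_measure_of[OF \<nu>_def])
    show "positive (sets \<nu>) (\<lambda>A. \<integral>\<^sup>+x. ennreal (R x) * P x A \<partial>M)"
      using null[of "{}"] by (auto simp: positive_def nn_integral_0_iff_AE elim!: eventually_mono)
    show "countably_additive (sets \<nu>) (\<lambda>A. \<integral>\<^sup>+x. ennreal (R x) * P x A \<partial>M)"
    proof (rule countably_additiveI)
      fix B :: "nat \<Rightarrow> 'a set" assume B: "range B \<subseteq> sets \<nu>" "disjoint_family B"
      have [measurable]: "B i \<in> sets M" for i using B sets\<nu> by auto
      have "(\<Sum>i. \<integral>\<^sup>+x. ennreal (R x) * P x (B i) \<partial>M) = (\<integral>\<^sup>+x. (\<Sum>i. ennreal (R x) * P x (B i)) \<partial>M)"
        by (intro nn_integral_suminf[symmetric]) measurable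
      then show "(\<Sum>i. \<integral>\<^sup>+x. ennreal (R x) * P x (B i) \<partial>M) = (\<integral>\<^sup>+x. ennreal (R x) * P x (\<Union>i. B i) \<partial>M)"
        using B by (simp add: sets\<nu> add)
    qed
  qed (use A sets.space_closed in \<open>auto simp: sets\<nu>\<close>)
  have fin: "emeasure \<nu> A < \<infinity>" if A: "A \<in> sets M" for A
  proof -
    have "emeasure \<nu> A \<le> (\<integral>\<^sup>+x. ennreal (R x) * 1 \<partial>M)"
      unfolding em[OF A] by (intro nn_integral_mono mult_left_mono le1 A) auto
    also have "\<dots> < \<infinity>" using R by (simp add: nn_integral_eq_integral)
    finally show ?thesis .
  qed
  have "absolutely_continuous M \<nu>"
    unfolding absolutely_continuous_def
  proof
    fix N assume N: "N \<in> null_sets M"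
    then have "emeasure \<nu> N = 0"
      using null[OF N] by (auto simp: em nn_integral_0_iff_AE elim!: eventually_mono)
    then show "N \<in> null_sets \<nu>" using N by (auto simp: null_sets_def sets\<nu>)
  qed
  then obtain f where f[measurable]: "f \<in> borel_measurable M" and d: "density M f = \<nu>"
    using Radon_Nikodym sets\<nu> by blast
  have nn: "(\<integral>\<^sup>+x. f x * indicator A x \<partial>M) = emeasure \<nu> A" if "A \<in> sets M" for A
    using that by (simp add: emeasure_density flip: d)
  have "(\<integral>\<^sup>+x. f x \<partial>M) = emeasure \<nu> (space M)"
    using nn[OF sets.top] by (simp cong: nn_integral_cong_simp)
  then have ffin: "(\<integral>\<^sup>+x. f x \<partial>M) \<noteq> \<infinity>"
    using fin[OF sets.top] by simp
  then have "AE x in M. f x \<noteq> \<infinity>"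
    by (intro nn_integral_PInf_AE f)
  then have fr: "AE x in M. ennreal (enn2real (f x)) = f x"
    by eventually_elim (simp add: less_top)
  show ?thesis
  proof (intro exI conjI ballI)
    have "(\<integral>\<^sup>+x. ennreal (enn2real (f x)) \<partial>M) = (\<integral>\<^sup>+x. f x \<partial>M)"
      using fr by (rule nn_integral_cong_AE)
    then show "integrable M (\<lambda>x. enn2real (f x))"
      using ffin by (intro integrableI_nonneg) (auto simp: less_top)
    fix A assume A[measurable]: "A \<in> sets M"
    have "(\<integral>x. R x * enn2real (P x A) \<partial>M) = enn2real (\<integral>\<^sup>+x. ennreal (R x * enn2real (P x A)) \<partial>M)"
      using R by (intro integral_eq_nn_integral) auto
    also have "(\<integral>\<^sup>+x. ennreal (R x * enn2real (P x A)) \<partial>M) = emeasure \<nu> A"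
      unfolding em[OF A]
    proof (intro nn_integral_cong)
      fix x
      have "P x A < top" using le1[OF A, of x] by (rule le_less_trans) simp
      then show "ennreal (R x * enn2real (P x A)) = ennreal (R x) * P x A"
        using R(2) by (simp add: ennreal_mult)
    qed
    also have "emeasure \<nu> A = (\<integral>\<^sup>+x. ennreal (indicator A x * enn2real (f x)) \<partial>M)"
      unfolding nn[OF A, symmetric] using fr
      by (intro nn_integral_cong_AE) (auto elim!: eventually_mono simp: indicator_def)
    also have "enn2real \<dots> = (LINT x:A|M. enn2real (f x))"
      unfolding set_lebesgue_integral_def
      by (subst integral_eq_nn_integral) auto
    finally show "(\<integral>x. R x * enn2real (P x A) \<partial>M) = (LINT x:A|M. enn2real (f x))" .
  qed
qed

lemma integrable_mult_bounded_kernel: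
  fixes R :: "'a \<Rightarrow> real"
  assumes "integrable M R" "p \<in> borel_measurable M" "\<And>x. 0 \<le> p x" "\<And>x. p x \<le> (1 :: real)"
  shows "integrable M (\<lambda>x. R x * p x)"
proof (rule Bochner_Integration.integrable_bound[OF assms(1)])
  show "AE x in M. norm (R x * p x) \<le> norm (R x)"
    using assms(3,4) by (intro AE_I2) (simp add: abs_mult mult_left_le)
qed (use assms in measurable)

lemma enn2real_le_1: "x \<le> 1 \<Longrightarrow> enn2real x \<le> 1"
  using enn2real_mono[of x 1] by simp

lemma (in sigma_finite_measure) kernel_density:
  fixes P :: "'a \<Rightarrow> 'a set \<Rightarrow> ennreal" and R :: "'a \<Rightarrow> real"
  assumes le1: "\<And>x A. A \<in> sets M \<Longrightarrow> P x A \<le> 1"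
    and meas: "\<And>A. A \<in> sets M \<Longrightarrow> (\<lambda>x. P x A) \<in> borel_measurable M"
    and add: "\<And>x B. range B \<subseteq> sets M \<Longrightarrow> disjoint_family B \<Longrightarrow> (\<Sum>i :: nat. P x (B i)) = P x (\<Union>i. B i)"
    and null: "\<And>N. N \<in> null_sets M \<Longrightarrow> AE x in M. P x N = 0"
    and R: "integrable M R"
  shows "\<exists>\<rho>. integrable M \<rho> \<and> (\<forall>A\<in>sets M. (\<integral>x. R x * enn2real (P x A) \<partial>M) = (LINT x:A|M. \<rho> x))"
proof -
  have R': "integrable M (\<lambda>x. max 0 (R x))" "integrable M (\<lambda>x. max 0 (- R x))"
    using R by (auto intro!: integrable_max)
  have ex: "\<exists>\<rho>. integrable M \<rho> \<and> (\<forall>A\<in>sets M. (\<integral>x. f x * enn2real (P x A) \<partial>M) = (LINT x:A|M. \<rho> x))"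
    if "integrable M f" "\<And>x. 0 \<le> f x" for f
    by (rule kernel_density_nonneg[OF le1 meas add null that])
  obtain \<rho>1 where \<rho>1: "integrable M \<rho>1"
    "\<And>A. A \<in> sets M \<Longrightarrow> (\<integral>x. max 0 (R x) * enn2real (P x A) \<partial>M) = (LINT x:A|M. \<rho>1 x)"
    using ex[OF R'(1) max.cobounded1] by blast
  obtain \<rho>2 where \<rho>2: "integrable M \<rho>2"
    "\<And>A. A \<in> sets M \<Longrightarrow> (\<integral>x. max 0 (- R x) * enn2real (P x A) \<partial>M) = (LINT x:A|M. \<rho>2 x)"
    using ex[OF R'(2) max.cobounded1] by blast
  have "(\<integral>x. R x * enn2real (P x A) \<partial>M) = (LINT x:A|M. \<rho>1 x - \<rho>2 x)" if A: "A \<in> sets M" for A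
  proof -
    have int: "integrable M (\<lambda>x. f x * enn2real (P x A))" if "integrable M f" for f :: "'a \<Rightarrow> real"
      using that meas[OF A] by (intro integrable_mult_bounded_kernel enn2real_le_1 le1 A) auto
    have "(\<integral>x. R x * enn2real (P x A) \<partial>M) =
        (\<integral>x. max 0 (R x) * enn2real (P x A) - max 0 (- R x) * enn2real (P x A) \<partial>M)"
      by (intro Bochner_Integration.integral_cong) (auto simp: max_def)
    also have "\<dots> = (LINT x:A|M. \<rho>1 x) - (LINT x:A|M. \<rho>2 x)"
      using int R' A by (simp add: \<rho>1(2) \<rho>2(2))
    also have "\<dots> = (LINT x:A|M. \<rho>1 x - \<rho>2 x)"
      using \<rho>1(1) \<rho>2(1) A by (intro set_integral_diff(2)[symmetric])
        (auto simp: set_integrable_def simp del: real_scaleR_def intro: integrable_mult_indicator)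
    finally show ?thesis .
  qed
  then show ?thesis using \<rho>1(1) \<rho>2(1) by (intro exI[of _ "\<lambda>x. \<rho>1 x - \<rho>2 x"]) auto
qed

lemma adjoint_evolution_L1_embed:
  fixes R :: "'a :: euclidean_space fset \<Rightarrow> real"
  assumes R: "integrable lebesgue_poisson R" and A: "A \<in> sets borel"
    and meas: "(\<lambda>\<eta>. transition K s \<eta> t A) \<in> borel_measurable borel"
    and le1: "\<And>\<eta>. transition K s \<eta> t A \<le> 1"
  shows "adjoint_evolution K t s (L1_embed R) A =
    (\<integral>\<eta>. R \<eta> * enn2real (transition K s \<eta> t A) \<partial>lebesgue_poisson)"
proof -
  let ?p = "\<lambda>\<eta>. enn2real (transition K s \<eta> t A)"
  have [measurable]: "?p \<in> borel_measurable lebesgue_poisson"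
    using meas by simp
  have pos: "(\<integral>\<eta>. ?p \<eta> \<partial>positive_variation (L1_embed f)) = (\<integral>\<eta>. max 0 (f \<eta>) * ?p \<eta> \<partial>lebesgue_poisson)"
    if f: "integrable lebesgue_poisson f" for f :: "'a fset \<Rightarrow> real"
  proof -
    have [measurable]: "f \<in> borel_measurable lebesgue_poisson" using f by auto
    have "(\<lambda>\<eta>. ennreal (f \<eta>)) = (\<lambda>\<eta>. ennreal (max 0 (f \<eta>)))"
      by (auto simp: max_def ennreal_neg)
    then have "positive_variation (L1_embed f) = density lebesgue_poisson (\<lambda>\<eta>. ennreal (max 0 (f \<eta>)))"
      using positive_variation_L1_embed[OF f] by simp
    then show ?thesis by (simp add: integral_density)
  qed
  have neg: "(\<lambda>A. - L1_embed R A) = L1_embed (\<lambda>\<eta>. - R \<eta>)"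
    by (auto simp: L1_embed_def set_lebesgue_integral_def)
  have int: "integrable lebesgue_poisson (\<lambda>\<eta>. f \<eta> * ?p \<eta>)" if "integrable lebesgue_poisson f" for f
    using that by (intro integrable_mult_bounded_kernel enn2real_le_1 le1) auto
  have "adjoint_evolution K t s (L1_embed R) A =
      (\<integral>\<eta>. max 0 (R \<eta>) * ?p \<eta> \<partial>lebesgue_poisson) - (\<integral>\<eta>. max 0 (- R \<eta>) * ?p \<eta> \<partial>lebesgue_poisson)"
    using A R by (simp add: adjoint_evolution_def signed_integral_def neg pos)
  also have "\<dots> = (\<integral>\<eta>. max 0 (R \<eta>) * ?p \<eta> - max 0 (- R \<eta>) * ?p \<eta> \<partial>lebesgue_poisson)"
    using R by (intro Bochner_Integration.integral_diff[symmetric] int integrable_max) auto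
  also have "\<dots> = (\<integral>\<eta>. R \<eta> * ?p \<eta> \<partial>lebesgue_poisson)"
    by (intro Bochner_Integration.integral_cong) (auto simp: max_def)
  finally show ?thesis .
qed

text \<open>Split the integral into the set where \<open>f\<close> is at least \<open>g\<close> and its complement.\<close>

lemma integral_abs_diff_le_sets:
  fixes f g :: "'a \<Rightarrow> real"
  assumes f: "integrable M f" and g: "integrable M g"
    and le: "\<And>A. A \<in> sets M \<Longrightarrow> \<bar>(LINT x:A|M. f x) - (LINT x:A|M. g x)\<bar> \<le> B"
  shows "(\<integral>x. \<bar>f x - g x\<bar> \<partial>M) \<le> 2 * B"
proof -
  define A where "A = {x \<in> space M. g x \<le> f x}"
  have [measurable]: "f \<in> borel_measurable M" "g \<in> borel_measurable M" using f g by auto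
  have A: "A \<in> sets M" unfolding A_def by measurable
  have int: "set_integrable M S h" if "S \<in> sets M" "integrable M h" for S and h :: "'a \<Rightarrow> real"
    unfolding set_integrable_def using that by (rule integrable_mult_indicator)
  have "(\<integral>x. \<bar>f x - g x\<bar> \<partial>M) = (\<integral>x. indicator A x *\<^sub>R (f x - g x) - indicator (space M - A) x *\<^sub>R (f x - g x) \<partial>M)"
    by (intro Bochner_Integration.integral_cong) (auto simp: A_def indicator_def)
  also have "\<dots> = (LINT x:A|M. f x - g x) - (LINT x:space M - A|M. f x - g x)"
    unfolding set_lebesgue_integral_def
    using A f g by (intro Bochner_Integration.integral_diff integrable_mult_indicator) auto
  also have "\<dots> = ((LINT x:A|M. f x) - (LINT x:A|M. g x)) - ((LINT x:space M - A|M. f x) - (LINT x:space M - A|M. g x))"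
    using A f g by (subst (1 2) set_integral_diff(2)) (auto intro: int)
  also have "\<dots> \<le> B + B"
    using le[OF A] le[of "space M - A"] A by auto
  finally show ?thesis by simp
qed

section \<open>The adjoint evolution on densities\<close>

context jump_evolution
begin

lemma adjoint_evolution_eq:
  assumes R: "integrable lebesgue_poisson R" and A: "A \<in> sets borel"
  shows "adjoint_evolution K t s (L1_embed R) A =
    (\<integral>\<eta>. R \<eta> * enn2real (transition K s \<eta> t A) \<partial>lebesgue_poisson)"
  using assms by (intro adjoint_evolution_L1_embed measurable_transition transition_le_1)

lemma adjoint_evolution_density:
  assumes K: "\<And>t \<xi> \<eta>. sets (K t \<xi> \<eta>) = sets borel"
    and ac: "\<And>t \<xi> \<eta>. absolutely_continuous lebesgue_poisson (K t \<xi> \<eta>)"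
    and R: "integrable lebesgue_poisson R"
  shows "\<exists>\<rho>. integrable lebesgue_poisson \<rho> \<and> adjoint_evolution K t s (L1_embed R) = L1_embed \<rho>"
proof -
  interpret lp: sigma_finite_measure "lebesgue_poisson :: 'a fset measure"
    by (rule sigma_finite_lebesgue_poisson)
  have "\<exists>\<rho>. integrable lebesgue_poisson \<rho> \<and> (\<forall>A\<in>sets lebesgue_poisson.
      (\<integral>\<eta>. R \<eta> * enn2real (transition K s \<eta> t A) \<partial>lebesgue_poisson) = (LINT \<eta>:A|lebesgue_poisson. \<rho> \<eta>))"
  proof (rule lp.kernel_density[OF _ _ _ _ R])
    show "transition K s \<eta> t A \<le> 1" if "A \<in> sets lebesgue_poisson" for \<eta> A
      using that by (simp add: transition_le_1)
    show "(\<lambda>\<eta>. transition K s \<eta> t A) \<in> borel_measurable lebesgue_poisson" if "A \<in> sets lebesgue_poisson" for A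
      using that by (subst measurable_cong_sets[OF sets_lebesgue_poisson refl]) (simp add: measurable_transition)
    show "(\<Sum>i. transition K s \<eta> t (B i)) = transition K s \<eta> t (\<Union>i. B i)"
      if "range B \<subseteq> sets lebesgue_poisson" "disjoint_family B" for \<eta> and B :: "nat \<Rightarrow> 'a fset set"
      using that by (simp add: transition_countably_additive)
    show "AE \<eta> in lebesgue_poisson. transition K s \<eta> t N = 0" if "N \<in> null_sets lebesgue_poisson" for N
      using K ac that by (rule AE_transition_null)
  qed
  then obtain \<rho> where \<rho>: "integrable lebesgue_poisson \<rho>" "\<And>A. A \<in> sets borel \<Longrightarrow>
      (\<integral>\<eta>. R \<eta> * enn2real (transition K s \<eta> t A) \<partial>lebesgue_poisson) = (LINT \<eta>:A|lebesgue_poisson. \<rho> \<eta>)"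
    by auto
  have "adjoint_evolution K t s (L1_embed R) A = L1_embed \<rho> A" for A
  proof (cases "A \<in> sets borel")
    case True
    then show ?thesis
      unfolding adjoint_evolution_eq[OF R True] by (simp add: \<rho>(2) L1_embed_def)
  next
    case False
    then show ?thesis by (simp add: adjoint_evolution_def L1_embed_def)
  qed
  then show ?thesis using \<rho>(1) by blast
qed

lemma L1_dist_density_le:
  assumes R: "integrable lebesgue_poisson R"
    and \<rho>: "integrable lebesgue_poisson \<rho>" "adjoint_evolution K t s (L1_embed R) = L1_embed \<rho>"
    and \<rho>': "integrable lebesgue_poisson \<rho>'" "adjoint_evolution K t' s' (L1_embed R) = L1_embed \<rho>'"
    and d: "d \<in> borel_measurable borel" "\<And>\<eta> A. A \<in> sets borel \<Longrightarrow>
      \<bar>enn2real (transition K s \<eta> t A) - enn2real (transition K s' \<eta> t' A)\<bar> \<le> d \<eta>"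
  shows "(\<integral>\<eta>. \<bar>\<rho> \<eta> - \<rho>' \<eta>\<bar> \<partial>lebesgue_poisson) \<le> 2 * (\<integral>\<eta>. \<bar>R \<eta>\<bar> * min 1 (d \<eta>) \<partial>lebesgue_poisson)"
proof (rule integral_abs_diff_le_sets[OF \<rho>(1) \<rho>'(1)])
  fix A :: "'a fset set" assume "A \<in> sets lebesgue_poisson"
  then have A: "A \<in> sets borel" by simp
  have d0: "0 \<le> d \<eta>" for \<eta>
    using d(2)[OF A, of \<eta>] by linarith
  let ?p = "\<lambda>s t \<eta>. enn2real (transition K s \<eta> t A)"
  have p: "?p s t \<eta> \<le> 1" for s t \<eta>
    by (intro enn2real_le_1 transition_le_1 A)
  have int: "integrable lebesgue_poisson (\<lambda>\<eta>. R \<eta> * ?p s t \<eta>)" for s t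
    using measurable_transition[OF A, of s t] by (intro integrable_mult_bounded_kernel R p) auto
  have "\<bar>(LINT \<eta>:A|lebesgue_poisson. \<rho> \<eta>) - (LINT \<eta>:A|lebesgue_poisson. \<rho>' \<eta>)\<bar> =
      \<bar>(\<integral>\<eta>. R \<eta> * ?p s t \<eta> \<partial>lebesgue_poisson) - (\<integral>\<eta>. R \<eta> * ?p s' t' \<eta> \<partial>lebesgue_poisson)\<bar>"
  proof -
    have embed: "(LINT \<eta>:A|lebesgue_poisson. f \<eta>) = L1_embed f A" for f :: "'a fset \<Rightarrow> real"
      using A by (simp add: L1_embed_def)
    show ?thesis
      unfolding embed \<rho>(2)[symmetric] \<rho>'(2)[symmetric] adjoint_evolution_eq[OF R A] ..
  qed
  also have "\<dots> = \<bar>\<integral>\<eta>. R \<eta> * ?p s t \<eta> - R \<eta> * ?p s' t' \<eta> \<partial>lebesgue_poisson\<bar>"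
    using int by simp
  also have "\<dots> \<le> (\<integral>\<eta>. \<bar>R \<eta> * ?p s t \<eta> - R \<eta> * ?p s' t' \<eta>\<bar> \<partial>lebesgue_poisson)"
    by (rule integral_abs_bound)
  also have "\<dots> \<le> (\<integral>\<eta>. \<bar>R \<eta>\<bar> * min 1 (d \<eta>) \<partial>lebesgue_poisson)"
  proof (rule integral_mono)
    show "integrable lebesgue_poisson (\<lambda>\<eta>. \<bar>R \<eta> * ?p s t \<eta> - R \<eta> * ?p s' t' \<eta>\<bar>)"
      using int by auto
    show "integrable lebesgue_poisson (\<lambda>\<eta>. \<bar>R \<eta>\<bar> * min 1 (d \<eta>))"
      using R d(1) d0 by (intro integrable_mult_bounded_kernel) auto
    fix \<eta>
    have "0 \<le> ?p s t \<eta>" "0 \<le> ?p s' t' \<eta>" by simp_all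
    then have "\<bar>?p s t \<eta> - ?p s' t' \<eta>\<bar> \<le> min 1 (d \<eta>)"
      using p[of s \<eta> t] p[of s' \<eta> t'] d(2)[OF A, of \<eta>] by (intro min.boundedI) linarith+
    from mult_left_mono[OF this, of "\<bar>R \<eta>\<bar>"]
    show "\<bar>R \<eta> * ?p s t \<eta> - R \<eta> * ?p s' t' \<eta>\<bar> \<le> \<bar>R \<eta>\<bar> * min 1 (d \<eta>)"
      by (simp add: abs_mult flip: right_diff_distrib)
  qed
  finally show "\<bar>(LINT \<eta>:A|lebesgue_poisson. \<rho> \<eta>) - (LINT \<eta>:A|lebesgue_poisson. \<rho>' \<eta>)\<bar> \<le>
    (\<integral>\<eta>. \<bar>R \<eta>\<bar> * min 1 (d \<eta>) \<partial>lebesgue_poisson)" .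
qed

text \<open>The truncation at 1 in \<open>L1_dist_density_le\<close> supplies the majorant \<open>\<bar>R\<bar>\<close> for dominated
  convergence, whatever the growth of \<open>W\<close>.\<close>

lemma L1_continuous_density:
  fixes \<rho> :: "real \<Rightarrow> real \<Rightarrow> 'a fset \<Rightarrow> real"
  assumes R: "integrable lebesgue_poisson R"
    and \<rho>: "\<And>s t. 0 \<le> s \<Longrightarrow> s \<le> t \<Longrightarrow>
      integrable lebesgue_poisson (\<rho> s t) \<and> adjoint_evolution K t s (L1_embed R) = L1_embed (\<rho> s t)"
    and st: "0 \<le> s\<^sub>0" "s\<^sub>0 \<le> t\<^sub>0"
    and W: "W \<in> borel_measurable borel"
    and lip: "\<And>s t \<eta> A. 0 \<le> s \<Longrightarrow> s \<le> t \<Longrightarrow> t \<le> t\<^sub>0 + 1 \<Longrightarrow> A \<in> sets borel \<Longrightarrow>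
      \<bar>enn2real (transition K s \<eta> t A) - enn2real (transition K s\<^sub>0 \<eta> t\<^sub>0 A)\<bar> \<le>
        (\<bar>s - s\<^sub>0\<bar> + \<bar>t - t\<^sub>0\<bar>) * W \<eta>"
  shows "((\<lambda>(s, t). \<integral>\<eta>. \<bar>\<rho> s t \<eta> - \<rho> s\<^sub>0 t\<^sub>0 \<eta>\<bar> \<partial>lebesgue_poisson) \<longlongrightarrow> 0)
    (at (s\<^sub>0, t\<^sub>0) within {(s, t). 0 \<le> s \<and> s \<le> t})"
proof -
  define \<delta> where "\<delta> p = \<bar>fst p - s\<^sub>0\<bar> + \<bar>snd p - t\<^sub>0\<bar>" for p :: "real \<times> real"
  define \<Phi> where "\<Phi> p = 2 * (\<integral>\<eta>. \<bar>R \<eta>\<bar> * min 1 (\<delta> p * \<bar>W \<eta>\<bar>) \<partial>lebesgue_poisson)" for p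
  let ?F = "at (s\<^sub>0, t\<^sub>0) within {(s, t). 0 \<le> s \<and> s \<le> t}"
  have [measurable]: "R \<in> borel_measurable lebesgue_poisson" using R by auto
  have [measurable]: "W \<in> borel_measurable lebesgue_poisson" using W by simp
  have "(\<Phi> \<longlongrightarrow> 0) ?F"
    unfolding tendsto_at_iff_sequentially
  proof (intro allI impI)
    fix X :: "nat \<Rightarrow> real \<times> real" assume X: "X \<longlonglongrightarrow> (s\<^sub>0, t\<^sub>0)"
    have "(\<lambda>n. \<delta> (X n)) \<longlonglongrightarrow> \<bar>fst (s\<^sub>0, t\<^sub>0) - s\<^sub>0\<bar> + \<bar>snd (s\<^sub>0, t\<^sub>0) - t\<^sub>0\<bar>"
      unfolding \<delta>_def by (intro tendsto_intros X)
    then have \<delta>: "(\<lambda>n. \<delta> (X n)) \<longlonglongrightarrow> 0" by simp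
    have "(\<lambda>n. \<integral>\<eta>. \<bar>R \<eta>\<bar> * min 1 (\<delta> (X n) * \<bar>W \<eta>\<bar>) \<partial>lebesgue_poisson) \<longlonglongrightarrow>
        (\<integral>\<eta>. 0 \<partial>(lebesgue_poisson :: 'a fset measure))"
    proof (rule integral_dominated_convergence[where w = "\<lambda>\<eta>. \<bar>R \<eta>\<bar>"])
      show "AE \<eta> in lebesgue_poisson. (\<lambda>n. \<bar>R \<eta>\<bar> * min 1 (\<delta> (X n) * \<bar>W \<eta>\<bar>)) \<longlonglongrightarrow> 0"
      proof (intro AE_I2)
        fix \<eta>
        have "(\<lambda>n. \<bar>R \<eta>\<bar> * min 1 (\<delta> (X n) * \<bar>W \<eta>\<bar>)) \<longlonglongrightarrow> \<bar>R \<eta>\<bar> * min 1 (0 * \<bar>W \<eta>\<bar>)"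
          by (intro tendsto_intros \<delta>)
        then show "(\<lambda>n. \<bar>R \<eta>\<bar> * min 1 (\<delta> (X n) * \<bar>W \<eta>\<bar>)) \<longlonglongrightarrow> 0" by simp
      qed
      show "AE \<eta> in lebesgue_poisson. norm (\<bar>R \<eta>\<bar> * min 1 (\<delta> (X n) * \<bar>W \<eta>\<bar>)) \<le> \<bar>R \<eta>\<bar>" for n
      proof (intro AE_I2)
        fix \<eta>
        have "0 \<le> min 1 (\<delta> (X n) * \<bar>W \<eta>\<bar>)" by (simp add: \<delta>_def)
        then show "norm (\<bar>R \<eta>\<bar> * min 1 (\<delta> (X n) * \<bar>W \<eta>\<bar>)) \<le> \<bar>R \<eta>\<bar>"
          by (simp add: abs_mult mult_left_le)
      qed
    qed (use R in auto)
    from tendsto_mult_left[OF this, of 2] show "(\<Phi> \<circ> X) \<longlonglongrightarrow> 0"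
      by (simp add: \<Phi>_def o_def)
  qed
  moreover have "\<forall>\<^sub>F p in ?F. norm (case p of (s, t) \<Rightarrow> \<integral>\<eta>. \<bar>\<rho> s t \<eta> - \<rho> s\<^sub>0 t\<^sub>0 \<eta>\<bar> \<partial>lebesgue_poisson) \<le> \<Phi> p"
    unfolding eventually_at
  proof (intro exI[of _ 1] conjI ballI impI)
    fix p assume p: "p \<in> {(s, t). 0 \<le> s \<and> s \<le> t}" "p \<noteq> (s\<^sub>0, t\<^sub>0) \<and> dist p (s\<^sub>0, t\<^sub>0) < 1"
    obtain s t where pst: "p = (s, t)" by (cases p)
    have "dist t t\<^sub>0 < 1"
      using dist_snd_le[of p "(s\<^sub>0, t\<^sub>0)"] p(2) pst by simp
    then have t: "t \<le> t\<^sub>0 + 1" by (simp add: dist_real_def)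
    have s: "0 \<le> s" "s \<le> t" using p pst by auto
    have "(\<integral>\<eta>. \<bar>\<rho> s t \<eta> - \<rho> s\<^sub>0 t\<^sub>0 \<eta>\<bar> \<partial>lebesgue_poisson) \<le> \<Phi> p"
      unfolding \<Phi>_def
    proof (rule L1_dist_density_le[OF R])
      fix \<eta> and A :: "'a fset set" assume "A \<in> sets borel"
      then have "\<bar>enn2real (transition K s \<eta> t A) - enn2real (transition K s\<^sub>0 \<eta> t\<^sub>0 A)\<bar> \<le> \<delta> p * W \<eta>"
        using lip[OF s t] by (simp add: \<delta>_def pst)
      also have "\<dots> \<le> \<delta> p * \<bar>W \<eta>\<bar>"
        by (intro mult_left_mono) (auto simp: \<delta>_def)
      finally show "\<bar>enn2real (transition K s \<eta> t A) - enn2real (transition K s\<^sub>0 \<eta> t\<^sub>0 A)\<bar> \<le> \<delta> p * \<bar>W \<eta>\<bar>" .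
    qed (use \<rho>[OF s] \<rho>[OF st] W in auto)
    then show "norm (case p of (s, t) \<Rightarrow> \<integral>\<eta>. \<bar>\<rho> s t \<eta> - \<rho> s\<^sub>0 t\<^sub>0 \<eta>\<bar> \<partial>lebesgue_poisson) \<le> \<Phi> p"
      by (simp add: pst)
  qed simp
  ultimately show ?thesis
    by (rule Lim_null_comparison[rotated])
qed

end

section \<open>Extension to negative times\<close>

text \<open>The hypotheses on the kernels concern nonnegative times only. Continuing a family by its value
  at time 0 preserves them, and evolutions that start at a nonnegative time do not see the difference.\<close>

definition extend_time :: "(real \<Rightarrow> 'b) \<Rightarrow> real \<Rightarrow> 'b" where
  "extend_time K t = K (max 0 t)"

lemma extend_time_nonneg: "0 \<le> t \<Longrightarrow> extend_time K t = K t"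
  by (simp add: extend_time_def)

lemma jump_kernel_extend_time: "0 \<le> t \<Longrightarrow> jump_kernel (extend_time K) t \<eta> = jump_kernel K t \<eta>"
  by (simp add: jump_kernel_def extend_time_nonneg)

lemma jump_rate_extend_time: "0 \<le> t \<Longrightarrow> jump_rate (extend_time K) t \<eta> = jump_rate K t \<eta>"
  by (simp add: jump_rate_def jump_kernel_extend_time)

lemma transition_term_extend_time:
  "0 \<le> s \<Longrightarrow> transition_term (extend_time K) n s \<eta> t A = transition_term K n s \<eta> t A"
proof (induction n arbitrary: s \<eta>)
  have rate: "(LBINT \<tau>:{s..r}. jump_rate (extend_time K) \<tau> \<eta>) = (LBINT \<tau>:{s..r}. jump_rate K \<tau> \<eta>)"
    if "0 \<le> s" for s r \<eta>
    unfolding set_lebesgue_integral_def using that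
    by (intro Bochner_Integration.integral_cong) (auto simp: indicator_def jump_rate_extend_time)
  {
    case 0
    then show ?case by (simp add: rate)
  next
    case (Suc n)
    have "(\<integral>\<^sup>+\<omega>. transition_term (extend_time K) n r \<omega> t A \<partial>jump_kernel (extend_time K) r \<eta>) =
        (\<integral>\<^sup>+\<omega>. transition_term K n r \<omega> t A \<partial>jump_kernel K r \<eta>)" if "s \<le> r" for r
      using that Suc.prems by (simp add: Suc.IH jump_kernel_extend_time)
    then show ?case
      using Suc.prems by (auto simp: rate indicator_def intro!: nn_integral_cong)
  }
qed

lemma adjoint_evolution_extend_time:
  "0 \<le> s \<Longrightarrow> adjoint_evolution (extend_time K) t s = adjoint_evolution K t s"
  by (simp add: adjoint_evolution_def transition_def transition_term_extend_time fun_eq_iff)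

theorem theorem3p2:
  fixes K :: "real \<Rightarrow> 'a :: euclidean_space fset \<Rightarrow> 'a fset \<Rightarrow> 'a fset measure"
    and V :: "'a fset \<Rightarrow> real" and c :: "real \<Rightarrow> real"
  assumes K: "usual_conditions K"
    and K_ac: "\<And>t \<xi> \<eta>. t \<ge> 0 \<Longrightarrow> absolutely_continuous lebesgue_poisson (K t \<xi> \<eta>)"
    and A: "\<And>\<epsilon> T B. \<epsilon> > 0 \<Longrightarrow> T > 0 \<Longrightarrow> compact B \<Longrightarrow>
      \<exists>A. compact A \<and>
        (\<forall>\<eta>\<in>B. (\<integral>\<^sup>+r\<in>{0..T}. emeasure (jump_kernel K r \<eta>) (- A) \<partial>lborel) < ennreal \<epsilon>)"
    and V: "continuous_on UNIV V" "\<And>\<eta>. V \<eta> \<ge> 0"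
    and c: "continuous_on {0..} c" "\<And>t. t \<ge> 0 \<Longrightarrow> c t \<ge> 0"
    and B: "\<And>t \<eta>. t \<ge> 0 \<Longrightarrow>
      (\<Sum>\<xi> | \<xi> |\<subseteq>| \<eta>. \<integral>\<^sup>+\<zeta>. ennreal (V (\<eta> |-| \<xi> |\<union>| \<zeta>)) \<partial>K t \<xi> \<eta>)
        \<le> ennreal (c t * V \<eta> + jump_rate K t \<eta> * V \<eta>)"
    and C: "\<And>F :: 'a fset \<Rightarrow> real. continuous_on UNIV F \<Longrightarrow>
      bdd_above (range (\<lambda>\<eta>. \<bar>F \<eta>\<bar> / (1 + V \<eta>))) \<Longrightarrow>
      continuous_on ({0..} \<times> UNIV)
        (\<lambda>(t, \<eta>). \<Sum>\<xi> | \<xi> |\<subseteq>| \<eta>. \<integral>\<zeta>. F (\<eta> |-| \<xi> |\<union>| \<zeta>) \<partial>K t \<xi> \<eta>)"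
    and D: "\<And>T. T > 0 \<Longrightarrow> \<exists>a>0. \<forall>\<eta>. \<forall>t\<in>{0..T}. jump_rate K t \<eta> \<le> a * V \<eta>"
    and E: "\<And>T. T > 0 \<Longrightarrow> \<exists>b>0. \<forall>\<eta>. \<forall>t\<in>{0..T}. jump_rate K t \<eta> \<ge> b * jump_rate K T \<eta>"
  shows "L1_invariant (adjoint_evolution K) \<and> L1_strongly_continuous (adjoint_evolution K)"
proof -
  define K' where "K' = extend_time K"
  have sets: "sets (K' t \<xi> \<eta>) = sets borel" and fin: "finite_measure (K' t \<xi> \<eta>)" for t \<xi> \<eta>
    using K by (auto simp: usual_conditions_def K'_def extend_time_def)
  have ac: "absolutely_continuous lebesgue_poisson (K' t \<xi> \<eta>)" for t \<xi> \<eta>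
    using K_ac by (simp add: K'_def extend_time_def)
  interpret jump_evolution K'
  proof (rule jump_evolutionI[OF sets fin])
    fix F :: "'a fset \<Rightarrow> real" assume F: "continuous_on UNIV F" "\<And>\<eta>. 0 \<le> F \<eta> \<and> F \<eta> \<le> 1"
    have "\<bar>F \<eta>\<bar> / (1 + V \<eta>) \<le> 1" for \<eta>
      using F(2)[of \<eta>] V(2)[of \<eta>] by (simp add: divide_le_eq)
    then have "bdd_above (range (\<lambda>\<eta>. \<bar>F \<eta>\<bar> / (1 + V \<eta>)))"
      by (intro bdd_aboveI[of _ 1]) auto
    note cont = C[OF F(1) this]
    have "continuous_on UNIV (\<lambda>p. case (max 0 (fst p), snd p) of (t, \<eta>) \<Rightarrow>
        \<Sum>\<xi> | \<xi> |\<subseteq>| \<eta>. \<integral>\<zeta>. F (\<eta> |-| \<xi> |\<union>| \<zeta>) \<partial>K t \<xi> \<eta>)"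
      by (rule continuous_on_compose2[OF cont])
        (auto intro!: continuous_on_Pair continuous_on_max continuous_on_fst continuous_on_snd)
    then show "continuous_on UNIV (\<lambda>(t, \<eta>). \<Sum>\<xi> | \<xi> |\<subseteq>| \<eta>. \<integral>\<zeta>. F (\<eta> |-| \<xi> |\<union>| \<zeta>) \<partial>K' t \<xi> \<eta>)"
      by (simp add: case_prod_unfold K'_def extend_time_def)
  qed
  have Vm: "V \<in> borel_measurable borel"
    using V(1) by (rule borel_measurable_continuous_onI)
  have evol: "adjoint_evolution K t s = adjoint_evolution K' t s" if "0 \<le> s" for s t
    using that by (simp add: K'_def adjoint_evolution_extend_time)
  have inv: "L1_invariant (adjoint_evolution K)"
    unfolding L1_invariant_def
  proof (intro allI impI subsetI)
    fix s t :: real and \<mu> assume "0 \<le> s" "\<mu> \<in> adjoint_evolution K t s ` L1_measures"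
    then obtain R where R: "integrable lebesgue_poisson R" "\<mu> = adjoint_evolution K' t s (L1_embed R)"
      by (auto simp: L1_measures_def evol)
    from adjoint_evolution_density[OF sets ac R(1), of t s]
    obtain \<rho> where "integrable lebesgue_poisson \<rho>" "\<mu> = L1_embed \<rho>"
      unfolding R(2) by (elim exE conjE)
    then show "\<mu> \<in> L1_measures"
      unfolding L1_measures_def by (intro image_eqI[of _ _ \<rho>] CollectI)
  qed
  \<comment> \<open>The constant is \<open>L = a(T) e\<^bsup>C T\<^esup>\<close> with \<open>C\<close> an upper bound of \<open>c\<close> on \<open>[0, T]\<close>.\<close>
  have lip: "\<exists>L. \<forall>s\<in>{0..T}. \<forall>s'\<in>{0..T}. \<forall>t\<in>{0..T}. \<forall>t'\<in>{0..T}. \<forall>\<eta>. \<forall>A\<in>sets borel.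
      \<bar>enn2real (transition K' s \<eta> t A) - enn2real (transition K' s' \<eta> t' A)\<bar> \<le>
        (\<bar>s - s'\<bar> + \<bar>t - t'\<bar>) * (L * V \<eta>)" if T: "0 < T" for T
  proof -
    obtain a where a: "a > 0" "\<And>\<eta> t. t \<in> {0..T} \<Longrightarrow> jump_rate K t \<eta> \<le> a * V \<eta>"
      using D[OF T] by blast
    have "\<exists>x\<in>{0..T}. \<forall>y\<in>{0..T}. c y \<le> c x"
      using T by (intro continuous_attains_sup continuous_on_subset[OF c(1)]) auto
    then obtain C where C: "0 \<le> C" "\<And>t. t \<in> {0..T} \<Longrightarrow> c t \<le> C"
      using c(2) by (metis atLeastAtMost_iff)
    have L: "(\<integral>\<^sup>+\<omega>. ennreal (V \<omega>) \<partial>jump_kernel K' r \<eta>) \<le> ennreal ((C + jump_rate K' r \<eta>) * V \<eta>)"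
      if r: "0 \<le> r" "r \<le> T" for r \<eta>
    proof -
      have "(\<integral>\<^sup>+\<omega>. ennreal (V \<omega>) \<partial>jump_kernel K' r \<eta>) =
          (\<Sum>\<xi> | \<xi> |\<subseteq>| \<eta>. \<integral>\<^sup>+\<zeta>. ennreal (V (\<eta> |-| \<xi> |\<union>| \<zeta>)) \<partial>K r \<xi> \<eta>)"
        using Vm r by (subst nn_integral_jump_kernel[OF sets]) (auto simp: K'_def extend_time_nonneg)
      also have "\<dots> \<le> ennreal (c r * V \<eta> + jump_rate K r \<eta> * V \<eta>)"
        by (rule B[OF r(1)])
      also have "\<dots> \<le> ennreal ((C + jump_rate K' r \<eta>) * V \<eta>)"
        using C(2)[of r] r V(2)[of \<eta>]
        by (intro ennreal_leI) (simp add: K'_def jump_rate_extend_time ring_distribs mult_right_mono)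
      finally show ?thesis .
    qed
    have q: "jump_rate K' r \<eta> \<le> a * V \<eta>" if "0 \<le> r" "r \<le> T" for r \<eta>
      using a(2)[of r \<eta>] that by (simp add: K'_def jump_rate_extend_time)
    show ?thesis
      using transition_lipschitz[OF _ C(1) less_imp_le[OF a(1)] Vm V(2) L q]
      by (intro exI[of _ "a * exp (C * T)"]) blast
  qed
  have "L1_strongly_continuous (adjoint_evolution K)"
    unfolding L1_strongly_continuous_def
  proof (intro allI impI)
    fix R :: "'a fset \<Rightarrow> real" assume R: "integrable lebesgue_poisson R"
    define \<rho> where "\<rho> s t =
      (SOME r. integrable lebesgue_poisson r \<and> adjoint_evolution K' t s (L1_embed R) = L1_embed r)" for s t
    have \<rho>: "integrable lebesgue_poisson (\<rho> s t) \<and> adjoint_evolution K' t s (L1_embed R) = L1_embed (\<rho> s t)" for s t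
      unfolding \<rho>_def by (rule someI_ex[OF adjoint_evolution_density[OF sets ac R]])
    show "\<exists>\<rho>. (\<forall>s t. 0 \<le> s \<longrightarrow> s \<le> t \<longrightarrow>
              integrable lebesgue_poisson (\<rho> s t) \<and> adjoint_evolution K t s (L1_embed R) = L1_embed (\<rho> s t)) \<and>
          (\<forall>s\<^sub>0 t\<^sub>0. 0 \<le> s\<^sub>0 \<longrightarrow> s\<^sub>0 \<le> t\<^sub>0 \<longrightarrow>
              ((\<lambda>(s, t). \<integral>\<eta>. \<bar>\<rho> s t \<eta> - \<rho> s\<^sub>0 t\<^sub>0 \<eta>\<bar> \<partial>lebesgue_poisson) \<longlongrightarrow> 0)
                (at (s\<^sub>0, t\<^sub>0) within {(s, t). 0 \<le> s \<and> s \<le> t}))"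
    proof (rule exI[of _ \<rho>], intro conjI allI impI)
      fix s t :: real assume "0 \<le> s" "s \<le> t"
      then show "integrable lebesgue_poisson (\<rho> s t)" "adjoint_evolution K t s (L1_embed R) = L1_embed (\<rho> s t)"
        using \<rho> by (simp_all add: evol)
    next
      fix s\<^sub>0 t\<^sub>0 :: real assume st: "0 \<le> s\<^sub>0" "s\<^sub>0 \<le> t\<^sub>0"
      then have "0 < t\<^sub>0 + 1" by simp
      from lip[OF this] obtain L where L: "\<And>s s' t t' \<eta> A. \<lbrakk>s \<in> {0..t\<^sub>0 + 1}; s' \<in> {0..t\<^sub>0 + 1};
          t \<in> {0..t\<^sub>0 + 1}; t' \<in> {0..t\<^sub>0 + 1}; A \<in> sets borel\<rbrakk> \<Longrightarrow>
          \<bar>enn2real (transition K' s \<eta> t A) - enn2real (transition K' s' \<eta> t' A)\<bar> \<le>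
            (\<bar>s - s'\<bar> + \<bar>t - t'\<bar>) * (L * V \<eta>)"
        by blast
      show "((\<lambda>(s, t). \<integral>\<eta>. \<bar>\<rho> s t \<eta> - \<rho> s\<^sub>0 t\<^sub>0 \<eta>\<bar> \<partial>lebesgue_poisson) \<longlongrightarrow> 0)
          (at (s\<^sub>0, t\<^sub>0) within {(s, t). 0 \<le> s \<and> s \<le> t})"
        by (rule L1_continuous_density[OF R \<rho> st, of "\<lambda>\<eta>. L * V \<eta>"]) (use Vm st in \<open>auto intro!: L\<close>)
    qed
  qed
  with inv show ?thesis ..
qed

end
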